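(* Let $\mathcal{X}=(x_n)_{n=1}^\infty$ be an almost greedy basis of a superreflexive Banach space $\mathbb{X}$, and let $w=(w_n)_{n=1}^\infty$ be the weight defined by \[ \sum_{n=1}^m w_n=\varphi_u[\mathcal{X},\mathbb{X}](m),\qquad m\in\mathbb{N}. \] Then there are $1<q<r<\infty$ such that $d_{1,q}(w)$ embeds in $\mathbb{X}$ via $\mathcal{X}$ and $\mathbb{X}$ embeds in $d_{1,r}(w)$ via $\mathcal{X}$.
   Context: $\mathbb{X}$ is an infinite-dimensional separable Banach space over $\mathbb{F}\in\{\mathbb{R},\mathbb{C}\}$. A Banach space is superreflexive if every Banach space finitely representable in it is reflexive (equivalently, it admits an equivalent uniformly convex norm). Basis: a sequence $\mathcal{X}=(x_n)_{n=1}^\infty$ in $\mathbb{X}$ with dense linear span, for which there is a (unique) sequence $(x_n^* )_{n=1}^\infty$ in $\mathbb{X}^*$ such that $(x_n,x_n^* )_n$ is a biorthogonal system, and with $\inf_n\|x_n\|>0$, $\sup_n\|x_n\|<\infty$. The coefficient transform is $\mathcal{F}(f)=(x_n^*(f))_{n=1}^\infty$. Thresholding greedy algorithm: $\mathcal{G}_m(f)$ is the sum of the $m$ terms $x_n^*(f)x_n$ whose coefficients are largest in modulus, ties being resolved by taking the terms in the basis order. (It is part of the notions defined through $\mathcal{G}_m$ that it is well defined on $\mathbb{X}$, i.e. $\mathcal{F}(f)\in c_0$ for all $f\in\mathbb{X}$, equivalently $\sup_n\|x_n^*\|<\infty$.) The basis is almost greedy if there is a constant $C$ such that $\|f-\mathcal{G}_m(f)\|\le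 C\|f-\sum_{n\in A}x_n^*(f)x_n\|$ for all $f\in\mathbb{X}$, $m\in\mathbb{N}$ and $A\subseteq\mathbb{N}$ with $|A|\le m$. Fundamental function: $\varphi_u[\mathcal{X},\mathbb{X}](m)=\sup\{\|\sum_{n\in A}\varepsilon_n x_n\|: |A|\le m,\ |\varepsilon_n|=1\}$. Lorentz sequence spaces: a weight is a sequence $w=(w_n)_{n=1}^\infty$ of non-negative scalars with $w_1>0$; its primitive sequence is $s_m=\sum_{n=1}^m w_n$. For $0<q<\infty$ and $f\in c_0$ with non-increasing rearrangement $f^*=(a_n)_{n=1}^\infty$ of $|f|$, $\|f\|_{1,q,w}=\left(\sum_{n=1}^\infty (a_ns_n)^q\frac{w_n}{s_n}\right)^{1/q}$, and $d_{1,q}(w)=\{f\in c_0:\|f\|_{1,q,w}<\infty\}$. Embeddings: for a sequence space $\mathbb{Y}\subseteq\mathbb{F}^{\mathbb{N}}$, "$\mathbb{X}$ embeds in $\mathbb{Y}$ via $\mathcal{X}$" means $\mathcal{F}(f)\in\mathbb{Y}$ for all $f\in\mathbb{X}$ (equivalently $\mathcal{F}:\mathbb{X}\to\mathbb{Y}$ is bounded); "$\mathbb{Y}$ embeds in $\mathbb{X}$ via $\mathcal{X}$" means $\sum_{n=1}^\infty a_nx_n$ converges in $\mathbb{X}$ for every $(a_n)_{n=1}^\infty\in\mathbb{Y}$ (equivalently $(a_n)\mapsto\sum a_nx_n$ is bounded from $\mathbb{Y}$ to $\mathbb{X}$). *)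

theory Defs
  imports "HOL-Analysis.Analysis"
begin

section \<open>Banach spaces over the real or complex field\<close>

text \<open>
  The scalar field is a type of sort \<open>{real_normed_field, euclidean_space}\<close>. Both \<open>real\<close> and
  \<open>complex\<close> have this sort and, by Frobenius' theorem, every type of this sort is isometrically
  isomorphic to one of them as a normed field. The type class \<open>banach\<close> only provides real scalar
  multiplication, so the multiplication by scalars of the field is a parameter extending it.
\<close>

locale banach_over = vector_space smul
  for smul :: "'k::{real_normed_field,euclidean_space} \<Rightarrow> 'a::banach \<Rightarrow> 'a" +
  assumes scale_of_real: "smul (of_real t) v = t *\<^sub>R v"
    and norm_scale: "norm (smul c v) = norm c * norm v"

definition infinite_dimensional :: "('k::field \<Rightarrow> 'a::ab_group_add \<Rightarrow> 'a) \<Rightarrow> bool" where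
  "infinite_dimensional smul \<longleftrightarrow> \<not> (\<exists>B. finite B \<and> module.span smul B = UNIV)"

definition separable_type :: "'a::topological_space itself \<Rightarrow> bool" where
  "separable_type _ \<longleftrightarrow> (\<exists>D::'a set. countable D \<and> closure D = UNIV)"


section \<open>Superreflexivity\<close>

text \<open>
  Superreflexivity quantifies over Banach spaces, inside a formula, and reflexivity speaks about
  duals. Both require Banach spaces with an explicit carrier.
\<close>

record ('k, 'b) nspace =
  vcarrier :: "'b set"
  vzero :: 'b
  vadd :: "'b \<Rightarrow> 'b \<Rightarrow> 'b"
  vscale :: "'k \<Rightarrow> 'b \<Rightarrow> 'b"
  vnorm :: "'b \<Rightarrow> real"

definition vdist :: "('k::{real_normed_field,euclidean_space}, 'b) nspace \<Rightarrow> 'b \<Rightarrow> 'b \<Rightarrow> real" where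
  "vdist Y u v = vnorm Y (vadd Y u (vscale Y (-1) v))"

locale banach_space =
  fixes Y :: "('k::{real_normed_field,euclidean_space}, 'b) nspace"
  assumes zero_closed: "vzero Y \<in> vcarrier Y"
    and add_closed: "\<lbrakk>u \<in> vcarrier Y; v \<in> vcarrier Y\<rbrakk> \<Longrightarrow> vadd Y u v \<in> vcarrier Y"
    and scale_closed: "u \<in> vcarrier Y \<Longrightarrow> vscale Y c u \<in> vcarrier Y"
    and add_assoc: "\<lbrakk>u \<in> vcarrier Y; v \<in> vcarrier Y; t \<in> vcarrier Y\<rbrakk> \<Longrightarrow>
      vadd Y (vadd Y u v) t = vadd Y u (vadd Y v t)"
    and add_commute: "\<lbrakk>u \<in> vcarrier Y; v \<in> vcarrier Y\<rbrakk> \<Longrightarrow> vadd Y u v = vadd Y v u"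
    and add_zero: "u \<in> vcarrier Y \<Longrightarrow> vadd Y (vzero Y) u = u"
    and add_inverse: "u \<in> vcarrier Y \<Longrightarrow> \<exists>v\<in>vcarrier Y. vadd Y u v = vzero Y"
    and scale_add_right: "\<lbrakk>u \<in> vcarrier Y; v \<in> vcarrier Y\<rbrakk> \<Longrightarrow>
      vscale Y c (vadd Y u v) = vadd Y (vscale Y c u) (vscale Y c v)"
    and scale_add_left: "u \<in> vcarrier Y \<Longrightarrow>
      vscale Y (c + d) u = vadd Y (vscale Y c u) (vscale Y d u)"
    and scale_scale: "u \<in> vcarrier Y \<Longrightarrow> vscale Y c (vscale Y d u) = vscale Y (c * d) u"
    and scale_one: "u \<in> vcarrier Y \<Longrightarrow> vscale Y 1 u = u"
    and norm_eq_zero: "u \<in> vcarrier Y \<Longrightarrow> vnorm Y u = 0 \<longleftrightarrow> u = vzero Y"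
    and norm_scaled: "u \<in> vcarrier Y \<Longrightarrow> vnorm Y (vscale Y c u) = norm c * vnorm Y u"
    and norm_triangle: "\<lbrakk>u \<in> vcarrier Y; v \<in> vcarrier Y\<rbrakk> \<Longrightarrow>
      vnorm Y (vadd Y u v) \<le> vnorm Y u + vnorm Y v"
    and complete: "\<lbrakk>\<And>n. s n \<in> vcarrier Y;
      \<forall>e>0. \<exists>N. \<forall>m\<ge>N. \<forall>n\<ge>N. vdist Y (s m) (s n) < e\<rbrakk> \<Longrightarrow>
      \<exists>l\<in>vcarrier Y. (\<lambda>n. vdist Y (s n) l) \<longlonglongrightarrow> 0"

definition space_of :: "('k \<Rightarrow> 'a::real_normed_vector \<Rightarrow> 'a) \<Rightarrow> ('k, 'a) nspace" where
  "space_of smul = \<lparr>vcarrier = UNIV, vzero = 0, vadd = (+), vscale = smul, vnorm = norm\<rparr>"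

definition lin_subspace :: "('k, 'b) nspace \<Rightarrow> 'b set \<Rightarrow> bool" where
  "lin_subspace Y E \<longleftrightarrow> E \<subseteq> vcarrier Y \<and> vzero Y \<in> E \<and>
     (\<forall>u\<in>E. \<forall>v\<in>E. vadd Y u v \<in> E) \<and> (\<forall>c. \<forall>u\<in>E. vscale Y c u \<in> E)"

definition lin_span :: "('k, 'b) nspace \<Rightarrow> 'b set \<Rightarrow> 'b set" where
  "lin_span Y B = \<Inter>{E. lin_subspace Y E \<and> B \<subseteq> E}"

definition lin_map_on :: "('k, 'b) nspace \<Rightarrow> 'b set \<Rightarrow> ('k, 'c) nspace \<Rightarrow> ('b \<Rightarrow> 'c) \<Rightarrow> bool" where
  "lin_map_on Y E Z T \<longleftrightarrow> T ` E \<subseteq> vcarrier Z \<and>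
     (\<forall>u\<in>E. \<forall>v\<in>E. T (vadd Y u v) = vadd Z (T u) (T v)) \<and>
     (\<forall>c. \<forall>u\<in>E. T (vscale Y c u) = vscale Z c (T u))"

text \<open>
  Functionals vanish outside the carrier by convention, so that elements of the dual which agree
  on the space are equal and the pointwise operations stay within the dual.
\<close>

definition dual :: "('k::{real_normed_field,euclidean_space}, 'b) nspace \<Rightarrow> ('k, 'b \<Rightarrow> 'k) nspace" where
  "dual Y = \<lparr>
     vcarrier = {f. lin_map_on Y (vcarrier Y) (space_of (*)) f \<and>
                    (\<exists>C. \<forall>u\<in>vcarrier Y. norm (f u) \<le> C * vnorm Y u) \<and>
                    (\<forall>u. u \<notin> vcarrier Y \<longrightarrow> f u = 0)},
     vzero = (\<lambda>_. 0),
     vadd = (\<lambda>f g u. f u + g u),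
     vscale = (\<lambda>c f u. c * f u),
     vnorm = (\<lambda>f. Sup {norm (f u) | u. u \<in> vcarrier Y \<and> vnorm Y u \<le> 1})\<rparr>"

definition reflexive :: "('k::{real_normed_field,euclidean_space}, 'b) nspace \<Rightarrow> bool" where
  "reflexive Y \<longleftrightarrow>
     (\<forall>\<Phi>\<in>vcarrier (dual (dual Y)). \<exists>u\<in>vcarrier Y. \<forall>f\<in>vcarrier (dual Y). \<Phi> f = f u)"

definition finitely_representable :: "('k, 'b) nspace \<Rightarrow> ('k, 'c) nspace \<Rightarrow> bool" where
  "finitely_representable Y X \<longleftrightarrow>
     (\<forall>\<epsilon>>0. \<forall>B. finite B \<and> B \<subseteq> vcarrier Y \<longrightarrow>
        (\<exists>T. lin_map_on Y (lin_span Y B) X T \<and>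
             (\<forall>u\<in>lin_span Y B. vnorm Y u \<le> vnorm X (T u) \<and> vnorm X (T u) \<le> (1 + \<epsilon>) * vnorm Y u)))"

text \<open>
  A formula of HOL cannot quantify over types, so the Banach spaces \<open>Y\<close> below have their carrier
  in the fixed type \<open>(nat \<Rightarrow> 'a) set\<close>. When \<open>'a\<close> is not trivial, this includes, up to isometric
  isomorphism, every Banach space of cardinality at most that of \<open>(nat \<Rightarrow> 'a) set\<close>, in particular
  all the separable ones and the countable ultrapowers of the space on \<open>'a\<close> (whose elements are
  sets of sequences). Nothing is lost: a space that is not reflexive has a separable closed
  subspace that is not reflexive, and finite representability passes to subspaces.
\<close>

definition superreflexive :: "('k::{real_normed_field,euclidean_space}, 'a) nspace \<Rightarrow> bool" where
  "superreflexive X \<longleftrightarrow>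
     (\<forall>Y :: ('k, (nat \<Rightarrow> 'a) set) nspace.
        banach_space Y \<and> finitely_representable Y X \<longrightarrow> reflexive Y)"


section \<open>Bases and the thresholding greedy algorithm\<close>

text \<open>
  Sequences are indexed from 0, so \<open>x n\<close> is the vector number \<open>n + 1\<close> of the basis. The coefficient
  functionals \<open>xs\<close> are determined by the basis, since its linear span is dense.
\<close>

definition is_basis ::
  "('k::{real_normed_field,euclidean_space} \<Rightarrow> 'a::banach \<Rightarrow> 'a) \<Rightarrow> (nat \<Rightarrow> 'a) \<Rightarrow> (nat \<Rightarrow> 'a \<Rightarrow> 'k) \<Rightarrow> bool" where
  "is_basis smul x xs \<longleftrightarrow>
     closure (module.span smul (range x)) = UNIV \<and>
     (\<forall>n. Vector_Spaces.linear smul (*) (xs n) \<and> continuous_on UNIV (xs n)) \<and>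
     (\<forall>n m. xs n (x m) = (if n = m then 1 else 0)) \<and>
     (INF n. norm (x n)) > 0 \<and> bdd_above (range (\<lambda>n. norm (x n)))"

definition coeff_transform :: "(nat \<Rightarrow> 'a \<Rightarrow> 'k) \<Rightarrow> 'a \<Rightarrow> nat \<Rightarrow> 'k" where
  "coeff_transform xs f = (\<lambda>n. xs n f)"

definition c0 :: "(nat \<Rightarrow> 'k::real_normed_vector) set" where
  "c0 = {a. a \<longlonglongrightarrow> 0}"

text \<open>The indices whose terms the greedy algorithm takes before the term of index \<open>n\<close>.\<close>

definition greedy_before :: "(nat \<Rightarrow> 'k::real_normed_vector) \<Rightarrow> nat \<Rightarrow> nat set" where
  "greedy_before a n = {k. norm (a k) > norm (a n) \<or> (norm (a k) = norm (a n) \<and> k < n)}"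

text \<open>
  For \<open>a \<in> c0\<close> this set has exactly \<open>m\<close> elements. An index \<open>n\<close> with \<open>a n = 0\<close> is preceded by
  infinitely many indices if the support of \<open>a\<close> is infinite; it is then never chosen.
\<close>

definition greedy_set :: "(nat \<Rightarrow> 'k::real_normed_vector) \<Rightarrow> nat \<Rightarrow> nat set" where
  "greedy_set a m = {n. finite (greedy_before a n) \<and> card (greedy_before a n) < m}"

definition coord_proj :: "('k \<Rightarrow> 'a::banach \<Rightarrow> 'a) \<Rightarrow> (nat \<Rightarrow> 'a) \<Rightarrow> (nat \<Rightarrow> 'a \<Rightarrow> 'k) \<Rightarrow> nat set \<Rightarrow> 'a \<Rightarrow> 'a" where
  "coord_proj smul x xs A f = (\<Sum>n\<in>A. smul (xs n f) (x n))"

definition greedy_sum ::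
  "('k::real_normed_vector \<Rightarrow> 'a::banach \<Rightarrow> 'a) \<Rightarrow> (nat \<Rightarrow> 'a) \<Rightarrow> (nat \<Rightarrow> 'a \<Rightarrow> 'k) \<Rightarrow> nat \<Rightarrow> 'a \<Rightarrow> 'a" where
  "greedy_sum smul x xs m f = coord_proj smul x xs (greedy_set (coeff_transform xs f) m) f"

definition almost_greedy ::
  "('k::real_normed_vector \<Rightarrow> 'a::banach \<Rightarrow> 'a) \<Rightarrow> (nat \<Rightarrow> 'a) \<Rightarrow> (nat \<Rightarrow> 'a \<Rightarrow> 'k) \<Rightarrow> bool" where
  "almost_greedy smul x xs \<longleftrightarrow>
     (\<forall>f. coeff_transform xs f \<in> c0) \<and>
     (\<exists>C. \<forall>f m A. finite A \<and> card A \<le> m \<longrightarrow>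
        norm (f - greedy_sum smul x xs m f) \<le> C * norm (f - coord_proj smul x xs A f))"

definition fundamental_fun :: "('k::real_normed_vector \<Rightarrow> 'a::banach \<Rightarrow> 'a) \<Rightarrow> (nat \<Rightarrow> 'a) \<Rightarrow> nat \<Rightarrow> real" where
  "fundamental_fun smul x m =
     Sup {norm (\<Sum>n\<in>A. smul (\<epsilon> n) (x n)) | A \<epsilon>.
          finite A \<and> card A \<le> m \<and> (\<forall>n\<in>A. norm (\<epsilon> n) = 1)}"


section \<open>Lorentz sequence spaces and embeddings\<close>

definition rearrangement :: "(nat \<Rightarrow> 'k::real_normed_vector) \<Rightarrow> nat \<Rightarrow> real" where
  "rearrangement f n =
     Inf {t. 0 \<le> t \<and> finite {k. norm (f k) > t} \<and> card {k. norm (f k) > t} \<le> n}"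

definition primitive :: "(nat \<Rightarrow> real) \<Rightarrow> nat \<Rightarrow> real" where
  "primitive w m = (\<Sum>n<m. w n)"

text \<open>
  The terms of the series are non-negative if \<open>w\<close> is a weight, so the quasi-norm is finite exactly
  if the series is summable. In the indexing from 0, the term of index \<open>n\<close> uses the primitive
  sequence at \<open>n + 1\<close>.
\<close>

definition lorentz_space :: "real \<Rightarrow> (nat \<Rightarrow> real) \<Rightarrow> (nat \<Rightarrow> 'k::real_normed_vector) set" where
  "lorentz_space q w = {f \<in> c0. summable (\<lambda>n.
     (rearrangement f n * primitive w (Suc n)) powr q * (w n / primitive w (Suc n)))}"

definition space_embeds_in_seq :: "(nat \<Rightarrow> 'a \<Rightarrow> 'k) \<Rightarrow> (nat \<Rightarrow> 'k) set \<Rightarrow> bool" where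
  "space_embeds_in_seq xs S \<longleftrightarrow> (\<forall>f. coeff_transform xs f \<in> S)"

definition seq_embeds_in_space ::
  "('k \<Rightarrow> 'a::banach \<Rightarrow> 'a) \<Rightarrow> (nat \<Rightarrow> 'a) \<Rightarrow> (nat \<Rightarrow> 'k) set \<Rightarrow> bool" where
  "seq_embeds_in_space smul x S \<longleftrightarrow> (\<forall>a\<in>S. summable (\<lambda>n. smul (a n) (x n)))"


section \<open>Consistency of the two presentations of Banach spaces\<close>

lemma banach_over_real: "banach_over ((*\<^sub>R) :: real \<Rightarrow> 'a::banach \<Rightarrow> 'a)"
  by unfold_locales (auto simp: algebra_simps)

lemma banach_over_complex: "banach_over ((*) :: complex \<Rightarrow> complex \<Rightarrow> complex)"
  by unfold_locales (auto simp: algebra_simps norm_mult scaleR_conv_of_real)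

lemma (in banach_over) banach_space_space_of: "banach_space (space_of smul)"
proof -
  have minus: "vdist (space_of smul) u v = dist u v" for u v
    using scale_of_real[of "-1" v] by (simp add: vdist_def space_of_def dist_norm)
  show ?thesis
  proof
    fix s :: "nat \<Rightarrow> 'a"
    assume "\<forall>e>0. \<exists>N. \<forall>m\<ge>N. \<forall>n\<ge>N. vdist (space_of smul) (s m) (s n) < e"
    then have "Cauchy s"
      by (simp add: minus Cauchy_def)
    then obtain l where "s \<longlonglongrightarrow> l"
      using Cauchy_convergent convergent_def by blast
    then have "(\<lambda>n. dist (s n) l) \<longlonglongrightarrow> 0"
      using tendsto_dist_iff by blast
    then show "\<exists>l\<in>vcarrier (space_of smul). (\<lambda>n. vdist (space_of smul) (s n) l) \<longlonglongrightarrow> 0"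
      unfolding minus by (intro bexI[of _ l]) (simp_all add: space_of_def)
  next
    fix u :: 'a
    show "\<exists>v\<in>vcarrier (space_of smul). vadd (space_of smul) u v = vzero (space_of smul)"
      by (rule bexI[of _ "- u"]) (simp_all add: space_of_def)
  qed (simp_all add: space_of_def add.assoc add.commute scale_left_distrib scale_right_distrib
      norm_scale norm_triangle_ineq)
qed

end

theory Submission
  imports Defs "HOL-Library.Function_Algebras"
begin

text \<open>
  Superreflexivity enters through James' criterion: for each \<open>\<theta> > 0\<close> there is a bound on the length
  of sequences in the unit ball of the space, or of its dual, every initial part of which has a
  convex hull at distance at least \<open>\<theta>\<close> from the convex hull of the rest. Indeed, arbitrarily long
  sequences would yield an infinite one, with separating functionals, in an ultrapower, for which
  iterated limits do not commute.

  Apply this to the projections of \<open>f\<close> onto its level sets \<open>{n. \<bar>xs n f\<bar> \<ge> t}\<close>, which are greedy sums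
  and hence bounded. A difference of convex combinations of them keeps the coefficients of \<open>f\<close> on
  one group of levels. So if every \<open>f\<close> with \<open>n\<close> levels of size \<open>\<rho>\<close>, measured by \<open>t * \<phi> (card E)\<close>, has
  norm at least \<open>\<rho> * R\<close>, then for some fixed \<open>m\<close> those with \<open>n * m\<close> such levels have norm at least
  \<open>\<rho> * 2 * R\<close>. This polynomial growth gives the embedding into \<open>d\<^sub>1\<^sub>,\<^sub>r(w)\<close>.

  The space has non-trivial type, so \<open>\<phi>\<close> has the upper regularity property; consequently projections
  onto level sets are bounded for the dual basis too, with \<open>n / \<phi> n\<close> in place of \<open>\<phi>\<close>. The same
  argument in the dual, followed by Hoelder's inequality, gives the embedding of \<open>d\<^sub>1\<^sub>,\<^sub>q(w)\<close>.
\<close>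

section \<open>Ultrafilters\<close>

text \<open>An almost greedy basis need not be unconditional, so there is no bounded family of
  coordinate projections on which estimates for block sequences could be run; only projections
  adapted to the vector, onto its own level sets, are bounded. James' criterion fits this situation
  because it asks for bounded vectors and not for bounded projections. The lower estimate sees only
  the sizes of the coefficients, so a combination of projections of \<open>f\<close> has to
  reproduce \<open>f\<close> on one group of levels and may do anything elsewhere. Level sets of a
  functional are unrelated to those of a vector. Their projections are controlled by bounding sums
  of \<open>m\<close> coefficients of a vector by a multiple of \<open>m / \<phi> m\<close>, which
  upper regularity provides. Both summability estimates hold for all large exponents. The conjugate
  of a dual exponent gives \<open>q\<close>, and \<open>r\<close> can then be taken beyond
  \<open>q\<close>.\<close>

definition ultrafilter :: "'i filter \<Rightarrow> bool" where
  "ultrafilter U \<longleftrightarrow> U \<noteq> bot \<and> (\<forall>P. eventually P U \<or> eventually (\<lambda>i. \<not> P i) U)"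

text \<open>Zorn's lemma on the non-trivial filters below \<open>F\<close>. The infimum of a chain
  stays non-trivial, because what holds eventually for it already holds eventually for a
  member.\<close>

lemma ex_ultrafilter_le:
  assumes "F \<noteq> (bot :: 'i filter)"
  shows "\<exists>U\<le>F. ultrafilter U"
proof -
  define A where "A = {G :: 'i filter. G \<le> F \<and> G \<noteq> bot}"
  have po: "partial_order_on A (relation_of (\<ge>) A)"
    by (rule partial_order_on_relation_ofI) auto
  have "\<exists>U\<in>A. \<forall>G\<in>A. U \<ge> G \<longrightarrow> G = U"
  proof (rule predicate_Zorn[OF po])
    fix C assume C: "C \<in> Chains (relation_of (\<ge>) A)"
    have CA: "C \<subseteq> A" and tot: "G \<le> H \<or> H \<le> G" if "G \<in> C" "H \<in> C" for G H
      using C that unfolding Chains_def relation_of_def by auto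
    show "\<exists>U\<in>A. \<forall>G\<in>C. G \<ge> U"
    proof (cases "C = {}")
      case True
      then show ?thesis using assms by (auto simp: A_def)
    next
      case False
      then obtain G0 where "G0 \<in> C" by blast
      have "eventually P (Inf C) \<longleftrightarrow> (\<exists>b\<in>C. eventually P b)" for P
      proof (rule eventually_Inf_base[OF False])
        fix G H assume "G \<in> C" "H \<in> C"
        then show "\<exists>x\<in>C. x \<le> inf G H" using tot[of G H] by (auto intro: bexI[of _ G] bexI[of _ H])
      qed
      from this[of "\<lambda>_. False"] have "Inf C \<noteq> bot"
        using CA \<open>G0 \<in> C\<close> unfolding trivial_limit_def by (auto simp: A_def trivial_limit_def)
      moreover have "Inf C \<le> F"
        using \<open>G0 \<in> C\<close> CA[OF \<open>G0 \<in> C\<close> \<open>G0 \<in> C\<close>] by (auto simp: A_def intro: Inf_lower2)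
      ultimately show ?thesis by (intro bexI[of _ "Inf C"]) (auto simp: A_def Inf_lower)
    qed
  qed
  then obtain U where U: "U \<le> F" "U \<noteq> bot" and min: "\<And>G. G \<le> F \<Longrightarrow> G \<noteq> bot \<Longrightarrow> G \<le> U \<Longrightarrow> G = U"
    by (auto simp: A_def)
  have "eventually P U \<or> eventually (\<lambda>i. \<not> P i) U" for P
  proof (rule disjCI)
    assume *: "\<not> eventually (\<lambda>i. \<not> P i) U"
    \<comment> \<open>Restricting \<open>U\<close> to \<open>P\<close> leaves a non-trivial filter
      unless \<open>P\<close> fails eventually, so minimality makes the restriction equal to
      \<open>U\<close>.\<close>
    have "inf U (principal {i. P i}) = U"
    proof (rule min)
      show "inf U (principal {i. P i}) \<noteq> bot"
        using * by (simp add: trivial_limit_def eventually_inf_principal)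
    qed (use U in \<open>auto intro: le_infI1\<close>)
    moreover have "eventually P (inf U (principal {i. P i}))"
      by (simp add: eventually_inf_principal)
    ultimately show "eventually P U" by simp
  qed
  with U show ?thesis by (auto simp: ultrafilter_def)
qed

text \<open>The image filter lives on a compact set and so has a cluster point. It decides every
  neighbourhood of this point, and a negative decision would contradict clustering.\<close>

lemma ultrafilter_convergent:
  fixes f :: "'i \<Rightarrow> 'b::heine_borel"
  assumes U: "ultrafilter U" and b: "bounded (range f)"
  shows "(f \<longlongrightarrow> Lim U f) U"
proof -
  have nb: "U \<noteq> bot" using U by (simp add: ultrafilter_def)
  have "compact (closure (range f))" using b by (simp add: compact_closure)
  moreover have "filtermap f U \<noteq> bot" using nb by (simp add: filtermap_bot_iff)
  moreover have "eventually (\<lambda>x. x \<in> closure (range f)) (filtermap f U)"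
    by (simp add: eventually_filtermap closure_subset[THEN subsetD])
  ultimately obtain l where l: "inf (nhds l) (filtermap f U) \<noteq> bot"
    unfolding compact_filter by blast
  have "filtermap f U \<le> nhds l"
  proof (rule filter_leI)
    fix P assume P: "eventually P (nhds l)"
    show "eventually P (filtermap f U)"
    proof (rule ccontr)
      assume "\<not> eventually P (filtermap f U)"
      then have "eventually (\<lambda>x. \<not> P x) (filtermap f U)"
        using U by (auto simp: ultrafilter_def eventually_filtermap)
      then have "eventually (\<lambda>x. False) (inf (nhds l) (filtermap f U))"
        unfolding eventually_inf using P by blast
      then show False using l by (simp add: trivial_limit_def)
    qed
  qed
  then have "(f \<longlongrightarrow> l) U" by (simp add: filterlim_def)
  then show ?thesis using tendsto_Lim[OF nb] by metis
qed

section \<open>The Hahn-Banach theorem\<close>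

text \<open>A sublinear functional that is minimal among those below \<open>p\<close> is linear: otherwise it could
  be replaced by the infimum of \<open>q (x + t y) - t q y\<close> over \<open>t \<ge> 0\<close>.\<close>

theorem hahn_banach:
  fixes scale :: "real \<Rightarrow> 'v::ab_group_add \<Rightarrow> 'v" and p :: "'v \<Rightarrow> real"
  assumes vs: "vector_space scale"
    and add: "\<And>x y. p (x + y) \<le> p x + p y"
    and pos: "\<And>t x. 0 \<le> t \<Longrightarrow> p (scale t x) \<le> t * p x"
  obtains g where "\<And>x y. g (x + y) = g x + g y" "\<And>t x. g (scale t x) = t * g x" "\<And>x. g x \<le> p x"
proof -
  interpret vector_space scale by (rule vs)
  define S where "S = {q :: 'v \<Rightarrow> real. (\<forall>x y. q (x + y) \<le> q x + q y) \<and>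
    (\<forall>t\<ge>0. \<forall>x. q (scale t x) \<le> t * q x) \<and> (\<forall>x. q x \<le> p x)}"
  have pS: "p \<in> S" using add pos by (auto simp: S_def)
  have q0: "q 0 = 0" if "q \<in> S" for q
  proof -
    have "q (scale 0 0) \<le> 0 * q 0" "q (0 + 0) \<le> q 0 + q 0"
      using that unfolding S_def by blast+
    then show ?thesis by simp
  qed
  have qm: "- q (- x) \<le> q x" if "q \<in> S" for q x
  proof -
    have "q (x + - x) \<le> q x + q (- x)" using that unfolding S_def by blast
    then show ?thesis using q0[OF that] by simp
  qed
  have po: "partial_order_on S (relation_of (\<ge>) S)"
    by (rule partial_order_on_relation_ofI) auto
  have "\<exists>q\<in>S. \<forall>r\<in>S. q \<ge> r \<longrightarrow> r = q"
  proof (rule predicate_Zorn[OF po])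
    fix C assume C: "C \<in> Chains (relation_of (\<ge>) S)"
    have CS: "G \<in> S" if "G \<in> C" for G
      using C that unfolding Chains_def relation_of_def by auto
    have tot: "G \<le> H \<or> H \<le> G" if "G \<in> C" "H \<in> C" for G H
      using C that unfolding Chains_def relation_of_def by auto
    show "\<exists>u\<in>S. \<forall>q\<in>C. q \<ge> u"
    proof (cases "C = {}")
      case True
      then show ?thesis using pS by auto
    next
      case False
      then obtain q1 where q1: "q1 \<in> C" by blast
      define u where "u x = (INF q\<in>C. q x)" for x
      have bd: "bdd_below ((\<lambda>q. q x) ` C)" for x
      proof (rule bdd_belowI2)
        fix q assume "q \<in> C"
        then have "q \<in> S" by (rule CS)
        then have "- p (- x) \<le> - q (- x)" by (auto simp: S_def)
        then show "- p (- x) \<le> q x" using qm[OF \<open>q \<in> S\<close>, of x] by linarith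
      qed
      have ule: "u x \<le> q x" if "q \<in> C" for q x
        unfolding u_def by (rule cINF_lower[OF bd that])
      have uge: "c \<le> u x" if "\<And>q. q \<in> C \<Longrightarrow> c \<le> q x" for c x
        unfolding u_def by (rule cINF_greatest[OF False that])
      have "u (x + y) \<le> u x + u y" for x y
      proof -
        have "u (x + y) - q y \<le> u x" if q: "q \<in> C" for q
        proof (rule uge)
          fix r assume r: "r \<in> C"
          obtain s where s: "s \<in> C" "s \<le> q" "s \<le> r" using tot[OF q r] q r by blast
          have "u (x + y) \<le> s (x + y)" by (rule ule[OF s(1)])
          also have "\<dots> \<le> s x + s y" using CS[OF s(1)] by (auto simp: S_def)
          also have "\<dots> \<le> r x + q y" using s by (auto simp: le_fun_def intro: add_mono)
          finally show "u (x + y) - q y \<le> r x" by simp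
        qed
        then have "u (x + y) - u x \<le> u y" by (intro uge) (smt (verit))
        then show ?thesis by simp
      qed
      moreover have "u (scale t x) \<le> t * u x" if t: "0 \<le> t" for t x
      proof (cases "t = 0")
        case True
        have "u 0 \<le> q1 0" by (rule ule[OF q1])
        then show ?thesis using True q0[OF CS[OF q1]] by simp
      next
        case False
        have "u (scale t x) / t \<le> u x"
        proof (rule uge)
          fix q assume q: "q \<in> C"
          have "u (scale t x) \<le> q (scale t x)" by (rule ule[OF q])
          also have "\<dots> \<le> t * q x" using CS[OF q] t by (auto simp: S_def)
          finally show "u (scale t x) / t \<le> q x" using False t by (simp add: field_simps)
        qed
        then show ?thesis using False t by (simp add: field_simps)
      qed
      moreover have "u x \<le> p x" for x
        using ule[OF q1, of x] CS[OF q1] by (auto simp: S_def intro: order_trans)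
      ultimately have "u \<in> S" by (auto simp: S_def)
      then show ?thesis using ule by (auto simp: le_fun_def)
    qed
  qed
  then obtain q where q: "q \<in> S" and min: "\<And>r. r \<in> S \<Longrightarrow> r \<le> q \<Longrightarrow> r = q" by blast
  have qadd: "q (x + y) \<le> q x + q y" and qpos: "0 \<le> t \<Longrightarrow> q (scale t x) \<le> t * q x"
    and qp: "q x \<le> p x" for x y t
    using q by (auto simp: S_def)
  have super: "q x + q y \<le> q (x + y)" for x y
  proof -
    define r where "r z = (INF t\<in>{0..}. q (z + scale t y) - t * q y)" for z
    have bd: "bdd_below ((\<lambda>t. q (z + scale t y) - t * q y) ` {0..})" for z
    proof (rule bdd_belowI2)
      fix t :: real assume "t \<in> {0..}"
      have "q (scale t y) \<le> q (z + scale t y) + q (- z)"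
        using qadd[of "z + scale t y" "- z"] by simp
      moreover have "t * q y \<le> q (scale t y)"
      proof (cases "t = 0")
        case True then show ?thesis using q0[OF q] by simp
      next
        case False
        then have "q (scale (1/t) (scale t y)) \<le> (1/t) * q (scale t y)"
          using \<open>t \<in> _\<close> by (intro qpos) auto
        then show ?thesis using False \<open>t \<in> _\<close> by (simp add: field_simps)
      qed
      ultimately show "- q (- z) \<le> q (z + scale t y) - t * q y" by linarith
    qed
    have rle: "r z \<le> q (z + scale t y) - t * q y" if "0 \<le> t" for t z
      unfolding r_def using that by (intro cINF_lower[OF bd]) auto
    have rge: "c \<le> r z" if "\<And>t. 0 \<le> t \<Longrightarrow> c \<le> q (z + scale t y) - t * q y" for c z
      unfolding r_def by (rule cINF_greatest) (use that in auto)
    have "r (z + z') \<le> r z + r z'" for z z'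
    proof -
      have "r (z + z') - (q (z' + scale t' y) - t' * q y) \<le> r z" if t': "0 \<le> t'" for t'
      proof (rule rge)
        fix t :: real assume t: "0 \<le> t"
        have "r (z + z') \<le> q ((z + z') + scale (t + t') y) - (t + t') * q y"
          using t t' by (intro rle) simp
        also have "(z + z') + scale (t + t') y = (z + scale t y) + (z' + scale t' y)"
          by (simp add: scale_left_distrib algebra_simps)
        also have "q \<dots> \<le> q (z + scale t y) + q (z' + scale t' y)" by (rule qadd)
        finally show "r (z + z') - (q (z' + scale t' y) - t' * q y) \<le> q (z + scale t y) - t * q y"
          by (simp add: algebra_simps)
      qed
      then have "r (z + z') - r z \<le> r z'" by (intro rge) (smt (verit))
      then show ?thesis by simp
    qed
    moreover have "r (scale s z) \<le> s * r z" if s: "0 \<le> s" for s z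
    proof (cases "s = 0")
      case True
      then show ?thesis using rle[of 0 0] q0[OF q] by simp
    next
      case False
      have "r (scale s z) / s \<le> r z"
      proof (rule rge)
        fix t :: real assume t: "0 \<le> t"
        have "r (scale s z) \<le> q (scale s z + scale (s * t) y) - (s * t) * q y"
          using s t by (intro rle) simp
        also have "scale s z + scale (s * t) y = scale s (z + scale t y)"
          by (simp add: scale_right_distrib)
        also have "q \<dots> \<le> s * q (z + scale t y)" by (rule qpos[OF s])
        finally show "r (scale s z) / s \<le> q (z + scale t y) - t * q y"
          using False s by (simp add: field_simps)
      qed
      then show ?thesis using False s by (simp add: field_simps)
    qed
    moreover have rq: "r z \<le> q z" for z
      using rle[of 0 z] by simp
    moreover have "r z \<le> p z" for z using rq[of z] qp[of z] by simp
    ultimately have "r \<in> S" by (auto simp: S_def)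
    then have "r = q" using rq by (intro min) (auto simp: le_fun_def)
    then show ?thesis using rle[of 1 x] by simp
  qed
  have ad: "q (x + y) = q x + q y" for x y using super[of x y] qadd[of x y] by simp
  have mi: "q (- x) = - q x" for x using ad[of x "- x"] q0[OF q] by simp
  have ho: "q (scale t x) = t * q x" if "0 \<le> t" for t x
    using qpos[OF that, of x] qpos[OF that, of "- x"] by (simp add: mi)
  have "q (scale t x) = t * q x" for t x
    using ho[of t x] ho[of "- t" x] mi[of "scale t x"] by (cases "0 \<le> t") auto
  from that[OF ad this qp] show ?thesis .
qed

text \<open>Hahn-Banach for the functional \<open>p\<close>, which is subadditive because
  \<open>C\<close> is convex. The choice \<open>t = 0\<close> shows that \<open>p\<close> is at most
  the norm, and \<open>t = 1\<close> that \<open>p (- c)\<close> is at most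
  \<open>- \<theta>\<close>; a linear functional below \<open>p\<close> inherits both.\<close>

lemma separating_functional:
  fixes C :: "'a::real_normed_vector set"
  assumes C: "convex C" and far: "\<And>c. c \<in> C \<Longrightarrow> \<theta> \<le> norm c"
  obtains g :: "'a \<Rightarrow>\<^sub>L real" where "norm g \<le> 1" "\<And>c. c \<in> C \<Longrightarrow> \<theta> \<le> blinfun_apply g c"
proof (cases "C = {}")
  case True
  then show ?thesis by (intro that[of 0]) auto
next
  case False
  define K where "K = {(t, c). 0 \<le> (t::real) \<and> c \<in> C}"
  define p where "p x = (INF (t, c)\<in>K. norm (x + t *\<^sub>R c) - t * \<theta>)" for x :: 'a
  have K: "K \<noteq> {}" using False by (auto simp: K_def)
  have bd: "bdd_below ((\<lambda>(t, c). norm (x + t *\<^sub>R c) - t * \<theta>) ` K)" for x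
  proof (rule bdd_belowI2)
    fix k assume "k \<in> K"
    then obtain t c where k: "k = (t, c)" "0 \<le> t" "c \<in> C" by (auto simp: K_def)
    have "t * \<theta> \<le> norm (t *\<^sub>R c)" using far[OF k(3)] k(2) by (simp add: mult_left_mono)
    moreover have "norm (t *\<^sub>R c) \<le> norm (x + t *\<^sub>R c) + norm x"
      by (metis add_diff_cancel_left' norm_triangle_ineq4)
    ultimately show "- norm x \<le> (case k of (t, c) \<Rightarrow> norm (x + t *\<^sub>R c) - t * \<theta>)"
      using k by simp
  qed
  have ple: "p x \<le> norm (x + t *\<^sub>R c) - t * \<theta>" if "0 \<le> t" "c \<in> C" for x t c
    unfolding p_def using cINF_lower[OF bd, of "(t, c)" x] that by (simp add: K_def)
  have pge: "a \<le> p x" if "\<And>t c. 0 \<le> t \<Longrightarrow> c \<in> C \<Longrightarrow> a \<le> norm (x + t *\<^sub>R c) - t * \<theta>" for a x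
    unfolding p_def by (rule cINF_greatest[OF K]) (use that in \<open>auto simp: K_def\<close>)
  have "p (x + y) \<le> p x + p y" for x y
  proof -
    have "p (x + y) - (norm (y + t' *\<^sub>R c') - t' * \<theta>) \<le> p x" if t': "0 \<le> t'" "c' \<in> C" for t' c'
    proof (rule pge)
      fix t c assume t: "0 \<le> (t::real)" "c \<in> C"
      \<comment> \<open>Convexity enters here: two non-negative multiples of points of
        \<open>C\<close> add up to one multiple of a point of \<open>C\<close>.\<close>
      obtain d where d: "d \<in> C" "(t + t') *\<^sub>R d = t *\<^sub>R c + t' *\<^sub>R c'"
      proof (cases "t + t' = 0")
        case True
        then show ?thesis using t t' by (intro that[of c]) (auto simp: add_nonneg_eq_0_iff)
      next
        case False
        then have "t + t' > 0" using t t' by auto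
        then have "(t / (t + t')) *\<^sub>R c + (t' / (t + t')) *\<^sub>R c' \<in> C"
          using t t' by (intro convexD[OF C]) (auto simp flip: add_divide_distrib)
        then show ?thesis using False by (intro that) (auto simp: scaleR_add_right)
      qed
      have "p (x + y) \<le> norm ((x + y) + (t + t') *\<^sub>R d) - (t + t') * \<theta>"
        using t t' d by (intro ple) auto
      also have "(x + y) + (t + t') *\<^sub>R d = (x + t *\<^sub>R c) + (y + t' *\<^sub>R c')"
        by (simp add: d)
      also have "norm \<dots> \<le> norm (x + t *\<^sub>R c) + norm (y + t' *\<^sub>R c')" by (rule norm_triangle_ineq)
      finally show "p (x + y) - (norm (y + t' *\<^sub>R c') - t' * \<theta>) \<le> norm (x + t *\<^sub>R c) - t * \<theta>"
        by (simp add: algebra_simps)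
    qed
    then have "p (x + y) - p x \<le> p y" by (intro pge) (smt (verit))
    then show ?thesis by simp
  qed
  moreover have "p (s *\<^sub>R x) \<le> s * p x" if s: "0 \<le> s" for s x
  proof (cases "s = 0")
    case True
    obtain c where "c \<in> C" using False by blast
    then show ?thesis using True ple[of 0 c 0] by simp
  next
    case False
    have "p (s *\<^sub>R x) / s \<le> p x"
    proof (rule pge)
      fix t c assume t: "0 \<le> (t::real)" "c \<in> C"
      have "p (s *\<^sub>R x) \<le> norm (s *\<^sub>R x + (s * t) *\<^sub>R c) - (s * t) * \<theta>"
        using s t by (intro ple) simp_all
      also have "norm (s *\<^sub>R x + (s * t) *\<^sub>R c) = norm (s *\<^sub>R (x + t *\<^sub>R c))"
        by (simp add: scaleR_add_right)
      also have "\<dots> = s * norm (x + t *\<^sub>R c)" using s by simp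
      finally show "p (s *\<^sub>R x) / s \<le> norm (x + t *\<^sub>R c) - t * \<theta>"
        using False s by (simp add: field_simps)
    qed
    then show ?thesis using False s by (simp add: field_simps)
  qed
  ultimately obtain g where g: "\<And>x y. g (x + y) = g x + g y" "\<And>t x. g (t *\<^sub>R x) = t * g x"
    "\<And>x. g x \<le> p x"
    using hahn_banach[OF real_vector.vector_space_axioms, of p] by blast
  obtain c0 where "c0 \<in> C" using False by blast
  then have le: "g x \<le> norm x" for x using g(3)[of x] ple[of 0 c0 x] by simp
  have mi: "g (- x) = - g x" for x using g(2)[of "-1" x] by simp
  have "\<bar>g x\<bar> \<le> norm x" for x using le[of x] le[of "- x"] mi[of x] by simp
  then have bl: "bounded_linear g"
    by (intro bounded_linear_intro[of _ 1]) (simp_all add: g)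
  have ap: "blinfun_apply (Blinfun g) = g" by (rule bounded_linear_Blinfun_apply[OF bl])
  show ?thesis
  proof (rule that[of "Blinfun g"])
    show "norm (Blinfun g) \<le> 1"
      by (rule norm_blinfun_bound) (simp_all add: ap \<open>\<And>x. \<bar>g x\<bar> \<le> norm x\<close>)
    fix c assume c: "c \<in> C"
    have "g (- c) \<le> p (- c)" by (rule g)
    also have "\<dots> \<le> norm (- c + 1 *\<^sub>R c) - 1 * \<theta>" by (rule ple) (use c in auto)
    finally show "\<theta> \<le> Blinfun g c" by (simp add: ap mi)
  qed
qed

lemma norming_functional:
  fixes x :: "'a::real_normed_vector"
  obtains g :: "'a \<Rightarrow>\<^sub>L real" where "norm g \<le> 1" "blinfun_apply g x = norm x"
proof -
  obtain g :: "'a \<Rightarrow>\<^sub>L real" where g: "norm g \<le> 1" "norm x \<le> g x"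
    using separating_functional[of "{x}" "norm x"] by auto
  have "g x \<le> norm g * norm x" using norm_blinfun[of g x] by simp
  also have "\<dots> \<le> norm x" using g(1) mult_right_mono[of "norm g" 1 "norm x"] by simp
  finally show ?thesis using g that by force
qed

text \<open>A finite-dimensional minimax principle: if no \<open>x\<close> in the unit ball satisfies all the
  inequalities, then \<open>p v = (INF x. (MAX i. v i - g i x) + \<theta>' * norm x)\<close> is a sublinear functional
  on the finite sequences, and a linear functional below it is a convex combination.\<close>

lemma common_large_vector:
  fixes g :: "'i \<Rightarrow> 'a::real_normed_vector \<Rightarrow>\<^sub>L real"
  assumes I: "finite I" "I \<noteq> {}" and "0 < \<theta>'" "\<theta>' < \<theta>"
    and far: "\<And>\<mu>. (\<And>i. i \<in> I \<Longrightarrow> 0 \<le> \<mu> i) \<Longrightarrow> (\<Sum>i\<in>I. \<mu> i) = 1 \<Longrightarrow> \<theta> \<le> norm (\<Sum>i\<in>I. \<mu> i *\<^sub>R g i)"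
  obtains x where "norm x \<le> 1" "\<And>i. i \<in> I \<Longrightarrow> \<theta>' \<le> g i x"
proof -
  \<comment> \<open>The homogeneous form of the claim. Strictness forces \<open>x\<close> to be
    non-zero, so that it can be normalized in the end.\<close>
  have "\<exists>x. \<forall>i\<in>I. \<theta>' * norm x < g i x"
  proof (rule ccontr)
    assume "\<nexists>x. \<forall>i\<in>I. \<theta>' * norm x < g i x"
    then have no: "\<exists>i\<in>I. g i x \<le> \<theta>' * norm x" for x by (meson not_le)
    define mx where "mx v = Max (v ` I)" for v :: "'i \<Rightarrow> real"
    have mx_ge: "v i \<le> mx v" if "i \<in> I" for v i
      unfolding mx_def using that I by auto
    have mx_le: "mx v \<le> a" if "\<And>i. i \<in> I \<Longrightarrow> v i \<le> a" for v a
      unfolding mx_def using that I by auto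
    define p where "p v = (INF x. mx (\<lambda>i. v i - g i x) + \<theta>' * norm x)" for v
    have bd: "bdd_below (range (\<lambda>x. mx (\<lambda>i. v i - g i x) + \<theta>' * norm x))" for v
    proof (rule bdd_belowI2)
      fix x
      obtain i where i: "i \<in> I" "g i x \<le> \<theta>' * norm x" using no by blast
      have "- v i \<le> mx (\<lambda>i. - v i)" using mx_ge[OF i(1), of "\<lambda>i. - v i"] .
      moreover have "v i - g i x \<le> mx (\<lambda>i. v i - g i x)"
        using mx_ge[OF i(1), of "\<lambda>i. v i - g i x"] .
      ultimately show "- mx (\<lambda>i. - v i) \<le> mx (\<lambda>i. v i - g i x) + \<theta>' * norm x"
        using i by linarith
    qed
    have ple: "p v \<le> mx (\<lambda>i. v i - g i x) + \<theta>' * norm x" for v x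
      unfolding p_def by (rule cINF_lower[OF bd]) auto
    have pge: "a \<le> p v" if "\<And>x. a \<le> mx (\<lambda>i. v i - g i x) + \<theta>' * norm x" for a v
      unfolding p_def by (rule cINF_greatest) (use that in auto)
    have vs: "vector_space (\<lambda>(c::real) v (i::'i). c * v i)"
      by unfold_locales (auto simp: fun_eq_iff algebra_simps)
    have "p (v + w) \<le> p v + p w" for v w
    proof -
      have "p (v + w) - (mx (\<lambda>i. w i - g i y) + \<theta>' * norm y) \<le> p v" for y
      proof (rule pge)
        fix x
        have "p (v + w) \<le> mx (\<lambda>i. (v + w) i - g i (x + y)) + \<theta>' * norm (x + y)" by (rule ple)
        also have "mx (\<lambda>i. (v + w) i - g i (x + y)) \<le> mx (\<lambda>i. v i - g i x) + mx (\<lambda>i. w i - g i y)"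
        proof (rule mx_le)
          fix i assume "i \<in> I"
          then show "(v + w) i - g i (x + y) \<le> mx (\<lambda>i. v i - g i x) + mx (\<lambda>i. w i - g i y)"
            using mx_ge[of i "\<lambda>i. v i - g i x"] mx_ge[of i "\<lambda>i. w i - g i y"]
            by (simp add: blinfun.add_right)
        qed
        also have "\<theta>' * norm (x + y) \<le> \<theta>' * norm x + \<theta>' * norm y"
          using norm_triangle_ineq[of x y] \<open>0 < \<theta>'\<close> by (simp flip: distrib_left)
        finally show "p (v + w) - (mx (\<lambda>i. w i - g i y) + \<theta>' * norm y)
          \<le> mx (\<lambda>i. v i - g i x) + \<theta>' * norm x" by simp
      qed
      then have "p (v + w) - p v \<le> p w" by (intro pge) (smt (verit))
      then show ?thesis by simp
    qed
    moreover have "p (\<lambda>i. s * v i) \<le> s * p v" if s: "0 \<le> s" for s v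
    proof (cases "s = 0")
      case True
      then show ?thesis using ple[of "\<lambda>_. 0" 0] mx_le[of "\<lambda>_. 0" 0] by auto
    next
      case False
      have "p (\<lambda>i. s * v i) / s \<le> p v"
      proof (rule pge)
        fix x
        have "p (\<lambda>i. s * v i) \<le> mx (\<lambda>i. s * v i - g i (s *\<^sub>R x)) + \<theta>' * norm (s *\<^sub>R x)" by (rule ple)
        also have "mx (\<lambda>i. s * v i - g i (s *\<^sub>R x)) \<le> s * mx (\<lambda>i. v i - g i x)"
        proof (rule mx_le)
          fix i assume "i \<in> I"
          then have "s * (v i - g i x) \<le> s * mx (\<lambda>i. v i - g i x)"
            using mx_ge[of i "\<lambda>i. v i - g i x"] s by (intro mult_left_mono) auto
          then show "s * v i - g i (s *\<^sub>R x) \<le> s * mx (\<lambda>i. v i - g i x)"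
            by (simp add: blinfun.scaleR_right algebra_simps)
        qed
        finally show "p (\<lambda>i. s * v i) / s \<le> mx (\<lambda>i. v i - g i x) + \<theta>' * norm x"
          using False s by (simp add: field_simps)
      qed
      then show ?thesis using False s by (simp add: field_simps)
    qed
    ultimately obtain L where L: "\<And>v w. L (v + w) = L v + L w" "\<And>t v. L (\<lambda>i. t * v i) = t * L v"
      "\<And>v. L v \<le> p v"
      using hahn_banach[OF vs, of p] by blast
    have L0: "L (\<lambda>_. 0) = 0" using L(2)[of 0 "\<lambda>_. 0"] by simp
    have Lmx: "L v \<le> mx v" for v using L(3)[of v] ple[of v 0] by simp
    have Lsum: "L (\<lambda>i. \<Sum>j\<in>J. c j * (if i = j then 1 else 0)) = (\<Sum>j\<in>J. c j * L (\<lambda>i. if i = j then 1 else 0))"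
      if "finite J" for J c
      using that
    proof (induction J)
      case empty then show ?case by (simp add: L0)
    next
      case (insert j J)
      have "(\<lambda>i. \<Sum>j\<in>insert j J. c j * (if i = j then 1 else 0))
        = (\<lambda>i. c j * (if i = j then 1 else 0)) + (\<lambda>i. \<Sum>j\<in>J. c j * (if i = j then 1 else 0))"
        using insert by (auto simp: fun_eq_iff)
      then show ?case using insert by (simp only: L(1) L(2)) simp
    qed
    define \<mu> where "\<mu> j = L (\<lambda>i. if i = j then 1 else 0)" for j
    have Lrep: "L (\<lambda>i. if i \<in> I then c i else 0) = (\<Sum>j\<in>I. c j * \<mu> j)" for c
    proof -
      have "(\<lambda>i. if i \<in> I then c i else 0) = (\<lambda>i. \<Sum>j\<in>I. c j * (if i = j then 1 else 0))"
        using I by (auto simp: fun_eq_iff if_distrib cong: if_cong)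
      then show ?thesis using Lsum[OF I(1), of c] by (simp add: \<mu>_def)
    qed
    have "0 \<le> \<mu> j" for j
    proof -
      have "mx (\<lambda>i. -1 * (if i = j then 1 else 0)) \<le> 0" by (rule mx_le) simp
      then have "L (\<lambda>i. -1 * (if i = j then 1 else 0)) \<le> 0" using Lmx order_trans by blast
      then show ?thesis unfolding \<mu>_def L(2) by simp
    qed
    moreover have "(\<Sum>j\<in>I. \<mu> j) = 1"
      \<comment> \<open>Testing the bound by the maximum at the constants 1 and -1 pins the total
        mass from both sides.\<close>
      using Lmx[of "\<lambda>i. if i \<in> I then 1 else 0"] mx_le[of "\<lambda>i. if i \<in> I then 1 else 0" 1]
        Lmx[of "\<lambda>i. if i \<in> I then -1 else 0"] mx_le[of "\<lambda>i. if i \<in> I then -1 else 0" "-1"]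
      by (simp add: Lrep sum_negf)
    ultimately have "\<theta> \<le> norm (\<Sum>i\<in>I. \<mu> i *\<^sub>R g i)" by (intro far)
    moreover have "norm (\<Sum>i\<in>I. \<mu> i *\<^sub>R g i) \<le> \<theta>'"
    proof (rule norm_blinfun_bound)
      fix x
      \<comment> \<open>At the vector with entries \<open>g i x\<close>, the same \<open>x\<close>
        in the infimum defining \<open>p\<close> cancels the maximum and leaves only
        \<open>\<theta>' * norm x\<close>.\<close>
      have *: "(\<Sum>i\<in>I. \<mu> i *\<^sub>R g i) x \<le> \<theta>' * norm x" for x
      proof -
        have "(\<Sum>i\<in>I. \<mu> i *\<^sub>R g i) x = L (\<lambda>i. if i \<in> I then g i x else 0)"
          by (simp add: Lrep blinfun.sum_left blinfun.scaleR_left mult.commute)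
        also have "\<dots> \<le> mx (\<lambda>i. (if i \<in> I then g i x else 0) - g i x) + \<theta>' * norm x"
          using L(3) ple by (rule order_trans)
        also have "mx (\<lambda>i. (if i \<in> I then g i x else 0) - g i x) \<le> 0" by (rule mx_le) simp
        finally show ?thesis by simp
      qed
      show "norm ((\<Sum>i\<in>I. \<mu> i *\<^sub>R g i) x) \<le> \<theta>' * norm x"
        using *[of x] *[of "- x"] by (simp add: blinfun.minus_right abs_le_iff)
    qed (use \<open>0 < \<theta>'\<close> in simp)
    ultimately show False using \<open>\<theta>' < \<theta>\<close> by simp
  qed
  then obtain x where x: "\<And>i. i \<in> I \<Longrightarrow> \<theta>' * norm x < g i x" by blast
  obtain i0 where "i0 \<in> I" using I by blast
  then have "x \<noteq> 0" using x by force
  show ?thesis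
  proof (rule that[of "(1 / norm x) *\<^sub>R x"])
    fix i assume "i \<in> I"
    then show "\<theta>' \<le> g i ((1 / norm x) *\<^sub>R x)"
      using x[of i] \<open>x \<noteq> 0\<close> by (simp add: blinfun.scaleR_right field_simps)
  qed (use \<open>x \<noteq> 0\<close> in simp)
qed

section \<open>Limits along an ultrafilter\<close>

lemma bounded_rangeI: "(\<And>i. norm (f i) \<le> C) \<Longrightarrow> bounded (range f)"
  by (auto simp: bounded_iff)

lemma Lim_eqI: "ultrafilter U \<Longrightarrow> (f \<longlongrightarrow> l) U \<Longrightarrow> Lim U f = l"
  by (simp add: ultrafilter_def tendsto_Lim)

lemma tendsto_LimI:
  fixes f :: "'i \<Rightarrow> 'b::{heine_borel,real_normed_vector}"
  assumes "ultrafilter U" "\<And>i. norm (f i) \<le> C"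
  shows "(f \<longlongrightarrow> Lim U f) U"
  using assms ultrafilter_convergent bounded_rangeI by metis

lemma norm_Lim_le:
  fixes f :: "'i \<Rightarrow> 'b::{heine_borel,real_normed_vector}"
  assumes "ultrafilter U" "\<And>i. norm (f i) \<le> C"
  shows "norm (Lim U f) \<le> C"
  by (rule tendsto_upperbound[OF tendsto_norm[OF tendsto_LimI[OF assms]]])
    (use assms in \<open>auto simp: ultrafilter_def\<close>)

text \<open>The two iterated limits see the entries on opposite sides of the diagonal, which differ
  by at least \<open>\<theta>\<close> in each row. Since \<open>U\<close> is free, the order
  constraints on the indices hold eventually when the limits are taken from the inside out.\<close>

lemma iterated_Lim_gap:
  fixes M :: "nat \<Rightarrow> nat \<Rightarrow> real"
  assumes U: "ultrafilter U" "U \<le> sequentially" and b: "\<And>i j. \<bar>M i j\<bar> \<le> 1"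
    and gap: "\<And>i k j. i \<le> k \<Longrightarrow> k < j \<Longrightarrow> M k i + \<theta> \<le> M k j"
  shows "Lim U (\<lambda>i. Lim U (\<lambda>k. M k i)) + \<theta> \<le> Lim U (\<lambda>k. Lim U (\<lambda>j. M k j))"
proof -
  have nb: "U \<noteq> bot" using U by (simp add: ultrafilter_def)
  have ev: "eventually P U" if "eventually P sequentially" for P
    using that U(2) by (simp add: filter_leD)
  have t1: "((\<lambda>j. M k j) \<longlongrightarrow> Lim U (\<lambda>j. M k j)) U" for k
    by (rule tendsto_LimI[OF U(1), of _ 1]) (simp add: b)
  have t2: "((\<lambda>k. M k i) \<longlongrightarrow> Lim U (\<lambda>k. M k i)) U" for i
    by (rule tendsto_LimI[OF U(1), of _ 1]) (simp add: b)
  have t3: "((\<lambda>k. Lim U (\<lambda>j. M k j)) \<longlongrightarrow> Lim U (\<lambda>k. Lim U (\<lambda>j. M k j))) U"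
    by (rule tendsto_LimI[OF U(1), of _ 1], rule norm_Lim_le[OF U(1)]) (simp add: b)
  have t4: "((\<lambda>i. Lim U (\<lambda>k. M k i)) \<longlongrightarrow> Lim U (\<lambda>i. Lim U (\<lambda>k. M k i))) U"
    by (rule tendsto_LimI[OF U(1), of _ 1], rule norm_Lim_le[OF U(1)]) (simp add: b)
  have 1: "M k i + \<theta> \<le> Lim U (\<lambda>j. M k j)" if "i \<le> k" for i k
    by (rule tendsto_lowerbound[OF t1 _ nb], rule ev)
      (use gap[OF that] in \<open>auto intro: eventually_mono[OF eventually_gt_at_top[of k]]\<close>)
  have 2: "Lim U (\<lambda>k. M k i) + \<theta> \<le> Lim U (\<lambda>k. Lim U (\<lambda>j. M k j))" for i
    by (rule tendsto_le[OF nb t3 tendsto_add[OF t2 tendsto_const]], rule ev)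
      (use 1 in \<open>auto intro: eventually_mono[OF eventually_ge_at_top[of i]]\<close>)
  show ?thesis
    by (rule tendsto_upperbound[OF tendsto_add[OF t4 tendsto_const] _ nb]) (use 2 in auto)
qed


section \<open>The ultrapower of a Banach space\<close>

context banach_over
begin

text \<open>The sort links inner product and multiplication through the norm only, so no formula
  with conjugates is at hand. Instead, \<open>J\<close> sends \<open>e\<close> to the Riesz
  representative of \<open>(c * e) \<bullet> 1\<close> as a functional of \<open>c\<close>. It is
  injective, as the scalar \<open>c = 1 / e\<close> shows, and hence onto by dimension.\<close>

lemma scalar_representation:
  fixes \<phi> :: "'k \<Rightarrow> real"
  assumes "linear \<phi>"
  shows "\<exists>!e. \<forall>c. (c * e) \<bullet> (1::'k) = \<phi> c"
proof -
  have riesz: "\<exists>d. \<forall>c. \<psi> c = c \<bullet> d" if "linear \<psi>" for \<psi> :: "'k \<Rightarrow> real"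
  proof -
    interpret linear \<psi> by fact
    have "\<psi> c = c \<bullet> (\<Sum>b\<in>Basis. \<psi> b *\<^sub>R b)" for c
    proof -
      have "\<psi> c = \<psi> (\<Sum>b\<in>Basis. (c \<bullet> b) *\<^sub>R b)" by (simp add: euclidean_representation)
      also have "\<dots> = (\<Sum>b\<in>Basis. (c \<bullet> b) * \<psi> b)" by (simp add: sum scaleR)
      finally show ?thesis by (simp add: inner_sum_right mult.commute)
    qed
    then show ?thesis by blast
  qed
  have one: "(1::'k) \<bullet> 1 = 1" by (simp add: dot_square_norm)
  define J where "J e = (\<Sum>b\<in>Basis. ((b * e) \<bullet> (1::'k)) *\<^sub>R b)" for e :: 'k
  have J: "c \<bullet> J e = (c * e) \<bullet> 1" for c e
  proof -
    have "(c * e) \<bullet> 1 = ((\<Sum>b\<in>Basis. (c \<bullet> b) *\<^sub>R b) * e) \<bullet> 1"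
      by (simp add: euclidean_representation)
    then show ?thesis
      by (simp add: J_def inner_sum_right inner_sum_left sum_distrib_right mult.commute[of "c \<bullet> _"])
  qed
  have nondeg: "e = 0" if "\<And>c. (c * e) \<bullet> (1::'k) = 0" for e
    using that[of "1 / e"] one by (cases "e = 0") auto
  have "linear J"
    by (rule linearI) (simp_all add: J_def algebra_simps inner_add_left sum.distrib scaleR_sum_right)
  moreover have "inj J"
  proof (rule injI)
    fix e e' assume "J e = J e'"
    then have "(c * (e - e')) \<bullet> (1::'k) = 0" for c
      using J[of c e] J[of c e'] by (simp add: algebra_simps inner_diff_left)
    then show "e = e'" using nondeg[of "e - e'"] by simp
  qed
  ultimately have surj: "surj J" by (rule linear_injective_imp_surjective) (rule refl)
  obtain d where d: "\<And>c. \<phi> c = c \<bullet> d" using riesz[OF assms] by blast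
  obtain e where e: "J e = d" using surj by (metis surjD)
  show ?thesis
  proof (rule ex1I[of _ e])
    show "\<forall>c. (c * e) \<bullet> 1 = \<phi> c" using J[of _ e] e d by simp
    fix e' assume "\<forall>c. (c * e') \<bullet> 1 = \<phi> c"
    then have "(c * (e' - e)) \<bullet> 1 = 0" for c
      using J[of c e] e d by (simp add: algebra_simps inner_diff_left)
    then show "e' = e" using nondeg[of "e' - e"] by simp
  qed
qed

text \<open>The usual complexification of a real functional, done for both fields at once, with the
  inner product with 1 in the role of the real part. Rotating \<open>v\<close> by a scalar of norm 1
  makes \<open>h v\<close> a non-negative multiple of 1, which gives the norm bound.\<close>

lemma linear_functional_lift:
  fixes g :: "'a \<Rightarrow>\<^sub>L real"
  assumes "norm g \<le> 1"
  obtains h :: "'a \<Rightarrow> 'k" where "\<And>u v. h (u + v) = h u + h v" "\<And>c v. h (smul c v) = c * h v"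
    "\<And>v. h v \<bullet> 1 = g v" "\<And>v. norm (h v) \<le> norm v"
proof -
  have "linear (\<lambda>c. g (smul c v))" for v
  proof (rule linearI)
    fix r c
    have "smul (r *\<^sub>R c) v = r *\<^sub>R smul c v"
      by (simp add: scaleR_conv_of_real scale_of_real flip: scale_scale)
    then show "g (smul (r *\<^sub>R c) v) = r *\<^sub>R g (smul c v)" by (simp add: blinfun.scaleR_right)
  qed (simp add: scale_left_distrib blinfun.add_right)
  then have ex: "\<exists>!e. \<forall>c. (c * e) \<bullet> (1::'k) = g (smul c v)" for v
    using scalar_representation by blast
  define h where "h v = (THE e. \<forall>c. (c * e) \<bullet> (1::'k) = g (smul c v))" for v
  have h: "(c * h v) \<bullet> 1 = g (smul c v)" for c v
    using theI'[OF ex[of v]] unfolding h_def by blast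
  have hI: "h v = e" if "\<And>c. (c * e) \<bullet> 1 = g (smul c v)" for e v
    using ex[of v] that h by blast
  show ?thesis
  proof (rule that[of h])
    show "h (u + v) = h u + h v" for u v
      by (rule hI) (simp add: algebra_simps inner_add_left h scale_right_distrib blinfun.add_right)
    show "h (smul c v) = c * h v" for c v
    proof (rule hI)
      fix d show "(d * (c * h v)) \<bullet> 1 = g (smul d (smul c v))"
        using h[of "d * c" v] by (simp add: mult.assoc)
    qed
    show "h v \<bullet> 1 = g v" for v using h[of 1 v] by simp
    show "norm (h v) \<le> norm v" for v
    proof (cases "h v = 0")
      case False
      define c where "c = of_real (norm (h v)) / h v"
      have c: "norm c = 1" using False by (simp add: c_def norm_divide)
      have "norm (h v) = (c * h v) \<bullet> 1"
      proof -
        have "c * h v = norm (h v) *\<^sub>R 1" using False by (simp add: c_def scaleR_conv_of_real)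
        then show ?thesis by (simp add: dot_square_norm)
      qed
      also have "\<dots> \<le> norm g * norm (smul c v)"
        using norm_blinfun[of g "smul c v"] by (simp add: h)
      also have "\<dots> \<le> norm v" using assms c by (simp add: norm_scale mult_left_le_one_le)
      finally show ?thesis .
    qed simp
  qed
qed

end

locale ultrapower = banach_over smul
  for smul :: "'k::{real_normed_field,euclidean_space} \<Rightarrow> 'a::banach \<Rightarrow> 'a" +
  fixes U :: "nat filter"
  assumes ultra: "ultrafilter U" and free: "U \<le> sequentially"
begin

definition seqscale :: "'k \<Rightarrow> (nat \<Rightarrow> 'a) \<Rightarrow> nat \<Rightarrow> 'a" where
  "seqscale c v = (\<lambda>n. smul c (v n))"

sublocale S: vector_space seqscale
  by unfold_locales (auto simp: seqscale_def fun_eq_iff scale_right_distrib scale_left_distrib)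

definition bseq :: "(nat \<Rightarrow> 'a) set" where
  "bseq = {v. bounded (range v)}"

definition unorm :: "(nat \<Rightarrow> 'a) \<Rightarrow> real" where
  "unorm v = Lim U (\<lambda>n. norm (v n))"

definition nulls :: "(nat \<Rightarrow> 'a) set" where
  "nulls = {v \<in> bseq. unorm v = 0}"

lemma nb: "U \<noteq> bot"
  using ultra by (simp add: ultrafilter_def)

lemma bseqI: "(\<And>n. norm (v n) \<le> C) \<Longrightarrow> v \<in> bseq"
  unfolding bseq_def using bounded_rangeI by blast

lemma bseqE: assumes "v \<in> bseq" obtains C where "\<And>n. norm (v n) \<le> C"
proof -
  from assms obtain C where "\<forall>x\<in>range v. norm x \<le> C" by (auto simp: bseq_def bounded_pos)
  then show ?thesis by (intro that[of C]) auto
qed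

lemma tendsto_unorm: "v \<in> bseq \<Longrightarrow> ((\<lambda>n. norm (v n)) \<longlongrightarrow> unorm v) U"
proof -
  assume "v \<in> bseq"
  then obtain C where "\<And>n. norm (v n) \<le> C" using bseqE by blast
  then show ?thesis unfolding unorm_def by (intro tendsto_LimI[OF ultra, of _ C]) simp
qed

lemma unorm_eqI: "((\<lambda>n. norm (v n)) \<longlongrightarrow> l) U \<Longrightarrow> unorm v = l"
  unfolding unorm_def by (rule Lim_eqI[OF ultra])

lemma bseq_add: "u \<in> bseq \<Longrightarrow> v \<in> bseq \<Longrightarrow> u + v \<in> bseq"
  by (auto simp: bseq_def intro: bounded_plus_comp)

lemma bseq_scale: assumes "v \<in> bseq" shows "seqscale c v \<in> bseq"
proof -
  from assms obtain C where "\<And>n. norm (v n) \<le> C" using bseqE by blast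
  then show ?thesis
    by (intro bseqI[of _ "norm c * C"]) (simp add: seqscale_def norm_scale mult_left_mono)
qed

lemma bseq_zero: "0 \<in> bseq"
  by (rule bseqI[of _ 0]) simp

lemma unorm_ge0: "v \<in> bseq \<Longrightarrow> 0 \<le> unorm v"
  by (rule tendsto_lowerbound[OF tendsto_unorm _ nb]) auto

lemma unorm_le: "v \<in> bseq \<Longrightarrow> eventually (\<lambda>n. norm (v n) \<le> C) U \<Longrightarrow> unorm v \<le> C"
  by (rule tendsto_upperbound[OF tendsto_unorm _ nb]) auto

lemma unorm_triangle: "u \<in> bseq \<Longrightarrow> v \<in> bseq \<Longrightarrow> unorm (u + v) \<le> unorm u + unorm v"
  by (rule tendsto_le[OF nb tendsto_add[OF tendsto_unorm tendsto_unorm] tendsto_unorm[OF bseq_add]])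
    (auto intro: always_eventually norm_triangle_ineq)

lemma unorm_scale: "v \<in> bseq \<Longrightarrow> unorm (seqscale c v) = norm c * unorm v"
  by (rule unorm_eqI) (simp add: seqscale_def norm_scale tendsto_mult_left tendsto_unorm)

lemma unorm_zero: "unorm 0 = 0"
  by (rule unorm_eqI) simp

lemma seqscale_minus: "seqscale (-1) v = - v"
  by (simp add: seqscale_def fun_eq_iff)

lemma bseq_diff: "u \<in> bseq \<Longrightarrow> v \<in> bseq \<Longrightarrow> u - v \<in> bseq"
  using bseq_add[of u "- v"] bseq_scale[of v "-1"] by (simp add: seqscale_minus)

lemma unorm_minus: "v \<in> bseq \<Longrightarrow> unorm (- v) = unorm v"
  using unorm_scale[of v "-1"] by (simp add: seqscale_minus)

lemma subspace_bseq: "S.subspace bseq"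
  by (rule S.subspaceI) (auto simp: bseq_zero bseq_add bseq_scale)

lemma subspace_nulls: "S.subspace nulls"
proof (rule S.subspaceI)
  fix u v assume "u \<in> nulls" "v \<in> nulls"
  then show "u + v \<in> nulls"
    using unorm_triangle[of u v] unorm_ge0[of "u + v"] by (simp add: nulls_def bseq_add)
qed (auto simp: nulls_def bseq_zero unorm_zero bseq_scale unorm_scale)

text \<open>The values of the projection serve as representatives of the elements of the ultrapower,
  which makes evaluation at an index linear on the ultrapower.\<close>

lemma ex_proj:
  "\<exists>P. Vector_Spaces.linear seqscale seqscale P \<and> (\<forall>v\<in>nulls. P v = 0) \<and> (\<forall>v. v - P v \<in> nulls)"
proof -
  interpret SP: vector_space_pair seqscale seqscale ..
  obtain B0 where B0: "B0 \<subseteq> nulls" "S.independent B0" "nulls \<subseteq> S.span B0"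
    by (rule S.maximal_independent_subset)
  define B where "B = S.extend_basis B0"
  have B: "B0 \<subseteq> B" "S.independent B" "S.span B = UNIV"
    using S.extend_basis_superset S.independent_extend_basis S.span_extend_basis B0(2)
    by (auto simp: B_def)
  \<comment> \<open>\<open>P\<close> kills a basis of \<open>nulls\<close> and fixes the vectors
    that extend it to a basis of all sequences. So \<open>P\<close> vanishes on \<open>nulls\<close>
    and moves every sequence by an element of \<open>nulls\<close> only.\<close>
  obtain P where P: "Vector_Spaces.linear seqscale seqscale P" "\<And>b. b \<in> B \<Longrightarrow> P b = (if b \<in> B0 then 0 else b)"
    using SP.linear_independent_extend[OF B(2), of "\<lambda>b. if b \<in> B0 then 0 else b"] by blast
  interpret P: Vector_Spaces.linear seqscale seqscale P by (rule P)
  have "P v = 0" if "v \<in> S.span B0" for v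
  proof -
    have "B0 \<subseteq> {v. P v = 0}" using P(2) B(1) by auto
    then show ?thesis using that S.span_minimal[OF _ P.subspace_kernel] by blast
  qed
  moreover have "v - P v \<in> nulls" for v
  proof -
    have "S.subspace {v. v - P v \<in> nulls}"
    proof (rule S.subspaceI)
      show "0 \<in> {v. v - P v \<in> nulls}" using S.subspace_0[OF subspace_nulls] by (simp add: P.zero)
    next
      fix u v assume "u \<in> {v. v - P v \<in> nulls}" "v \<in> {v. v - P v \<in> nulls}"
      then have "(u - P u) + (v - P v) \<in> nulls" by (auto intro: S.subspace_add[OF subspace_nulls])
      then show "u + v \<in> {v. v - P v \<in> nulls}" by (simp add: P.add algebra_simps)
    next
      fix c v assume "v \<in> {v. v - P v \<in> nulls}"
      then have "seqscale c (v - P v) \<in> nulls" by (auto intro: S.subspace_scale[OF subspace_nulls])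
      then show "seqscale c v \<in> {v. v - P v \<in> nulls}"
        by (simp add: P.scale S.scale_right_diff_distrib)
    qed
    moreover have "B \<subseteq> {v. v - P v \<in> nulls}"
      using P(2) B0(1) S.subspace_0[OF subspace_nulls] by auto
    ultimately have "S.span B \<subseteq> {v. v - P v \<in> nulls}" by (intro S.span_minimal)
    then show ?thesis using B(3) by blast
  qed
  ultimately show ?thesis using P(1) B0(3) by blast
qed

definition proj :: "(nat \<Rightarrow> 'a) \<Rightarrow> nat \<Rightarrow> 'a" where
  "proj = (SOME P. Vector_Spaces.linear seqscale seqscale P \<and> (\<forall>v\<in>nulls. P v = 0) \<and> (\<forall>v. v - P v \<in> nulls))"

lemma linear_proj: "Vector_Spaces.linear seqscale seqscale proj"
  and proj_nulls: "v \<in> nulls \<Longrightarrow> proj v = 0"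
  and diff_proj: "u - proj u \<in> nulls"
  using someI_ex[OF ex_proj] unfolding proj_def by blast+

definition reps :: "(nat \<Rightarrow> 'a) set" where
  "reps = proj ` bseq"

lemma proj_bseq: "v \<in> bseq \<Longrightarrow> proj v \<in> bseq"
  using bseq_diff[of v "v - proj v"] diff_proj[of v] by (simp add: nulls_def)

lemma reps_bseq: "v \<in> reps \<Longrightarrow> v \<in> bseq"
  by (auto simp: reps_def proj_bseq)

lemma proj_reps: assumes "v \<in> reps" shows "proj v = v"
proof -
  interpret P: Vector_Spaces.linear seqscale seqscale proj by (rule linear_proj)
  obtain u where u: "v = proj u" using assms by (auto simp: reps_def)
  have "proj (u - proj u) = 0" by (rule proj_nulls[OF diff_proj])
  then show ?thesis using u by (simp add: P.diff)
qed

lemma subspace_reps: "S.subspace reps"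
proof -
  interpret P: Vector_Spaces.linear seqscale seqscale proj by (rule linear_proj)
  show ?thesis unfolding reps_def by (rule P.subspace_image[OF subspace_bseq])
qed

lemmas reps_add = S.subspace_add[OF subspace_reps]
  and reps_scale = S.subspace_scale[OF subspace_reps]
  and reps_zero = S.subspace_0[OF subspace_reps]
  and reps_diff = S.subspace_diff[OF subspace_reps]

lemma unorm_eq_0: "v \<in> reps \<Longrightarrow> unorm v = 0 \<longleftrightarrow> v = 0"
  using proj_nulls[of v] proj_reps[of v] reps_bseq[of v] by (auto simp: nulls_def unorm_zero)

lemma unorm_proj: assumes "v \<in> bseq" shows "unorm (v - proj v) = 0" "unorm (proj v) = unorm v"
proof -
  show 0: "unorm (v - proj v) = 0" using diff_proj[of v] by (simp add: nulls_def)
  have b: "v - proj v \<in> bseq" "proj v \<in> bseq" using assms by (auto simp: proj_bseq bseq_diff)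
  then show "unorm (proj v) = unorm v"
    using unorm_triangle[of "v - proj v" "proj v"] unorm_triangle[of v "- (v - proj v)"] 0
      unorm_minus[of "v - proj v"] bseq_scale[OF b(1), of "-1"] assms
    by (simp add: seqscale_minus)
qed

text \<open>Along a subsequence with geometrically small differences, each difference is cut off at
  the coordinates where it is too large. The cut concerns only a set negligible for
  \<open>U\<close>, and afterwards the telescoping series converges in every coordinate, with
  uniform bounds on its tails.\<close>

lemma unorm_complete:
  assumes v: "\<And>k. v k \<in> bseq"
    and cauchy: "\<And>e. e > 0 \<Longrightarrow> \<exists>N. \<forall>m\<ge>N. \<forall>n\<ge>N. unorm (v m - v n) < e"
  obtains l where "l \<in> bseq" "(\<lambda>k. unorm (v k - l)) \<longlonglongrightarrow> 0"
proof -
  have "\<exists>N. \<forall>i. \<forall>m\<ge>N i. \<forall>n\<ge>N i. unorm (v m - v n) < (1/2)^i"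
    by (intro choice allI cauchy) simp
  then obtain N where N: "\<And>i m n. N i \<le> m \<Longrightarrow> N i \<le> n \<Longrightarrow> unorm (v m - v n) < (1/2)^i" by blast
  \<comment> \<open>Partial sums in place of maxima give at once that \<open>k i\<close> and
    \<open>k (Suc i)\<close> are both at least \<open>N i\<close>.\<close>
  define k where "k i = (\<Sum>j\<le>i. N j)" for i
  have kN: "N i \<le> k i" for i unfolding k_def by (rule member_le_sum) auto
  have kS: "N i \<le> k (Suc i)" for i using kN[of i] by (simp add: k_def)
  define d where "d i n = v (k (Suc i)) n - v (k i) n" for i n
  have db: "d i \<in> bseq" and dn: "unorm (d i) < (1/2)^i" for i
  proof -
    have "d i = v (k (Suc i)) - v (k i)" by (simp add: d_def fun_eq_iff)
    then show "d i \<in> bseq" "unorm (d i) < (1/2)^i" using N[OF kS kN] v by (auto intro: bseq_diff)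
  qed
  define d' where "d' i n = (if norm (d i n) \<le> (1/2)^i then d i n else 0)" for i n
  have d'b: "norm (d' i n) \<le> (1/2)^i" for i n by (simp add: d'_def)
  have sm: "summable (\<lambda>i. norm (d' i n))" for n
    by (rule summable_comparison_test'[OF summable_geometric[of "1/2::real"]]) (auto simp: d'b)
  have ev: "eventually (\<lambda>n. d' i n = d i n) U" for i
    using order_tendstoD(2)[OF tendsto_unorm[OF db] dn[of i]]
    by (rule eventually_mono) (simp add: d'_def)
  define l where "l n = v (k 0) n + (\<Sum>i. d' i n)" for n
  have tail: "norm (\<Sum>i. d' (i + j) n) \<le> 2 * (1/2)^j" for j n
  proof -
    have "norm (\<Sum>i. d' (i + j) n) \<le> (\<Sum>i. norm (d' (i + j) n))"
      by (rule summable_norm) (use sm in \<open>simp add: summable_iff_shift[of "\<lambda>i. norm (d' i n)"]\<close>)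
    also have "\<dots> \<le> (\<Sum>i. (1/2)^i * (1/2)^j)"
      by (rule suminf_le) (use d'b sm in \<open>auto simp: power_add[symmetric]
        summable_iff_shift[of "\<lambda>i. norm (d' i n)"] intro!: summable_mult2 summable_geometric\<close>)
    also have "\<dots> = 2 * (1/2)^j"
      by (subst suminf_mult2[symmetric]) (auto simp: suminf_geometric summable_geometric)
    finally show ?thesis .
  qed
  have lb: "l \<in> bseq"
  proof -
    obtain C where "\<And>n. norm (v (k 0) n) \<le> C" using v bseqE by blast
    then have "norm (l n) \<le> C + 2" for n
      using tail[of 0 n] norm_triangle_ineq[of "v (k 0) n" "\<Sum>i. d' i n"]
      unfolding l_def by (smt (verit) add_0_right power_0 suminf_cong)
    then show ?thesis by (rule bseqI)
  qed
  have ub: "unorm (v (k j) - l) \<le> 2 * (1/2)^j" for j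
  proof (rule unorm_le)
    show "v (k j) - l \<in> bseq" using v lb by (rule bseq_diff)
    have "eventually (\<lambda>n. \<forall>i\<in>{..<j}. d' i n = d i n) U"
      by (rule eventually_ball_finite) (auto simp: ev)
    then show "eventually (\<lambda>n. norm ((v (k j) - l) n) \<le> 2 * (1/2)^j) U"
    proof (rule eventually_mono)
      fix n assume n: "\<forall>i\<in>{..<j}. d' i n = d i n"
      have "(\<Sum>i. d' i n) = (\<Sum>i. d' (i + j) n) + (\<Sum>i<j. d' i n)"
        by (rule suminf_split_initial_segment) (rule summable_norm_cancel[OF sm])
      also have "(\<Sum>i<j. d' i n) = (\<Sum>i<j. v (k (Suc i)) n - v (k i) n)"
        using n by (intro sum.cong) (auto simp: d_def)
      also have "\<dots> = v (k j) n - v (k 0) n"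
        by (rule sum_lessThan_telescope)
      finally have "(v (k j) - l) n = - (\<Sum>i. d' (i + j) n)" by (simp add: l_def)
      then show "norm ((v (k j) - l) n) \<le> 2 * (1/2)^j" using tail[of j n] by simp
    qed
  qed
  show ?thesis
  proof (rule that[OF lb], rule LIMSEQ_I)
    fix e :: real assume "e > 0"
    then obtain j where j: "(1/2::real)^j < e / 3" using real_arch_pow_inv[of "e/3" "1/2"] by auto
    have "norm (unorm (v m - l) - 0) < e" if m: "k j \<le> m" for m
    proof -
      have "unorm (v m - l) \<le> unorm (v m - v (k j)) + unorm (v (k j) - l)"
        using unorm_triangle[of "v m - v (k j)" "v (k j) - l"] v lb by (simp add: bseq_diff)
      also have "unorm (v m - v (k j)) < (1/2)^j"
        using kN[of j] m by (intro N) auto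
      also have "unorm (v (k j) - l) \<le> 2 * (1/2)^j" by (rule ub)
      finally show ?thesis using j unorm_ge0[of "v m - l"] v lb by (simp add: bseq_diff)
    qed
    then show "\<exists>no. \<forall>n\<ge>no. norm (unorm (v n - l) - 0) < e" by blast
  qed
qed

text \<open>Otherwise normalized coefficient vectors violating the estimate would converge along the
  ultrafilter to a non-trivial one.\<close>

lemma eventually_almost_isometric:
  assumes B: "finite B" "B \<subseteq> reps" and "0 < \<epsilon>"
  shows "eventually (\<lambda>n. \<forall>v\<in>S.span B. \<bar>norm (v n) - unorm v\<bar> \<le> \<epsilon> * unorm v) U"
proof (rule ccontr)
  assume "\<not> ?thesis"
  then have ev: "eventually (\<lambda>n. \<exists>v\<in>S.span B. \<epsilon> * unorm v < \<bar>norm (v n) - unorm v\<bar>) U"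
    using ultra by (auto simp: ultrafilter_def not_le)
  \<comment> \<open>Independence guarantees below that a non-zero limit of coefficient vectors
    represents a non-zero element.\<close>
  obtain B' where B': "B' \<subseteq> B" "S.independent B'" "B \<subseteq> S.span B'"
    by (rule S.maximal_independent_subset)
  have fin: "finite B'" using B B' finite_subset by blast
  have bb: "b \<in> bseq" if "b \<in> B'" for b using that B B' reps_bseq by blast
  have span: "S.span B = S.span B'"
    by (rule S.span_eq[THEN iffD2]) (use B' S.span_superset in blast)
  define comb where "comb c = (\<Sum>b\<in>B'. seqscale (c b) b)" for c :: "(nat \<Rightarrow> 'a) \<Rightarrow> 'k"
  have comb_reps: "comb c \<in> reps" for c
    unfolding comb_def using B B' by (intro S.subspace_sum[OF subspace_reps] reps_scale) auto
  have comb_apply: "comb c n = (\<Sum>b\<in>B'. smul (c b) (b n))" for c n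
  proof -
    have "(\<Sum>b\<in>A. seqscale (c b) b) n = (\<Sum>b\<in>A. smul (c b) (b n))" if "finite A" for A
      using that by induction (auto simp: seqscale_def)
    then show ?thesis using fin by (simp add: comb_def)
  qed
  have comb_diff: "comb c - comb c' = comb (\<lambda>b. c b - c' b)" for c c'
    by (simp add: comb_def S.scale_left_diff_distrib sum_subtractf)
  have unorm_comb: "unorm (comb c) \<le> (\<Sum>b\<in>B'. norm (c b) * unorm b)" for c
  proof -
    have "(\<Sum>b\<in>A. seqscale (c b) b) \<in> bseq \<and>
      unorm (\<Sum>b\<in>A. seqscale (c b) b) \<le> (\<Sum>b\<in>A. norm (c b) * unorm b)" if "finite A" "A \<subseteq> B'" for A
      using that
    proof induction
      case (insert b A)
      have e: "(\<Sum>b\<in>insert b A. seqscale (c b) b) = seqscale (c b) b + (\<Sum>b\<in>A. seqscale (c b) b)"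
        by (rule sum.insert[OF insert(1,2)])
      have IH: "(\<Sum>b\<in>A. seqscale (c b) b) \<in> bseq"
        "unorm (\<Sum>b\<in>A. seqscale (c b) b) \<le> (\<Sum>b\<in>A. norm (c b) * unorm b)" "b \<in> bseq"
        using insert bb by auto
      have "unorm (seqscale (c b) b + (\<Sum>b\<in>A. seqscale (c b) b))
          \<le> unorm (seqscale (c b) b) + unorm (\<Sum>b\<in>A. seqscale (c b) b)"
        by (intro unorm_triangle bseq_scale IH)
      also have "\<dots> \<le> norm (c b) * unorm b + (\<Sum>b\<in>A. norm (c b) * unorm b)"
        using IH by (simp add: unorm_scale)
      also have "\<dots> = (\<Sum>b\<in>insert b A. norm (c b) * unorm b)" using insert by simp
      finally show ?case unfolding e by (rule conjI[OF bseq_add[OF bseq_scale[OF IH(3)] IH(1)]])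
    qed (simp add: bseq_zero unorm_zero)
    then show ?thesis using fin by (simp add: comb_def)
  qed
  have "\<exists>c. (\<forall>b. norm (c b) \<le> 1) \<and> (\<exists>b\<in>B'. norm (c b) = 1) \<and>
      \<epsilon> * unorm (comb c) < \<bar>norm (comb c n) - unorm (comb c)\<bar>"
    if n: "\<exists>v\<in>S.span B. \<epsilon> * unorm v < \<bar>norm (v n) - unorm v\<bar>" for n
  proof -
    from n obtain v where v: "v \<in> S.span B'" "\<epsilon> * unorm v < \<bar>norm (v n) - unorm v\<bar>"
      by (auto simp: span)
    then obtain a where a: "v = comb a" by (auto simp: S.span_finite[OF fin] comb_def)
    have "v \<noteq> 0" using v by (auto simp: unorm_zero)
    have "\<exists>b\<in>B'. a b \<noteq> 0"
    proof (rule ccontr)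
      assume "\<not> ?thesis"
      then have "v = 0" unfolding a comb_def by (intro sum.neutral) auto
      then show False using \<open>v \<noteq> 0\<close> by blast
    qed
    then obtain b1 where b1: "b1 \<in> B'" "a b1 \<noteq> 0" by blast
    \<comment> \<open>Dividing by the largest modulus keeps the coefficients bounded and one of them
      of modulus 1, so that they have limits which are not all zero.\<close>
    define m where "m = Max ((\<lambda>b. norm (a b)) ` B')"
    have am: "norm (a b) \<le> m" if "b \<in> B'" for b unfolding m_def using fin that by auto
    then have m0: "0 < m" using b1 by (metis less_le_trans zero_less_norm_iff)
    have "m \<in> (\<lambda>b. norm (a b)) ` B'" unfolding m_def using fin b1 by (intro Max_in) auto
    then obtain b2 where b2: "b2 \<in> B'" "norm (a b2) = m" by auto
    define c where "c b = (if b \<in> B' then of_real (1/m) * a b else 0)" for b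
    have "comb c = seqscale (of_real (1/m)) v"
      unfolding a comb_def S.scale_sum_right by (intro sum.cong) (auto simp: c_def)
    moreover have "v \<in> bseq" using a comb_reps reps_bseq by auto
    ultimately have "unorm (comb c) = (1/m) * unorm v" "norm (comb c n) = (1/m) * norm (v n)"
      using m0 by (simp add: unorm_scale norm_divide, simp add: seqscale_def norm_scale norm_divide)
    moreover have *: "(1/m) * (\<epsilon> * unorm v) < (1/m) * \<bar>norm (v n) - unorm v\<bar>"
      using v(2) m0 by (intro mult_strict_left_mono) auto
    have "\<epsilon> * ((1/m) * unorm v) < \<bar>(1/m) * norm (v n) - (1/m) * unorm v\<bar>"
    proof -
      have "\<bar>(1/m) * norm (v n) - (1/m) * unorm v\<bar> = \<bar>1/m\<bar> * \<bar>norm (v n) - unorm v\<bar>"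
        by (metis abs_mult right_diff_distrib)
      also have "\<dots> = (1/m) * \<bar>norm (v n) - unorm v\<bar>" using m0 by simp
      finally show ?thesis using * by (simp only: mult.left_commute[of \<epsilon>])
    qed
    ultimately have "\<epsilon> * unorm (comb c) < \<bar>norm (comb c n) - unorm (comb c)\<bar>" by simp
    moreover have "norm (c b) \<le> 1" for b using am[of b] m0 by (simp add: c_def norm_mult norm_divide)
    moreover have "norm (c b2) = 1" using b2 m0 by (simp add: c_def norm_mult norm_divide)
    ultimately show ?thesis using b2 by blast
  qed
  note normalized = this
  have "\<exists>c. \<forall>n. (\<forall>b. norm (c n b) \<le> 1) \<and>
    ((\<exists>v\<in>S.span B. \<epsilon> * unorm v < \<bar>norm (v n) - unorm v\<bar>) \<longrightarrow> (\<exists>b\<in>B'. norm (c n b) = 1) \<and>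
      \<epsilon> * unorm (comb (c n)) < \<bar>norm (comb (c n) n) - unorm (comb (c n))\<bar>)"
  proof (intro choice allI)
    fix n
    show "\<exists>c. (\<forall>b. norm (c b) \<le> 1) \<and>
      ((\<exists>v\<in>S.span B. \<epsilon> * unorm v < \<bar>norm (v n) - unorm v\<bar>) \<longrightarrow> (\<exists>b\<in>B'. norm (c b) = 1) \<and>
        \<epsilon> * unorm (comb c) < \<bar>norm (comb c n) - unorm (comb c)\<bar>)"
    proof (cases "\<exists>v\<in>S.span B. \<epsilon> * unorm v < \<bar>norm (v n) - unorm v\<bar>")
      case True
      from normalized[OF this] show ?thesis by blast
    next
      case False
      then show ?thesis by (intro exI[of _ "\<lambda>_. 0"]) simp
    qed
  qed
  then obtain c where cb: "\<And>n b. norm (c n b) \<le> 1"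
    and c: "\<And>n. \<exists>v\<in>S.span B. \<epsilon> * unorm v < \<bar>norm (v n) - unorm v\<bar> \<Longrightarrow> (\<exists>b\<in>B'. norm (c n b) = 1) \<and>
      \<epsilon> * unorm (comb (c n)) < \<bar>norm (comb (c n) n) - unorm (comb (c n))\<bar>"
    by blast
  define cl where "cl b = Lim U (\<lambda>n. c n b)" for b
  have cl: "((\<lambda>n. c n b) \<longlongrightarrow> cl b) U" for b
    unfolding cl_def by (rule tendsto_LimI[OF ultra, of _ 1]) (simp add: cb)
  \<comment> \<open>If all limits vanished, the finitely many coefficients would eventually all have
    modulus below 1, against the normalization.\<close>
  have "\<exists>b\<in>B'. cl b \<noteq> 0"
  proof (rule ccontr)
    assume "\<not> ?thesis"
    then have "eventually (\<lambda>n. norm (c n b) < 1) U" if "b \<in> B'" for b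
      using that order_tendstoD(2)[OF tendsto_norm[OF cl[of b]], of 1] by simp
    then have "eventually (\<lambda>n. \<forall>b\<in>B'. norm (c n b) < 1) U"
      using fin by (intro eventually_ball_finite) auto
    with ev have "eventually (\<lambda>n. False) U"
      by eventually_elim (use c in \<open>metis less_irrefl\<close>)
    then show False using nb by (simp add: trivial_limit_def)
  qed
  then have "comb cl \<noteq> 0"
    using B'(2) unfolding comb_def S.dependent_finite[OF fin] by blast
  then have pos: "0 < unorm (comb cl)"
    using unorm_eq_0[OF comb_reps] unorm_ge0[OF reps_bseq[OF comb_reps]] by (metis less_le)
  define D where "D n = (\<Sum>b\<in>B'. norm (c n b - cl b) * unorm b)" for n
  have D: "(D \<longlongrightarrow> 0) U"
  proof -
    have "((\<lambda>n. \<Sum>b\<in>B'. norm (c n b - cl b) * unorm b) \<longlongrightarrow> (\<Sum>b\<in>B'. norm (cl b - cl b) * unorm b)) U"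
      by (intro tendsto_intros cl)
    then show ?thesis by (simp add: D_def[abs_def])
  qed
  define E where "E n = (\<Sum>b\<in>B'. norm (c n b - cl b) * norm (b n))" for n
  have E: "(E \<longlongrightarrow> 0) U"
  proof -
    have "((\<lambda>n. \<Sum>b\<in>B'. norm (c n b - cl b) * norm (b n)) \<longlongrightarrow> (\<Sum>b\<in>B'. norm (cl b - cl b) * unorm b)) U"
      by (intro tendsto_intros cl tendsto_unorm bb)
    then show ?thesis by (simp add: E_def[abs_def])
  qed
  have 1: "\<bar>unorm (comb (c n)) - unorm (comb cl)\<bar> \<le> D n" for n
  proof -
    have "unorm (comb (c n) - comb cl) \<le> D n"
      using unorm_comb[of "\<lambda>b. c n b - cl b"] by (simp add: comb_diff D_def)
    moreover have "unorm (comb cl - comb (c n)) \<le> D n"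
      using unorm_comb[of "\<lambda>b. cl b - c n b"] by (simp add: comb_diff D_def norm_minus_commute)
    ultimately show ?thesis
      using unorm_triangle[of "comb (c n) - comb cl" "comb cl"]
        unorm_triangle[of "comb cl - comb (c n)" "comb (c n)"] comb_reps reps_bseq
      by (simp add: bseq_diff abs_le_iff)
  qed
  have 2: "\<bar>norm (comb (c n) n) - norm (comb cl n)\<bar> \<le> E n" for n
  proof -
    have "norm (comb (c n) n - comb cl n) = norm (\<Sum>b\<in>B'. smul (c n b - cl b) (b n))"
      by (simp add: comb_apply scale_left_diff_distrib sum_subtractf)
    also have "\<dots> \<le> E n" unfolding E_def by (rule sum_norm_le) (simp add: norm_scale)
    finally show ?thesis using norm_triangle_ineq3 order_trans by blast
  qed
  have t1: "((\<lambda>n. unorm (comb (c n))) \<longlongrightarrow> unorm (comb cl)) U"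
  proof -
    have "((\<lambda>n. unorm (comb (c n)) - unorm (comb cl)) \<longlongrightarrow> 0) U"
      by (rule Lim_null_comparison[OF _ D]) (simp add: 1)
    then show ?thesis by (simp add: LIM_zero_iff)
  qed
  have t2: "((\<lambda>n. norm (comb (c n) n)) \<longlongrightarrow> unorm (comb cl)) U"
  proof -
    have "((\<lambda>n. norm (comb (c n) n) - norm (comb cl n)) \<longlongrightarrow> 0) U"
      by (rule Lim_null_comparison[OF _ E]) (simp add: 2)
    from tendsto_add[OF this tendsto_unorm[OF reps_bseq[OF comb_reps[of cl]]]] show ?thesis by simp
  qed
  have "((\<lambda>n. \<bar>norm (comb (c n) n) - unorm (comb (c n))\<bar>) \<longlongrightarrow> \<bar>unorm (comb cl) - unorm (comb cl)\<bar>) U"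
    by (intro tendsto_intros t1 t2)
  then have "\<epsilon> * unorm (comb cl) \<le> \<bar>unorm (comb cl) - unorm (comb cl)\<bar>"
  proof (rule tendsto_le[OF nb _ tendsto_mult_left[OF t1]])
    show "eventually (\<lambda>n. \<epsilon> * unorm (comb (c n)) \<le> \<bar>norm (comb (c n) n) - unorm (comb (c n))\<bar>) U"
      using ev by (rule eventually_mono) (rule less_imp_le, use c in blast)
  qed
  then show False using pos \<open>0 < \<epsilon>\<close> by (simp add: mult_le_0_iff)
qed

text \<open>The elements are singletons of representatives because \<open>superreflexive\<close>
  tests spaces with carrier in the type \<open>(nat \<Rightarrow> 'a) set\<close>.\<close>

definition upower :: "('k, (nat \<Rightarrow> 'a) set) nspace" where
  "upower = \<lparr>vcarrier = (\<lambda>v. {v}) ` reps, vzero = {0},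
     vadd = (\<lambda>A B. {the_elem A + the_elem B}), vscale = (\<lambda>c A. {seqscale c (the_elem A)}),
     vnorm = (\<lambda>A. unorm (the_elem A))\<rparr>"

lemma upower_simps [simp]:
  "vcarrier upower = (\<lambda>v. {v}) ` reps" "vzero upower = {0}"
  "vadd upower {u} {v} = {u + v}" "vscale upower c {v} = {seqscale c v}" "vnorm upower {v} = unorm v"
  by (simp_all add: upower_def)

lemma vdist_upower: "vdist upower {u} {v} = unorm (u - v)"
  by (simp add: vdist_def seqscale_minus)

lemma banach_space_upower: "banach_space upower"
proof
  fix s :: "nat \<Rightarrow> (nat \<Rightarrow> 'a) set"
  assume s: "\<And>n. s n \<in> vcarrier upower"
    and c: "\<forall>e>0. \<exists>N. \<forall>m\<ge>N. \<forall>n\<ge>N. vdist upower (s m) (s n) < e"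
  define v where "v n = the_elem (s n)" for n
  have sv: "s n = {v n}" and v: "v n \<in> reps" for n
  proof -
    obtain r where "s n = {r}" "r \<in> reps" using s[of n] by auto
    then show "s n = {v n}" "v n \<in> reps" by (simp_all add: v_def)
  qed
  have "\<exists>N. \<forall>m\<ge>N. \<forall>n\<ge>N. unorm (v m - v n) < e" if "e > 0" for e
    using c that unfolding sv vdist_upower by blast
  then obtain l where l: "l \<in> bseq" "(\<lambda>k. unorm (v k - l)) \<longlonglongrightarrow> 0"
    by (rule unorm_complete[OF reps_bseq[OF v]])
  have "unorm (v k - proj l) = unorm (v k - l)" for k
  proof -
    interpret P: Vector_Spaces.linear seqscale seqscale proj by (rule linear_proj)
    have "proj (v k - l) = v k - proj l" by (simp add: P.diff proj_reps[OF v])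
    then show ?thesis using unorm_proj(2)[OF bseq_diff[OF reps_bseq[OF v] l(1)], of k] by simp
  qed
  then have "(\<lambda>n. vdist upower (s n) {proj l}) \<longlonglongrightarrow> 0"
    using l(2) by (simp only: sv vdist_upower)
  moreover have "proj l \<in> reps" using l(1) by (simp add: reps_def)
  ultimately show "\<exists>l\<in>vcarrier upower. (\<lambda>n. vdist upower (s n) l) \<longlonglongrightarrow> 0" by auto
next
  fix u assume "u \<in> vcarrier upower"
  then obtain v where v: "u = {v}" "v \<in> reps" by auto
  then show "\<exists>v\<in>vcarrier upower. vadd upower u v = vzero upower"
    using reps_scale[of v "-1"] by (intro bexI[of _ "{- v}"]) (auto simp: seqscale_minus)
qed (auto simp: reps_zero reps_add reps_scale ac_simps S.scale_right_distrib
    S.scale_left_distrib unorm_eq_0 unorm_scale reps_bseq unorm_triangle)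

text \<open>Evaluation of the representatives at one index is linear, and at a suitable index it is
  almost isometric on a given finite-dimensional subspace. A final scaling makes it norm-increasing,
  as the definition demands.\<close>

lemma finitely_representable_upower: "finitely_representable upower (space_of smul)"
  unfolding finitely_representable_def
proof (intro allI impI)
  fix \<epsilon> :: real and B assume "0 < \<epsilon>" and B: "finite B \<and> B \<subseteq> vcarrier upower"
  define B0 where "B0 = the_elem ` B"
  have B0: "finite B0" "B0 \<subseteq> reps" "B = (\<lambda>v. {v}) ` B0"
    using B by (auto simp: B0_def image_iff) force+
  \<comment> \<open>The solution of \<open>(1 + \<delta>) / (1 - \<delta>) = 1 + \<epsilon>\<close>:
    after division by \<open>1 - \<delta>\<close> the two-sided distortion becomes
    one-sided.\<close>
  define \<delta> where "\<delta> = \<epsilon> / (2 + \<epsilon>)"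
  have \<delta>: "0 < \<delta>" "\<delta> < 1" using \<open>0 < \<epsilon>\<close> by (auto simp: \<delta>_def)
  have \<delta>': "(1 + \<delta>) / (1 - \<delta>) = 1 + \<epsilon>" using \<open>0 < \<epsilon>\<close> by (simp add: \<delta>_def field_simps)
  obtain n where n: "\<And>v. v \<in> S.span B0 \<Longrightarrow> \<bar>norm (v n) - unorm v\<bar> \<le> \<delta> * unorm v"
    using eventually_happens'[OF nb eventually_almost_isometric[OF B0(1,2) \<delta>(1)]] by blast
  have sub: "S.span B0 \<subseteq> reps" by (rule S.span_minimal[OF B0(2) subspace_reps])
  have span: "lin_span upower B \<subseteq> (\<lambda>v. {v}) ` S.span B0"
  proof -
    have "lin_subspace upower ((\<lambda>v. {v}) ` S.span B0)"
      using sub S.span_zero S.span_add S.span_scale by (auto simp: lin_subspace_def)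
    moreover have "B \<subseteq> (\<lambda>v. {v}) ` S.span B0" using B0(3) S.span_superset by blast
    ultimately show ?thesis unfolding lin_span_def by blast
  qed
  define T where "T A = smul (of_real (1 / (1 - \<delta>))) (the_elem A n)" for A :: "(nat \<Rightarrow> 'a) set"
  show "\<exists>T. lin_map_on upower (lin_span upower B) (space_of smul) T \<and>
    (\<forall>u\<in>lin_span upower B. vnorm upower u \<le> vnorm (space_of smul) (T u) \<and>
       vnorm (space_of smul) (T u) \<le> (1 + \<epsilon>) * vnorm upower u)"
  proof (intro exI[of _ T] conjI ballI)
    show "lin_map_on upower (lin_span upower B) (space_of smul) T"
    proof -
      have "T (vadd upower u v) = vadd (space_of smul) (T u) (T v)"
        "T (vscale upower c u) = vscale (space_of smul) c (T u)"
        if uv: "u \<in> lin_span upower B" "v \<in> lin_span upower B" for u v c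
      proof -
        obtain a b where "u = {a}" "v = {b}" using uv span by blast
        then show "T (vadd upower u v) = vadd (space_of smul) (T u) (T v)"
          "T (vscale upower c u) = vscale (space_of smul) c (T u)"
          by (simp_all add: space_of_def T_def seqscale_def scale_right_distrib mult.commute)
      qed
      then show ?thesis unfolding lin_map_on_def by (auto simp: space_of_def)
    qed
  next
    fix u assume "u \<in> lin_span upower B"
    then obtain v where v: "u = {v}" "v \<in> S.span B0" using span by blast
    have "(1 - \<delta>) * unorm v \<le> norm (v n)" "norm (v n) \<le> (1 + \<delta>) * unorm v"
      using n[OF v(2)] by (auto simp: algebra_simps abs_le_iff)
    then have "unorm v \<le> norm (v n) / (1 - \<delta>)" "norm (v n) / (1 - \<delta>) \<le> (1 + \<epsilon>) * unorm v"
      using \<delta> divide_right_mono[of "norm (v n)" "(1 + \<delta>) * unorm v" "1 - \<delta>"]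
      by (simp add: field_simps, simp flip: \<delta>')
    then show "vnorm upower u \<le> vnorm (space_of smul) (T u)"
      "vnorm (space_of smul) (T u) \<le> (1 + \<epsilon>) * vnorm upower u"
      using \<delta> v(1) by (simp_all add: space_of_def T_def norm_scale norm_divide norm_inverse
        flip: of_real_diff)
  qed
qed

end

section \<open>Reflexivity of the ultrapower and iterated limits\<close>

context ultrapower
begin

definition hlim :: "(nat \<Rightarrow> 'a \<Rightarrow> 'k) \<Rightarrow> (nat \<Rightarrow> 'a) \<Rightarrow> 'k" where
  "hlim h v = Lim U (\<lambda>n. h n (v n))"

lemma
  assumes add: "\<And>n u v. h n (u + v) = h n u + h n v" and sc: "\<And>n c v. h n (smul c v) = c * h n v"
    and le: "\<And>n v. norm (h n v) \<le> norm v"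
  shows tendsto_hlim: "v \<in> bseq \<Longrightarrow> ((\<lambda>n. h n (v n)) \<longlongrightarrow> hlim h v) U"
    and hlim_add: "u \<in> bseq \<Longrightarrow> v \<in> bseq \<Longrightarrow> hlim h (u + v) = hlim h u + hlim h v"
    and hlim_scale: "v \<in> bseq \<Longrightarrow> hlim h (seqscale c v) = c * hlim h v"
    and hlim_le: "v \<in> bseq \<Longrightarrow> norm (hlim h v) \<le> unorm v"
    and hlim_proj: "v \<in> bseq \<Longrightarrow> hlim h (proj v) = hlim h v"
proof -
  show t: "((\<lambda>n. h n (v n)) \<longlongrightarrow> hlim h v) U" if v: "v \<in> bseq" for v
  proof -
    obtain C where "\<And>n. norm (v n) \<le> C" using v bseqE by blast
    then have "norm (h n (v n)) \<le> C" for n using le order_trans by blast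
    then show ?thesis unfolding hlim_def by (rule tendsto_LimI[OF ultra])
  qed
  show a: "hlim h (u + v) = hlim h u + hlim h v" if "u \<in> bseq" "v \<in> bseq" for u v
    unfolding hlim_def[of h "u + v"]
    using tendsto_add[OF t[OF that(1)] t[OF that(2)]] by (intro Lim_eqI[OF ultra]) (simp add: add)
  show "hlim h (seqscale c v) = c * hlim h v" if "v \<in> bseq" for c v
    unfolding hlim_def[of h "seqscale c v"]
    using tendsto_mult_left[OF t[OF that], of c]
    by (intro Lim_eqI[OF ultra]) (simp add: sc seqscale_def)
  show l: "norm (hlim h v) \<le> unorm v" if "v \<in> bseq" for v
    by (rule tendsto_le[OF nb tendsto_unorm[OF that] tendsto_norm[OF t[OF that]]])
      (auto intro!: always_eventually le)
  show "hlim h (proj v) = hlim h v" if "v \<in> bseq" for v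
  proof -
    have d: "v - proj v \<in> bseq" "proj v \<in> bseq" using that by (auto simp: bseq_diff proj_bseq)
    have "norm (hlim h (v - proj v)) \<le> 0" using l[OF d(1)] unorm_proj(1)[OF that] by simp
    moreover have "hlim h v = hlim h ((v - proj v) + proj v)" by simp
    ultimately show ?thesis unfolding a[OF d] by simp
  qed
qed

lemma dual_upowerI:
  assumes "\<And>u v. u \<in> reps \<Longrightarrow> v \<in> reps \<Longrightarrow> f (u + v) = f u + f v"
    and "\<And>c v. v \<in> reps \<Longrightarrow> f (seqscale c v) = c * f v"
    and "\<And>v. v \<in> reps \<Longrightarrow> norm (f v) \<le> unorm v"
  shows "(\<lambda>A. if A \<in> vcarrier upower then f (the_elem A) else 0) \<in> vcarrier (dual upower)"
  using assms reps_add reps_scale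
  by (auto simp: dual_def lin_map_on_def space_of_def image_iff intro!: exI[of _ 1])

text \<open>By reflexivity, the limit of the \<open>x _ k\<close> in the bidual is a vector, so both sides are its value
  under the limit of the \<open>g _ j\<close> in the dual.\<close>

lemma iterated_Lim_commute:
  fixes x :: "nat \<Rightarrow> nat \<Rightarrow> 'a" and g :: "nat \<Rightarrow> nat \<Rightarrow> 'a \<Rightarrow>\<^sub>L real"
  assumes refl: "reflexive upower"
    and x: "\<And>n k. norm (x n k) \<le> 1" and g: "\<And>n j. norm (g n j) \<le> 1"
  shows "Lim U (\<lambda>j. Lim U (\<lambda>k. Lim U (\<lambda>n. g n j (x n k)))) =
    Lim U (\<lambda>k. Lim U (\<lambda>j. Lim U (\<lambda>n. g n j (x n k))))"
proof -
  \<comment> \<open>Reflexivity speaks of functionals with values in the field, so the real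
    functionals \<open>g n j\<close> are lifted; the inner product with 1 recovers them at the
    end.\<close>
  define lifts where "lifts f h \<longleftrightarrow> (\<forall>u v. h (u + v) = h u + h v) \<and> (\<forall>c v. h (smul c v) = c * h v) \<and>
     (\<forall>v. h v \<bullet> (1::'k) = f v) \<and> (\<forall>v. norm (h v) \<le> norm v)" for f :: "'a \<Rightarrow> real" and h
  define h where "h n j = (SOME h. lifts (g n j) h)" for n j
  have "lifts (g n j) (h n j)" for n j
  proof -
    have "\<exists>h. lifts (g n j) h"
      by (rule linear_functional_lift[OF g[of n j]]) (unfold lifts_def, blast)
    then show ?thesis unfolding h_def by (rule someI_ex)
  qed
  then have h_add: "\<And>n j u v. h n j (u + v) = h n j u + h n j v"
    and h_sc: "\<And>n j c v. h n j (smul c v) = c * h n j v"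
    and h_g: "\<And>n j v. h n j v \<bullet> (1::'k) = g n j v" and h_le: "\<And>n j v. norm (h n j v) \<le> norm v"
    by (simp_all add: lifts_def)
  define X where "X k = proj (\<lambda>n. x n k)" for k
  have xb: "(\<lambda>n. x n k) \<in> bseq" for k by (rule bseqI[of _ 1]) (rule x)
  have X: "X k \<in> reps" "unorm (X k) \<le> 1" for k
  proof -
    show "X k \<in> reps" unfolding X_def reps_def using xb by blast
    have "unorm (\<lambda>n. x n k) \<le> 1" by (rule unorm_le[OF xb]) (simp add: x)
    then show "unorm (X k) \<le> 1" unfolding X_def by (simp only: unorm_proj(2)[OF xb])
  qed
  define F where "F j = hlim (\<lambda>n. h n j)" for j
  note F_facts = h_add h_sc h_le
  have F_add: "F j (u + v) = F j u + F j v" if "u \<in> reps" "v \<in> reps" for j u v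
    unfolding F_def using that by (intro hlim_add reps_bseq) (simp_all add: F_facts)
  have F_scale: "F j (seqscale c v) = c * F j v" if "v \<in> reps" for j c v
    unfolding F_def using that by (intro hlim_scale reps_bseq) (simp_all add: F_facts)
  have F_le: "norm (F j v) \<le> unorm v" if "v \<in> reps" for j v
    unfolding F_def using that by (intro hlim_le reps_bseq) (simp_all add: F_facts)
  have F_X: "F j (X k) \<bullet> 1 = Lim U (\<lambda>n. g n j (x n k))" for j k
  proof -
    have "F j (X k) = hlim (\<lambda>n. h n j) (\<lambda>n. x n k)"
      unfolding F_def X_def by (rule hlim_proj[OF _ _ _ xb]) (simp_all add: F_facts)
    moreover have "((\<lambda>n. h n j (x n k)) \<longlongrightarrow> hlim (\<lambda>n. h n j) (\<lambda>n. x n k)) U"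
      by (rule tendsto_hlim[OF _ _ _ xb, of "\<lambda>n. h n j"]) (simp_all add: F_facts)
    ultimately have "((\<lambda>n. h n j (x n k) \<bullet> 1) \<longlongrightarrow> F j (X k) \<bullet> 1) U"
      by (simp add: tendsto_inner)
    then show ?thesis using Lim_eqI[OF ultra] by (fastforce simp: h_g)
  qed
  define Fd where "Fd j A = (if A \<in> vcarrier upower then F j (the_elem A) else 0)" for j A
  have Fd: "Fd j \<in> vcarrier (dual upower)" for j
    unfolding Fd_def by (rule dual_upowerI[OF F_add F_scale F_le])
  define P where "P v = Lim U (\<lambda>j. F j v)" for v
  have P: "((\<lambda>j. F j v) \<longlongrightarrow> P v) U" if "v \<in> reps" for v
    unfolding P_def by (rule tendsto_LimI[OF ultra, of _ "unorm v"]) (rule F_le[OF that])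
  have P_add: "P (u + v) = P u + P v" if "u \<in> reps" "v \<in> reps" for u v
    unfolding P_def[of "u + v"] using tendsto_add[OF P[OF that(1)] P[OF that(2)]]
    by (intro Lim_eqI[OF ultra]) (simp add: F_add that)
  have P_scale: "P (seqscale c v) = c * P v" if "v \<in> reps" for c v
    unfolding P_def[of "seqscale c v"] using tendsto_mult_left[OF P[OF that], of c]
    by (intro Lim_eqI[OF ultra]) (simp add: F_scale that)
  have P_le: "norm (P v) \<le> unorm v" if "v \<in> reps" for v
    unfolding P_def by (rule norm_Lim_le[OF ultra]) (rule F_le[OF that])
  define Pd where "Pd A = (if A \<in> vcarrier upower then P (the_elem A) else 0)" for A
  have Pd: "Pd \<in> vcarrier (dual upower)"
    unfolding Pd_def by (rule dual_upowerI[OF P_add P_scale P_le])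
  \<comment> \<open>The weak-star limit of the vectors \<open>X k\<close> in the bidual. The value 0
    outside the dual is the convention for functionals.\<close>
  define \<Phi> where "\<Phi> f = (if f \<in> vcarrier (dual upower) then Lim U (\<lambda>k. f {X k}) else 0)" for f
  have dual_le: "norm (f {v}) \<le> vnorm (dual upower) f"
    if f: "f \<in> vcarrier (dual upower)" and v: "v \<in> reps" "unorm v \<le> 1" for f v
  proof -
    obtain C where C: "\<And>u. u \<in> reps \<Longrightarrow> norm (f {u}) \<le> C * unorm u"
      using f by (auto simp: dual_def)
    have "norm (f {v}) \<le> Sup {norm (f u) |u. u \<in> vcarrier upower \<and> vnorm upower u \<le> 1}"
    proof (rule cSup_upper)
      show "bdd_above {norm (f u) |u. u \<in> vcarrier upower \<and> vnorm upower u \<le> 1}"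
      proof (rule bdd_aboveI[of _ "\<bar>C\<bar>"], clarsimp)
        fix u assume u: "u \<in> reps" "unorm u \<le> 1"
        have "C * unorm u \<le> \<bar>C\<bar> * unorm u"
          using unorm_ge0[OF reps_bseq[OF u(1)]] by (intro mult_right_mono) auto
        also have "\<dots> \<le> \<bar>C\<bar>" using u(2) by (simp add: mult_left_le)
        finally show "norm (f {u}) \<le> \<bar>C\<bar>" using C[OF u(1)] by simp
      qed
    qed (use v in auto)
    then show ?thesis by (simp add: dual_def)
  qed
  have \<Phi>_lim: "((\<lambda>k. f {X k}) \<longlongrightarrow> \<Phi> f) U" if "f \<in> vcarrier (dual upower)" for f
    using tendsto_LimI[OF ultra dual_le[OF that X]] that by (simp add: \<Phi>_def)
  have sub: "(\<lambda>u. f u + f' u) \<in> vcarrier (dual upower)"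
    if f: "f \<in> vcarrier (dual upower)" "f' \<in> vcarrier (dual upower)" for f f'
  proof -
    obtain C where C: "\<And>u. u \<in> reps \<Longrightarrow> norm (f {u}) \<le> C * unorm u"
      using f(1) by (auto simp: dual_def)
    obtain C' where C': "\<And>u. u \<in> reps \<Longrightarrow> norm (f' {u}) \<le> C' * unorm u"
      using f(2) by (auto simp: dual_def)
    have "norm (f {u} + f' {u}) \<le> (C + C') * unorm u" if "u \<in> reps" for u
      using norm_triangle_ineq[of "f {u}" "f' {u}"] C[OF that] C'[OF that]
      by (simp add: distrib_right)
    then have "\<exists>C. \<forall>u\<in>reps. norm (f {u} + f' {u}) \<le> C * unorm u" by blast
    then show ?thesis using f by (simp add: dual_def lin_map_on_def space_of_def algebra_simps)
  qed
  have sub': "(\<lambda>u. c * f u) \<in> vcarrier (dual upower)" if f: "f \<in> vcarrier (dual upower)" for f c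
  proof -
    obtain C where C: "\<And>u. u \<in> reps \<Longrightarrow> norm (f {u}) \<le> C * unorm u"
      using f by (auto simp: dual_def)
    have "norm (c * f {u}) \<le> (norm c * C) * unorm u" if "u \<in> reps" for u
      using mult_left_mono[OF C[OF that], of "norm c"] by (simp add: norm_mult mult.assoc)
    then have "\<exists>C. \<forall>u\<in>reps. norm (c * f {u}) \<le> C * unorm u" by blast
    then show ?thesis using f by (simp add: dual_def lin_map_on_def space_of_def algebra_simps)
  qed
  have "\<Phi> \<in> vcarrier (dual (dual upower))"
  proof -
    have "\<Phi> (\<lambda>u. f u + f' u) = \<Phi> f + \<Phi> f'"
      if "f \<in> vcarrier (dual upower)" "f' \<in> vcarrier (dual upower)" for f f'
      using tendsto_unique[OF nb \<Phi>_lim[OF sub[OF that]]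
          tendsto_add[OF \<Phi>_lim[OF that(1)] \<Phi>_lim[OF that(2)]]] .
    moreover have "\<Phi> (\<lambda>u. c * f u) = c * \<Phi> f" if "f \<in> vcarrier (dual upower)" for c f
      using tendsto_unique[OF nb \<Phi>_lim[OF sub'[OF that]] tendsto_mult_left[OF \<Phi>_lim[OF that]]] .
    moreover have "norm (\<Phi> f) \<le> 1 * vnorm (dual upower) f" if "f \<in> vcarrier (dual upower)" for f
      using tendsto_upperbound[OF tendsto_norm[OF \<Phi>_lim[OF that]] _ nb] dual_le[OF that X] by simp
    moreover have "\<Phi> f = 0" if "f \<notin> vcarrier (dual upower)" for f
      using that by (simp add: \<Phi>_def)
    moreover have "vadd (dual upower) f f' = (\<lambda>u. f u + f' u)"
      "vscale (dual upower) c f = (\<lambda>u. c * f u)" for f f' c by (simp_all add: dual_def)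
    ultimately show ?thesis
      by (subst dual_def) (auto simp: lin_map_on_def space_of_def intro!: exI[of _ 1])
  qed
  then obtain u where "u \<in> vcarrier upower" "\<And>f. f \<in> vcarrier (dual upower) \<Longrightarrow> \<Phi> f = f u"
    using refl unfolding reflexive_def by blast
  then obtain v where v: "v \<in> reps" and \<Phi>_v: "\<And>f. f \<in> vcarrier (dual upower) \<Longrightarrow> \<Phi> f = f {v}"
    by auto
  have 1: "F j v \<bullet> 1 = Lim U (\<lambda>k. F j (X k) \<bullet> 1)" for j
  proof -
    have "((\<lambda>k. Fd j {X k}) \<longlongrightarrow> Fd j {v}) U" using \<Phi>_lim[OF Fd] \<Phi>_v[OF Fd] by simp
    then have "((\<lambda>k. F j (X k)) \<longlongrightarrow> F j v) U" using v X by (simp add: Fd_def)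
    from tendsto_inner[OF this tendsto_const, of 1] show ?thesis using Lim_eqI[OF ultra] by metis
  qed
  have 2: "P v \<bullet> 1 = Lim U (\<lambda>k. P (X k) \<bullet> 1)"
  proof -
    have "((\<lambda>k. Pd {X k}) \<longlongrightarrow> Pd {v}) U" using \<Phi>_lim[OF Pd] \<Phi>_v[OF Pd] by simp
    then have "((\<lambda>k. P (X k)) \<longlongrightarrow> P v) U" using v X by (simp add: Pd_def)
    from tendsto_inner[OF this tendsto_const, of 1] show ?thesis using Lim_eqI[OF ultra] by metis
  qed
  have 3: "P w \<bullet> 1 = Lim U (\<lambda>j. F j w \<bullet> 1)" if "w \<in> reps" for w
    using tendsto_inner[OF P[OF that] tendsto_const, of 1] Lim_eqI[OF ultra] by metis
  have "Lim U (\<lambda>j. Lim U (\<lambda>k. F j (X k) \<bullet> 1)) = P v \<bullet> 1"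
    by (simp add: 3[OF v] 1)
  also have "\<dots> = Lim U (\<lambda>k. Lim U (\<lambda>j. F j (X k) \<bullet> 1))"
    by (simp add: 2 3[OF X(1)])
  finally show ?thesis by (simp add: F_X)
qed

end


section \<open>Finite consequences of superreflexivity\<close>

context banach_over
begin

text \<open>This packages all that the later arguments take from the ultrapower. They choose
  \<open>x\<close> and \<open>g\<close> with their finite counterexamples in the coordinates
  \<open>n\<close>.\<close>

lemma superreflexive_iterated_Lim:
  assumes "superreflexive (space_of smul)"
  shows "\<exists>U :: nat filter. ultrafilter U \<and> U \<le> sequentially \<and>
    (\<forall>x g. (\<forall>n k. norm (x n k :: 'a) \<le> 1) \<longrightarrow> (\<forall>n j. norm (g n j) \<le> 1) \<longrightarrow>
       Lim U (\<lambda>j. Lim U (\<lambda>k. Lim U (\<lambda>n. blinfun_apply (g n j) (x n k) :: real))) =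
       Lim U (\<lambda>k. Lim U (\<lambda>j. Lim U (\<lambda>n. g n j (x n k)))))"
proof -
  obtain U :: "nat filter" where U: "U \<le> sequentially" "ultrafilter U"
    using ex_ultrafilter_le[of sequentially] by auto
  interpret ultrapower smul U by unfold_locales (use U in auto)
  have "reflexive upower"
    using assms banach_space_upower finitely_representable_upower unfolding superreflexive_def by blast
  then show ?thesis using U by (intro exI[of _ U] conjI allI impI iterated_Lim_commute) auto
qed

text \<open>Counterexamples of every length, placed in the coordinates of the ultrapower, would have
  an infinite counterexample as their limit, and the gap \<open>\<theta>\<close> would separate two
  iterated limits that agree. The first form, functionals separating vectors, serves the space; the
  second, vectors separating functionals, serves its dual.\<close>

lemma superreflexive_no_triangle:
  assumes sr: "superreflexive (space_of smul)" and "0 < \<theta>"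
  shows "\<exists>m. \<forall>(x :: nat \<Rightarrow> 'a) (g :: nat \<Rightarrow> 'a \<Rightarrow>\<^sub>L real).
    (\<forall>i<m. norm (x i) \<le> 1) \<and> (\<forall>i<m. norm (g i) \<le> 1) \<longrightarrow>
    (\<exists>i k j. i \<le> k \<and> k < j \<and> j < m \<and> blinfun_apply (g k) (x j) < blinfun_apply (g k) (x i) + \<theta>)" (is "\<exists>m. ?A m")
  and "\<exists>m. \<forall>(x :: nat \<Rightarrow> 'a) (g :: nat \<Rightarrow> 'a \<Rightarrow>\<^sub>L real).
    (\<forall>i<m. norm (x i) \<le> 1) \<and> (\<forall>i<m. norm (g i) \<le> 1) \<longrightarrow>
    (\<exists>i k j. i \<le> k \<and> k < j \<and> j < m \<and> blinfun_apply (g j) (x k) < blinfun_apply (g i) (x k) + \<theta>)" (is "\<exists>m. ?B m")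
proof -
  obtain U where U: "ultrafilter U" "U \<le> sequentially"
    and comm: "\<forall>x g. (\<forall>n k. norm (x n k :: 'a) \<le> 1) \<longrightarrow> (\<forall>n j. norm (g n j) \<le> 1) \<longrightarrow>
       Lim U (\<lambda>j. Lim U (\<lambda>k. Lim U (\<lambda>n. blinfun_apply (g n j) (x n k) :: real))) =
       Lim U (\<lambda>k. Lim U (\<lambda>j. Lim U (\<lambda>n. g n j (x n k))))"
    using superreflexive_iterated_Lim[OF sr] by blast
  have nb: "U \<noteq> bot" using U by (simp add: ultrafilter_def)
  define T where "T m x g \<longleftrightarrow> (\<forall>i<m. norm (x i) \<le> 1) \<and> (\<forall>i<m. norm (g i) \<le> 1)"
    for m :: nat and x :: "nat \<Rightarrow> 'a" and g :: "nat \<Rightarrow> 'a \<Rightarrow>\<^sub>L real"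
  \<comment> \<open>\<open>ap\<close> stands for both pairings: the row index belongs to the
    functionals in the first form and to the vectors in the second.\<close>
  have key: "\<exists>m. \<forall>x g. T m x g \<longrightarrow>
      (\<exists>i k j. i \<le> k \<and> k < j \<and> j < m \<and> ap x g k j < ap x g k i + \<theta>)"
    if ap: "ap = (\<lambda>x g k j. blinfun_apply (g k) (x j)) \<or> ap = (\<lambda>x g k j. blinfun_apply (g j) (x k))"
    for ap :: "(nat \<Rightarrow> 'a) \<Rightarrow> (nat \<Rightarrow> 'a \<Rightarrow>\<^sub>L real) \<Rightarrow> nat \<Rightarrow> nat \<Rightarrow> real"
  proof (rule ccontr)
    assume no: "\<not> ?thesis"
    define good where "good m p \<longleftrightarrow> T m (fst p) (snd p) \<and>
      (\<forall>i k j. i \<le> k \<longrightarrow> k < j \<longrightarrow> j < m \<longrightarrow> ap (fst p) (snd p) k i + \<theta> \<le> ap (fst p) (snd p) k j)" for m p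
    have "\<exists>p. good m p" for m
    proof (rule ccontr)
      assume nx: "\<nexists>p. good m p"
      have "\<exists>i k j. i \<le> k \<and> k < j \<and> j < m \<and> ap x g k j < ap x g k i + \<theta>" if "T m x g" for x g
      proof -
        have "\<not> good m (x, g)" using nx by blast
        then show ?thesis using that unfolding good_def fst_conv snd_conv not_less[symmetric] by blast
      qed
      then show False using no by blast
    qed
    then have "good m (SOME p. good m p)" for m by (rule someI_ex)
    then obtain p where "\<And>m. good m (p m)" by (rule that)
    then obtain x g where T: "\<And>m. T m (x m) (g m)"
      and gap: "\<And>m i k j. i \<le> k \<Longrightarrow> k < j \<Longrightarrow> j < m \<Longrightarrow> ap (x m) (g m) k i + \<theta> \<le> ap (x m) (g m) k j"
      unfolding good_def by (intro that[of "\<lambda>m. fst (p m)" "\<lambda>m. snd (p m)"]) simp_all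
    \<comment> \<open>Padding by zeros beyond the length \<open>m\<close>. It is harmless, since for
      a fixed index all but finitely many \<open>m\<close> exceed it.\<close>
    define x' where "x' m i = (if i < m then x m i else 0)" for m i
    define g' where "g' m i = (if i < m then g m i else 0)" for m i
    have x': "norm (x' m i) \<le> 1" and g': "norm (g' m i) \<le> 1" for m i
      using T[of m] by (auto simp: T_def x'_def g'_def)
    define M where "M k j = Lim U (\<lambda>n. ap (x' n) (g' n) k j)" for k j
    have apb: "norm (ap (x' n) (g' n) k j) \<le> 1" for n k j
    proof -
      have "norm (blinfun_apply (g' n k) (x' n j)) \<le> 1" for k j
        using norm_blinfun[of "g' n k" "x' n j"] mult_mono[OF g'[of n k] x'[of n j]] by simp
      then show ?thesis using ap by auto
    qed
    have M: "((\<lambda>n. ap (x' n) (g' n) k j) \<longlongrightarrow> M k j) U" for k j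
      unfolding M_def by (rule tendsto_LimI[OF U(1) apb])
    have "M k i + \<theta> \<le> M k j" if "i \<le> k" "k < j" for i k j
    proof (rule tendsto_le[OF nb M tendsto_add[OF M tendsto_const]])
      have "eventually (\<lambda>n. j < n) U" using U(2) filter_leD eventually_gt_at_top by blast
      then show "eventually (\<lambda>n. ap (x' n) (g' n) k i + \<theta> \<le> ap (x' n) (g' n) k j) U"
      proof eventually_elim
        case (elim n)
        then have "ap (x' n) (g' n) k i = ap (x n) (g n) k i" "ap (x' n) (g' n) k j = ap (x n) (g n) k j"
          using that ap by (auto simp: x'_def g'_def)
        then show ?case using gap[OF that elim] by simp
      qed
    qed
    moreover have "\<bar>M k j\<bar> \<le> 1" for k j
      using norm_Lim_le[OF U(1) apb] by (simp add: M_def)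
    ultimately have "Lim U (\<lambda>i. Lim U (\<lambda>k. M k i)) + \<theta> \<le> Lim U (\<lambda>k. Lim U (\<lambda>j. M k j))"
      by (intro iterated_Lim_gap[OF U])
    moreover have "Lim U (\<lambda>i. Lim U (\<lambda>k. M k i)) = Lim U (\<lambda>k. Lim U (\<lambda>j. M k j))"
      using ap
    proof
      assume a: "ap = (\<lambda>x g k j. blinfun_apply (g k) (x j))"
      show ?thesis unfolding M_def a by (rule comm[rule_format, OF x' g', symmetric])
    next
      assume a: "ap = (\<lambda>x g k j. blinfun_apply (g j) (x k))"
      show ?thesis unfolding M_def a by (rule comm[rule_format, OF x' g'])
    qed
    ultimately show False using \<open>0 < \<theta>\<close> by simp
  qed
  show "\<exists>m. ?A m"
    using key[of "\<lambda>x g k j. blinfun_apply (g k) (x j)"] unfolding T_def by blast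
  show "\<exists>m. ?B m"
    using key[of "\<lambda>x g k j. blinfun_apply (g j) (x k)"] unfolding T_def by blast
qed

end

section \<open>Separated convex hulls in the space and in its dual\<close>

text \<open>The weights \<open>\<mu>\<close> encode a point of each of the convex hulls of \<open>s 0, \<dots>, s k\<close> and of
  \<open>s (k + 1), \<dots>, s (m - 1)\<close>.\<close>

definition hulls_close :: "'z::real_normed_vector itself \<Rightarrow> real \<Rightarrow> nat \<Rightarrow> bool" where
  "hulls_close _ \<theta> m \<longleftrightarrow> (\<forall>s :: nat \<Rightarrow> 'z. (\<forall>i<m. norm (s i) \<le> 1) \<longrightarrow>
     (\<exists>k \<mu>. Suc k < m \<and> (\<forall>i. 0 \<le> \<mu> i) \<and> (\<Sum>i\<le>k. \<mu> i) = 1 \<and> (\<Sum>i\<in>{k<..<m}. \<mu> i) = (1::real) \<and>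
        norm ((\<Sum>i\<in>{k<..<m}. \<mu> i *\<^sub>R s i) - (\<Sum>i\<le>k. \<mu> i *\<^sub>R s i)) < \<theta>))"

lemma not_hulls_closeD:
  assumes "\<not> hulls_close TYPE('z::real_normed_vector) \<theta> m"
  shows "\<exists>s :: nat \<Rightarrow> 'z. (\<forall>i<m. norm (s i) \<le> 1) \<and>
    (\<forall>k \<mu>. Suc k < m \<longrightarrow> (\<forall>i. 0 \<le> \<mu> i) \<longrightarrow> (\<Sum>i\<le>k. \<mu> i) = 1 \<longrightarrow> (\<Sum>i\<in>{k<..<m}. \<mu> i) = 1 \<longrightarrow>
      \<theta> \<le> norm ((\<Sum>i\<in>{k<..<m}. \<mu> i *\<^sub>R s i) - (\<Sum>i\<le>k. \<mu> i *\<^sub>R s i)))"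
proof (rule ccontr)
  assume no: "\<not> ?thesis"
  have "hulls_close TYPE('z) \<theta> m"
    unfolding hulls_close_def
  proof (intro allI impI)
    fix s :: "nat \<Rightarrow> 'z" assume s: "\<forall>i<m. norm (s i) \<le> 1"
    show "\<exists>k \<mu>. Suc k < m \<and> (\<forall>i. 0 \<le> \<mu> i) \<and> (\<Sum>i\<le>k. \<mu> i) = 1 \<and> (\<Sum>i\<in>{k<..<m}. \<mu> i) = (1::real) \<and>
        norm ((\<Sum>i\<in>{k<..<m}. \<mu> i *\<^sub>R s i) - (\<Sum>i\<le>k. \<mu> i *\<^sub>R s i)) < \<theta>"
      using no s unfolding not_le[symmetric] by blast
  qed
  then show False using assms by blast
qed

context banach_over
begin

text \<open>If the two hulls stay \<open>\<theta>\<close> apart at every cut \<open>k\<close>, a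
  functional separating their differences from 0 at each cut produces exactly the forbidden
  triangle.\<close>

lemma superreflexive_hulls_close:
  assumes sr: "superreflexive (space_of smul)" and "0 < \<theta>"
  shows "\<exists>m. hulls_close TYPE('a) \<theta> m"
proof (rule ccontr)
  assume no: "\<nexists>m. hulls_close TYPE('a) \<theta> m"
  obtain m where m: "\<forall>(x :: nat \<Rightarrow> 'a) (g :: nat \<Rightarrow> 'a \<Rightarrow>\<^sub>L real).
    (\<forall>i<m. norm (x i) \<le> 1) \<and> (\<forall>i<m. norm (g i) \<le> 1) \<longrightarrow>
    (\<exists>i k j. i \<le> k \<and> k < j \<and> j < m \<and> blinfun_apply (g k) (x j) < blinfun_apply (g k) (x i) + \<theta>)"
    using superreflexive_no_triangle(1)[OF assms] by blast
  obtain s :: "nat \<Rightarrow> 'a" where s: "\<forall>i<m. norm (s i) \<le> 1"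
    and far': "\<forall>k \<mu>. Suc k < m \<longrightarrow> (\<forall>i. 0 \<le> \<mu> i) \<longrightarrow> (\<Sum>i\<le>k. \<mu> i) = 1 \<longrightarrow> (\<Sum>i\<in>{k<..<m}. \<mu> i) = 1 \<longrightarrow>
      \<theta> \<le> norm ((\<Sum>i\<in>{k<..<m}. \<mu> i *\<^sub>R s i) - (\<Sum>i\<le>k. \<mu> i *\<^sub>R s i))"
    using no not_hulls_closeD[where 'z = "'a", of \<theta> m] by blast
  note far = far'[rule_format]
  have "\<exists>g :: 'a \<Rightarrow>\<^sub>L real. norm g \<le> 1 \<and> (\<forall>i j. i \<le> k \<longrightarrow> k < j \<longrightarrow> j < m \<longrightarrow> blinfun_apply g (s i) + \<theta> \<le> blinfun_apply g (s j))" for k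
  proof (cases "Suc k < m")
    case False
    then show ?thesis by (intro exI[of _ 0]) auto
  next
    case True
    define D where "D \<mu> = (\<Sum>i\<in>{k<..<m}. \<mu> i *\<^sub>R s i) - (\<Sum>i\<le>k. \<mu> i *\<^sub>R s i)" for \<mu>
    define W where "W = {\<mu>. (\<forall>i. 0 \<le> \<mu> i) \<and> (\<Sum>i\<le>k. \<mu> i) = 1 \<and> (\<Sum>i\<in>{k<..<m}. \<mu> i) = (1::real)}"
    have "convex (D ` W)"
    proof (rule convexI)
      fix a b and u v :: real
      assume "a \<in> D ` W" "b \<in> D ` W" and uv: "0 \<le> u" "0 \<le> v" "u + v = 1"
      then obtain \<mu> \<nu> where *: "a = D \<mu>" "b = D \<nu>" "\<mu> \<in> W" "\<nu> \<in> W" by blast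
      have "(\<lambda>i. u * \<mu> i + v * \<nu> i) \<in> W"
        using * uv by (auto simp: W_def sum.distrib simp flip: sum_distrib_left)
      moreover have "u *\<^sub>R a + v *\<^sub>R b = D (\<lambda>i. u * \<mu> i + v * \<nu> i)"
        by (simp add: * D_def scaleR_add_left sum.distrib scaleR_sum_right algebra_simps)
      ultimately show "u *\<^sub>R a + v *\<^sub>R b \<in> D ` W" by blast
    qed
    moreover have "\<theta> \<le> norm c" if "c \<in> D ` W" for c
      using that far[OF True] by (auto simp: W_def D_def)
    ultimately obtain g :: "'a \<Rightarrow>\<^sub>L real" where g: "norm g \<le> 1" "\<And>c. c \<in> D ` W \<Longrightarrow> \<theta> \<le> blinfun_apply g c"
      using separating_functional by blast
    have "blinfun_apply g (s i) + \<theta> \<le> blinfun_apply g (s j)" if "i \<le> k" "k < j" "j < m" for i j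
    proof -
      \<comment> \<open>Point masses at \<open>i\<close> and \<open>j\<close>: the difference of the
        two hull points is then \<open>s j - s i\<close>.\<close>
      define \<mu> where "\<mu> l = (if l = i \<or> l = j then 1 else 0 :: real)" for l
      have e1: "(\<Sum>l\<le>k. \<mu> l *\<^sub>R z l) = z i" for z :: "nat \<Rightarrow> 'b::real_vector"
      proof -
        have "(\<Sum>l\<le>k. \<mu> l *\<^sub>R z l) = (\<Sum>l\<le>k. if l = i then z l else 0)"
          by (rule sum.cong) (use that in \<open>auto simp: \<mu>_def\<close>)
        then show ?thesis using that by simp
      qed
      have e2: "(\<Sum>l\<in>{k<..<m}. \<mu> l *\<^sub>R z l) = z j" for z :: "nat \<Rightarrow> 'b::real_vector"
      proof -
        have "(\<Sum>l\<in>{k<..<m}. \<mu> l *\<^sub>R z l) = (\<Sum>l\<in>{k<..<m}. if l = j then z l else 0)"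
          by (rule sum.cong) (use that in \<open>auto simp: \<mu>_def\<close>)
        then show ?thesis using that by simp
      qed
      have "\<mu> \<in> W" using e1[of "\<lambda>_. 1::real"] e2[of "\<lambda>_. 1::real"] by (auto simp: W_def \<mu>_def)
      then have "\<theta> \<le> g (D \<mu>)" using g(2) by blast
      then show ?thesis by (simp add: D_def e1 e2 blinfun.diff_right)
    qed
    with g(1) show ?thesis by blast
  qed
  then have "\<exists>g :: nat \<Rightarrow> 'a \<Rightarrow>\<^sub>L real. \<forall>k. norm (g k) \<le> 1 \<and>
      (\<forall>i j. i \<le> k \<longrightarrow> k < j \<longrightarrow> j < m \<longrightarrow> blinfun_apply (g k) (s i) + \<theta> \<le> blinfun_apply (g k) (s j))"
    by (intro choice allI)
  then obtain g :: "nat \<Rightarrow> 'a \<Rightarrow>\<^sub>L real" where g: "\<forall>k. norm (g k) \<le> 1 \<and>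
      (\<forall>i j. i \<le> k \<longrightarrow> k < j \<longrightarrow> j < m \<longrightarrow> blinfun_apply (g k) (s i) + \<theta> \<le> blinfun_apply (g k) (s j))" ..
  then show False using m[THEN spec, THEN spec, of s g] s unfolding not_le[symmetric] by blast
qed

text \<open>Separation in the dual would yield elements of the bidual. The minimax principle yields
  vectors of the space instead, for any gap strictly below \<open>\<theta>\<close>; half of it is
  taken.\<close>

lemma superreflexive_hulls_close_dual:
  assumes sr: "superreflexive (space_of smul)" and "0 < \<theta>"
  shows "\<exists>m. hulls_close TYPE('a \<Rightarrow>\<^sub>L real) \<theta> m"
proof (rule ccontr)
  assume no: "\<nexists>m. hulls_close TYPE('a \<Rightarrow>\<^sub>L real) \<theta> m"
  have \<theta>2: "0 < \<theta> / 2" using \<open>0 < \<theta>\<close> by simp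
  obtain m where m: "\<forall>(x :: nat \<Rightarrow> 'a) (g :: nat \<Rightarrow> 'a \<Rightarrow>\<^sub>L real).
    (\<forall>i<m. norm (x i) \<le> 1) \<and> (\<forall>i<m. norm (g i) \<le> 1) \<longrightarrow>
    (\<exists>i k j. i \<le> k \<and> k < j \<and> j < m \<and> blinfun_apply (g j) (x k) < blinfun_apply (g i) (x k) + \<theta> / 2)"
    using superreflexive_no_triangle(2)[OF sr \<theta>2] by blast
  obtain s :: "nat \<Rightarrow> 'a \<Rightarrow>\<^sub>L real" where s: "\<forall>i<m. norm (s i) \<le> 1"
    and far': "\<forall>k \<mu>. Suc k < m \<longrightarrow> (\<forall>i. 0 \<le> \<mu> i) \<longrightarrow> (\<Sum>i\<le>k. \<mu> i) = 1 \<longrightarrow> (\<Sum>i\<in>{k<..<m}. \<mu> i) = 1 \<longrightarrow>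
      \<theta> \<le> norm ((\<Sum>i\<in>{k<..<m}. \<mu> i *\<^sub>R s i) - (\<Sum>i\<le>k. \<mu> i *\<^sub>R s i))"
    using no not_hulls_closeD[where 'z = "'a \<Rightarrow>\<^sub>L real", of \<theta> m] by blast
  note far = far'[rule_format]
  have "\<exists>x :: 'a. norm x \<le> 1 \<and> (\<forall>i j. i \<le> k \<longrightarrow> k < j \<longrightarrow> j < m \<longrightarrow> blinfun_apply (s i) x + \<theta> / 2 \<le> blinfun_apply (s j) x)" for k
  proof (cases "Suc k < m")
    case False
    then show ?thesis by (intro exI[of _ 0]) auto
  next
    case True
    define I where "I = {..k} \<times> {k<..<m}"
    define G where "G p = s (snd p) - s (fst p)" for p
    have I: "finite I" "I \<noteq> {}"
    proof -
      have "(k, Suc k) \<in> I" using True by (simp add: I_def)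
      then show "I \<noteq> {}" by blast
    qed (simp add: I_def)
    have far2: "\<theta> \<le> norm (\<Sum>p\<in>I. \<mu> p *\<^sub>R G p)"
      if \<mu>: "\<And>p. p \<in> I \<Longrightarrow> 0 \<le> \<mu> p" "(\<Sum>p\<in>I. \<mu> p) = 1" for \<mu>
    proof -
      \<comment> \<open>The marginals of \<open>\<mu>\<close>: a convex combination of differences
        \<open>s j - s i\<close> over pairs is the difference of a point of each hull.\<close>
      define \<nu> where "\<nu> l = (if l \<le> k then \<Sum>j\<in>{k<..<m}. \<mu> (l, j) else if l < m then \<Sum>i\<le>k. \<mu> (i, l) else 0)" for l
      have e1: "(\<Sum>i\<le>k. \<nu> i *\<^sub>R z i) = (\<Sum>p\<in>I. \<mu> p *\<^sub>R z (fst p))" for z :: "nat \<Rightarrow> 'b::real_vector"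
        unfolding I_def by (simp add: \<nu>_def scaleR_sum_left sum.cartesian_product case_prod_beta)
      have e2: "(\<Sum>j\<in>{k<..<m}. \<nu> j *\<^sub>R z j) = (\<Sum>p\<in>I. \<mu> p *\<^sub>R z (snd p))" for z :: "nat \<Rightarrow> 'b::real_vector"
      proof -
        have "(\<Sum>j\<in>{k<..<m}. \<nu> j *\<^sub>R z j) = (\<Sum>j\<in>{k<..<m}. \<Sum>i\<le>k. \<mu> (i, j) *\<^sub>R z j)"
          by (rule sum.cong) (auto simp: \<nu>_def scaleR_sum_left)
        also have "\<dots> = (\<Sum>i\<le>k. \<Sum>j\<in>{k<..<m}. \<mu> (i, j) *\<^sub>R z j)" by (rule sum.swap)
        finally show ?thesis unfolding I_def by (simp add: sum.cartesian_product case_prod_beta)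
      qed
      have "\<theta> \<le> norm ((\<Sum>i\<in>{k<..<m}. \<nu> i *\<^sub>R s i) - (\<Sum>i\<le>k. \<nu> i *\<^sub>R s i))"
      proof (rule far[OF True])
        show "0 \<le> \<nu> i" for i using \<mu>(1) by (auto simp: \<nu>_def I_def intro!: sum_nonneg)
      qed (use \<mu>(2) e1[of "\<lambda>_. 1::real"] e2[of "\<lambda>_. 1::real"] in simp_all)
      then show ?thesis by (simp add: e1 e2 G_def scaleR_diff_right sum_subtractf)
    qed
    have "\<theta> / 2 < \<theta>" using \<open>0 < \<theta>\<close> by simp
    from common_large_vector[OF I \<theta>2 this far2] obtain x
      where x: "norm x \<le> 1" "\<And>p. p \<in> I \<Longrightarrow> \<theta> / 2 \<le> blinfun_apply (G p) x" by blast
    have "blinfun_apply (s i) x + \<theta> / 2 \<le> blinfun_apply (s j) x" if "i \<le> k" "k < j" "j < m" for i j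
      using x(2)[of "(i, j)"] that by (simp add: I_def G_def blinfun.diff_left)
    then show ?thesis using x(1) by blast
  qed
  then have "\<exists>x :: nat \<Rightarrow> 'a. \<forall>k. norm (x k) \<le> 1 \<and>
      (\<forall>i j. i \<le> k \<longrightarrow> k < j \<longrightarrow> j < m \<longrightarrow> blinfun_apply (s i) (x k) + \<theta> / 2 \<le> blinfun_apply (s j) (x k))"
    by (intro choice allI)
  then obtain x :: "nat \<Rightarrow> 'a" where x: "\<forall>k. norm (x k) \<le> 1 \<and>
      (\<forall>i j. i \<le> k \<longrightarrow> k < j \<longrightarrow> j < m \<longrightarrow> blinfun_apply (s i) (x k) + \<theta> / 2 \<le> blinfun_apply (s j) (x k))" ..
  then show False using m[THEN spec, THEN spec, of x s] s unfolding not_le[symmetric] by blast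
qed

end

section \<open>Choices of signs\<close>

text \<open>With \<open>\<beta> < m\<close> this is the condition of B-convexity, which expresses
  non-trivial type.\<close>

definition sign_bound :: "'z::real_normed_vector itself \<Rightarrow> nat \<Rightarrow> real \<Rightarrow> bool" where
  "sign_bound _ m \<beta> \<longleftrightarrow> (\<forall>u :: nat \<Rightarrow> 'z. (\<forall>i<m. norm (u i) \<le> 1) \<longrightarrow>
     (\<exists>e. (\<forall>i. e i = 1 \<or> e i = (-1::real)) \<and> norm (\<Sum>i<m. e i *\<^sub>R u i) \<le> \<beta>))"

lemma sign_bound_scaled:
  fixes u :: "nat \<Rightarrow> 'z::real_normed_vector"
  assumes sb: "sign_bound TYPE('z) m \<beta>" and C: "0 \<le> C" "\<And>i. i < m \<Longrightarrow> norm (u i) \<le> C"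
  shows "\<exists>e. (\<forall>i. e i = 1 \<or> e i = (-1::real)) \<and> norm (\<Sum>i<m. e i *\<^sub>R u i) \<le> C * \<beta>"
proof (cases "C = 0")
  case True
  then show ?thesis using C by (intro exI[of _ "\<lambda>_. 1"]) simp
next
  case False
  then have "0 < C" using C by simp
  have "\<forall>i<m. norm ((1/C) *\<^sub>R u i) \<le> 1" using C \<open>0 < C\<close> by simp
  then obtain e where e: "\<forall>i. e i = 1 \<or> e i = (-1::real)" "norm (\<Sum>i<m. e i *\<^sub>R (1/C) *\<^sub>R u i) \<le> \<beta>"
    using sb[unfolded sign_bound_def, THEN spec, of "\<lambda>i. (1/C) *\<^sub>R u i"] by (elim impE exE conjE) auto
  have "(\<Sum>i<m. e i *\<^sub>R (1/C) *\<^sub>R u i) = (1/C) *\<^sub>R (\<Sum>i<m. e i *\<^sub>R u i)"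
    unfolding scaleR_sum_right by (rule sum.cong[OF refl]) (rule scaleR_left_commute)
  then have "(1/C) * norm (\<Sum>i<m. e i *\<^sub>R u i) \<le> \<beta>" using e(2) \<open>0 < C\<close> by simp
  then have "norm (\<Sum>i<m. e i *\<^sub>R u i) \<le> C * \<beta>" using \<open>0 < C\<close> by (simp add: field_simps)
  with e(1) show ?thesis by blast
qed

text \<open>Signs are chosen first inside each of \<open>n\<close> groups of \<open>m\<close>
  vectors and then for the \<open>n\<close> group sums, whose norms are at most
  \<open>\<beta>\<close>. Taking powers thus makes the bound as small as desired relative to the
  number of vectors.\<close>

lemma sign_bound_mult:
  assumes "sign_bound TYPE('z::real_normed_vector) m \<beta>" "sign_bound TYPE('z) n \<gamma>" "0 \<le> \<beta>"
  shows "sign_bound TYPE('z) (n * m) (\<beta> * \<gamma>)"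
  unfolding sign_bound_def
proof (intro allI impI)
  fix u :: "nat \<Rightarrow> 'z" assume u: "\<forall>i<n * m. norm (u i) \<le> 1"
  have idx: "j * m + i < n * m" if "i < m" "j < n" for i j
  proof -
    have "j * m + i < Suc j * m" using that by simp
    also have "\<dots> \<le> n * m" using that by (intro mult_le_mono1) simp
    finally show ?thesis .
  qed
  have "\<forall>j. \<exists>e. j < n \<longrightarrow> (\<forall>i. e i = 1 \<or> e i = (-1::real)) \<and> norm (\<Sum>i<m. e i *\<^sub>R u (j * m + i)) \<le> \<beta>"
    using assms(1)[unfolded sign_bound_def, THEN spec, of "\<lambda>i. u (_ * m + i)"] u idx by blast
  from choice[OF this] obtain e where e: "\<And>j i. j < n \<Longrightarrow> e j i = 1 \<or> e j i = (-1::real)"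
    "\<And>j. j < n \<Longrightarrow> norm (\<Sum>i<m. e j i *\<^sub>R u (j * m + i)) \<le> \<beta>"
    by blast
  obtain f where f: "\<forall>i. f i = 1 \<or> f i = (-1::real)"
    "norm (\<Sum>j<n. f j *\<^sub>R (\<Sum>i<m. e j i *\<^sub>R u (j * m + i))) \<le> \<beta> * \<gamma>"
    using sign_bound_scaled[OF assms(2,3), of "\<lambda>j. \<Sum>i<m. e j i *\<^sub>R u (j * m + i)"] e(2) by blast
  define g where "g l = (if l < n * m then f (l div m) * e (l div m) (l mod m) else 1)" for l
  have "(\<Sum>l<n * m. g l *\<^sub>R u l) = (\<Sum>j<n. \<Sum>l\<in>{j * m..<j * m + m}. g l *\<^sub>R u l)"
    by (rule sum.nat_group[symmetric])
  also have "\<dots> = (\<Sum>j<n. f j *\<^sub>R (\<Sum>i<m. e j i *\<^sub>R u (j * m + i)))"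
  proof (rule sum.cong[OF refl])
    fix j assume j: "j \<in> {..<n}"
    have "(\<Sum>l\<in>{j * m..<j * m + m}. g l *\<^sub>R u l) = (\<Sum>i<m. g (j * m + i) *\<^sub>R u (j * m + i))"
      by (rule sum.reindex_bij_witness[of _ "\<lambda>i. j * m + i" "\<lambda>l. l - j * m"]) auto
    also have "\<dots> = (\<Sum>i<m. f j *\<^sub>R e j i *\<^sub>R u (j * m + i))"
      using j idx by (intro sum.cong) (auto simp: g_def)
    finally show "(\<Sum>l\<in>{j * m..<j * m + m}. g l *\<^sub>R u l) = f j *\<^sub>R (\<Sum>i<m. e j i *\<^sub>R u (j * m + i))"
      by (simp add: scaleR_sum_right)
  qed
  finally have "norm (\<Sum>l<n * m. g l *\<^sub>R u l) \<le> \<beta> * \<gamma>" using f(2) by simp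
  moreover have "g l = 1 \<or> g l = -1" for l
  proof (cases "l < n * m")
    case True
    then have "l div m < n" by (rule less_mult_imp_div_less)
    show ?thesis
      using e(1)[OF \<open>l div m < n\<close>, of "l mod m"] f(1)[THEN spec, of "l div m"] True
      unfolding g_def by (elim disjE) simp_all
  qed (simp add: g_def)
  ultimately show "\<exists>e. (\<forall>i. e i = 1 \<or> e i = -1) \<and> norm (\<Sum>l<n * m. e l *\<^sub>R u l) \<le> \<beta> * \<gamma>" by blast
qed

lemma sign_bound_power:
  assumes "sign_bound TYPE('z::real_normed_vector) m \<beta>" "0 \<le> \<beta>"
  shows "sign_bound TYPE('z) (m ^ k) (\<beta> ^ k)"
proof (induction k)
  case 0
  show ?case unfolding sign_bound_def by (auto intro: exI[of _ "\<lambda>_. 1"])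
next
  case (Suc k)
  show ?case using sign_bound_mult[OF assms(1) Suc assms(2)] by (simp add: mult.commute)
qed

text \<open>Suppose that every choice of signs gives more than \<open>m - 1/2\<close>. Take a
  norming functional for the sum with signs -1 up to \<open>k\<close> and 1 afterwards. As no term
  exceeds 1, each of the \<open>m\<close> terms is at least 1/2, so the functional jumps by at least
  1 after \<open>k\<close>; for all \<open>k\<close> together this is a forbidden triangle.\<close>

lemma (in banach_over) superreflexive_sign_bound:
  assumes "superreflexive (space_of smul)"
  shows "\<exists>m. sign_bound TYPE('a) m (m - 1/2)"
proof -
  obtain m where m: "\<forall>(x :: nat \<Rightarrow> 'a) (g :: nat \<Rightarrow> 'a \<Rightarrow>\<^sub>L real).
    (\<forall>i<m. norm (x i) \<le> 1) \<and> (\<forall>i<m. norm (g i) \<le> 1) \<longrightarrow>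
    (\<exists>i k j. i \<le> k \<and> k < j \<and> j < m \<and> blinfun_apply (g k) (x j) < blinfun_apply (g k) (x i) + 1)"
    using superreflexive_no_triangle(1)[OF assms, of 1] by auto
  have "sign_bound TYPE('a) m (m - 1/2)"
    unfolding sign_bound_def
  proof (intro allI impI, rule ccontr)
    fix u :: "nat \<Rightarrow> 'a" assume u: "\<forall>i<m. norm (u i) \<le> 1"
    assume no: "\<not> (\<exists>e. (\<forall>i. e i = 1 \<or> e i = (-1::real)) \<and> norm (\<Sum>i<m. e i *\<^sub>R u i) \<le> m - 1/2)"
    have big: "m - 1/2 < norm (\<Sum>i<m. e i *\<^sub>R u i)" if "\<forall>i. e i = 1 \<or> e i = (-1::real)" for e
      using no that not_less by blast
    define e :: "nat \<Rightarrow> nat \<Rightarrow> real" where "e k i = (if i \<le> k then -1 else 1)" for k i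
    have "\<exists>g :: 'a \<Rightarrow>\<^sub>L real. norm g \<le> 1 \<and> blinfun_apply g (\<Sum>i<m. e k i *\<^sub>R u i) = norm (\<Sum>i<m. e k i *\<^sub>R u i)" for k
      using norming_functional[of "\<Sum>i<m. e k i *\<^sub>R u i"] by metis
    then have "\<forall>k. \<exists>g :: 'a \<Rightarrow>\<^sub>L real. norm g \<le> 1 \<and>
        blinfun_apply g (\<Sum>i<m. e k i *\<^sub>R u i) = norm (\<Sum>i<m. e k i *\<^sub>R u i)" by blast
    from choice[OF this] obtain g :: "nat \<Rightarrow> 'a \<Rightarrow>\<^sub>L real" where g: "\<And>k. norm (g k) \<le> 1"
      "\<And>k. blinfun_apply (g k) (\<Sum>i<m. e k i *\<^sub>R u i) = norm (\<Sum>i<m. e k i *\<^sub>R u i)"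
      by blast
    have half: "1/2 \<le> e k i * blinfun_apply (g k) (u i)" if i: "i < m" for k i
    proof -
      have le1: "e k l * blinfun_apply (g k) (u l) \<le> 1" if "l < m" for l
      proof -
        have "\<bar>blinfun_apply (g k) (u l)\<bar> \<le> norm (g k) * norm (u l)"
          using norm_blinfun[of "g k" "u l"] by simp
        also have "\<dots> \<le> 1 * 1" using g(1) u \<open>l < m\<close> by (intro mult_mono) auto
        finally show ?thesis by (auto simp: e_def abs_le_iff)
      qed
      have "m - 1/2 < norm (\<Sum>i<m. e k i *\<^sub>R u i)" using big by (simp add: e_def)
      also have "\<dots> = (\<Sum>l<m. e k l * blinfun_apply (g k) (u l))"
        by (simp flip: g(2)) (simp add: blinfun.sum_right blinfun.scaleR_right)
      also have "\<dots> = e k i * blinfun_apply (g k) (u i) + (\<Sum>l\<in>{..<m} - {i}. e k l * blinfun_apply (g k) (u l))"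
        using i by (intro sum.remove) auto
      also have "(\<Sum>l\<in>{..<m} - {i}. e k l * blinfun_apply (g k) (u l)) \<le> (\<Sum>l\<in>{..<m} - {i}. 1)"
        using le1 by (intro sum_mono) auto
      also have "\<dots> = m - 1" using i by simp
      finally show ?thesis using i by (simp add: of_nat_diff)
    qed
    obtain i k j where *: "i \<le> k" "k < j" "j < m"
      "blinfun_apply (g k) (u j) < blinfun_apply (g k) (u i) + 1"
      using m[THEN spec, THEN spec, of u g] u g(1) by blast
    then show False using half[of i k] half[of j k] by (simp add: e_def)
  qed
  then show ?thesis by blast
qed


section \<open>Non-increasing rearrangements\<close>

lemma rearrangement_le:
  assumes "0 \<le> t" "finite {k. t < norm (f k)}" "card {k. t < norm (f k)} \<le> n"
  shows "rearrangement f n \<le> t"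
  unfolding rearrangement_def by (rule cInf_lower) (use assms in \<open>auto intro: bdd_belowI[of _ 0]\<close>)

context
  fixes f :: "nat \<Rightarrow> 'k::real_normed_vector"
  assumes fin: "\<And>t. 0 < t \<Longrightarrow> finite {k. t \<le> norm (f k)}"
begin

lemma finite_superlevel: "0 < t \<Longrightarrow> finite {k. t < norm (f k)}"
  by (rule finite_subset[OF _ fin]) auto

lemma rearrangement_set_nonempty:
  "\<exists>t. 0 \<le> t \<and> finite {k. t < norm (f k)} \<and> card {k. t < norm (f k)} \<le> n"
proof -
  define B where "B = Max (insert 1 ((\<lambda>k. norm (f k)) ` {k. 1 \<le> norm (f k)}))"
  have 1: "finite (insert 1 ((\<lambda>k. norm (f k)) ` {k. 1 \<le> norm (f k)}))" using fin[of 1] by simp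
  have "1 \<le> B" unfolding B_def by (rule Max_ge[OF 1]) simp
  have "norm (f k) \<le> B" for k
  proof (cases "1 \<le> norm (f k)")
    case True then show ?thesis unfolding B_def by (intro Max_ge[OF 1]) auto
  qed (use \<open>1 \<le> B\<close> in simp)
  then have "{k. B < norm (f k)} = {}" by (auto simp: not_less)
  then show ?thesis using \<open>1 \<le> B\<close> by (intro exI[of _ B]) (simp only: card.empty, simp)
qed

lemma rearrangement_ge0: "0 \<le> rearrangement f n"
  unfolding rearrangement_def
  by (rule cInf_greatest) (use rearrangement_set_nonempty[of n] in auto)

lemma rearrangement_mono_lt:
  assumes "rearrangement f n < t"
  shows "finite {k. t < norm (f k)} \<and> card {k. t < norm (f k)} \<le> n"
proof -
  have "\<exists>s\<in>{t. 0 \<le> t \<and> finite {k. t < norm (f k)} \<and> card {k. t < norm (f k)} \<le> n}. s < t"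
    using assms rearrangement_set_nonempty[of n] unfolding rearrangement_def
    by (subst (asm) cInf_less_iff) (auto intro: bdd_belowI[of _ 0])
  then obtain s where s: "s < t" "finite {k. s < norm (f k)}" "card {k. s < norm (f k)} \<le> n" by auto
  have "{k. t < norm (f k)} \<subseteq> {k. s < norm (f k)}" using s(1) by auto
  then show ?thesis using s finite_subset card_mono order_trans by metis
qed

text \<open>The infimum in the definition is attained: a finite set of indices with sizes above it
  also lies above some larger threshold, which at most \<open>n\<close> indices exceed.\<close>

lemma above_rearrangement:
  "finite {k. rearrangement f n < norm (f k)}" "card {k. rearrangement f n < norm (f k)} \<le> n"
proof -
  have *: "card A \<le> n" if A: "finite A" "A \<subseteq> {k. rearrangement f n < norm (f k)}" for A
  proof (cases "A = {}")
    case False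
    define v where "v = Min ((\<lambda>k. norm (f k)) ` A)"
    have "v \<in> (\<lambda>k. norm (f k)) ` A" unfolding v_def using A(1) False by (intro Min_in) auto
    then have "rearrangement f n < v" using A(2) by auto
    then obtain t where t: "rearrangement f n < t" "t < v" using dense by blast
    have "A \<subseteq> {k. t < norm (f k)}"
    proof
      fix k assume "k \<in> A"
      then have "v \<le> norm (f k)" unfolding v_def using A(1) by (intro Min_le) auto
      then show "k \<in> {k. t < norm (f k)}" using t by simp
    qed
    then show ?thesis using rearrangement_mono_lt[OF t(1)] card_mono order_trans by metis
  qed simp
  show fin': "finite {k. rearrangement f n < norm (f k)}"
  proof (rule ccontr)
    assume "infinite {k. rearrangement f n < norm (f k)}"
    then obtain A where "A \<subseteq> {k. rearrangement f n < norm (f k)}" "finite A" "card A = Suc n"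
      using infinite_arbitrarily_large by metis
    then show False using *[of A] by simp
  qed
  then show "card {k. rearrangement f n < norm (f k)} \<le> n" by (rule *) simp
qed

text \<open>Only finitely many sizes lie between half of the value and the value itself, so some
  threshold below the value is exceeded just where the value is reached. Were there at most
  \<open>n\<close> such indices, the infimum would not exceed this threshold.\<close>

lemma card_at_rearrangement:
  assumes "0 < rearrangement f n"
  shows "n < card {k. rearrangement f n \<le> norm (f k)}"
proof (rule ccontr)
  let ?r = "rearrangement f n"
  assume no: "\<not> ?thesis"
  define D where "D = insert (?r / 2) ((\<lambda>k. norm (f k)) ` {k. ?r / 2 \<le> norm (f k) \<and> norm (f k) < ?r})"
  have "finite {k. ?r / 2 \<le> norm (f k) \<and> norm (f k) < ?r}"
    by (rule finite_subset[OF _ fin[of "?r / 2"]]) (use assms in auto)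
  then have D: "finite D" by (simp add: D_def)
  define t where "t = Max D"
  have "t \<in> D" unfolding t_def by (rule Max_in[OF D]) (simp add: D_def)
  then have t: "t < ?r" "0 < t" using assms by (auto simp: D_def)
  have "{k. t < norm (f k)} \<subseteq> {k. ?r \<le> norm (f k)}"
  proof
    fix k assume k: "k \<in> {k. t < norm (f k)}"
    show "k \<in> {k. ?r \<le> norm (f k)}"
    proof (rule ccontr)
      assume "k \<notin> {k. ?r \<le> norm (f k)}"
      moreover have "?r / 2 \<le> t" unfolding t_def by (rule Max_ge[OF D]) (simp add: D_def)
      ultimately have "norm (f k) \<in> D" using k by (auto simp: D_def)
      then have "norm (f k) \<le> t" unfolding t_def by (rule Max_ge[OF D])
      then show False using k by simp
    qed
  qed
  then have "card {k. t < norm (f k)} \<le> n"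
    using no card_mono[OF fin[OF assms]] by (meson not_less order_trans)
  then have "?r \<le> t" using t by (intro rearrangement_le finite_superlevel) auto
  then show False using t by simp
qed

lemma rearrangement_antimono: "m \<le> n \<Longrightarrow> rearrangement f n \<le> rearrangement f m"
  using above_rearrangement[of m] rearrangement_ge0[of m] by (intro rearrangement_le) auto

lemma rearrangement_le_of_le:
  assumes "\<And>k. norm (g k) \<le> norm (f k)"
  shows "rearrangement g n \<le> rearrangement f n"
proof (rule rearrangement_le)
  have sub: "{k. rearrangement f n < norm (g k)} \<subseteq> {k. rearrangement f n < norm (f k)}"
    using assms less_le_trans by auto
  then show "finite {k. rearrangement f n < norm (g k)}"
    using above_rearrangement finite_subset by blast
  show "card {k. rearrangement f n < norm (g k)} \<le> n"
    using card_mono[OF above_rearrangement(1) sub] above_rearrangement(2)[of n] by simp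
qed (rule rearrangement_ge0)

lemma rearrangement_le_bound:
  assumes "\<And>k. norm (f k) \<le> B" "0 \<le> B"
  shows "rearrangement f n \<le> B"
proof -
  have "{k. B < norm (f k)} = {}" using assms by (auto simp: not_less)
  then show ?thesis using assms(2) by (intro rearrangement_le) auto
qed

end

lemma c0_finite:
  assumes "a \<in> c0" "0 < t" shows "finite {k. t \<le> norm (a k)}"
proof -
  have "eventually (\<lambda>k. norm (a k) < t) sequentially"
    using assms order_tendstoD(2)[OF tendsto_norm_zero, of a sequentially t] by (simp add: c0_def)
  then have "finite {k. \<not> norm (a k) < t}"
    by (simp add: eventually_cofinite[symmetric] cofinite_eq_sequentially)
  then show ?thesis by (simp add: not_less)
qed


section \<open>Chains of level sets\<close>

text \<open>\<open>N f n\<close> is the size of the coefficient number \<open>n\<close> of \<open>f\<close>, and \<open>Q A\<close> the projection onto the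
  coordinates in \<open>A\<close>. The instances are a space with an almost greedy basis, where \<open>\<omega>\<close> is its
  fundamental function, and the dual of this space, where \<open>\<omega> n\<close> is \<open>n\<close> divided by it.\<close>

locale chain_space =
  fixes N :: "'z::real_normed_vector \<Rightarrow> nat \<Rightarrow> real" and Q :: "nat set \<Rightarrow> 'z \<Rightarrow> 'z"
    and \<omega> :: "nat \<Rightarrow> real" and K c :: real
  assumes N_ge0: "0 \<le> N f n"
    and N_comb: "\<lbrakk>finite I; \<And>i. i \<in> I \<Longrightarrow> finite (A i)\<rbrakk> \<Longrightarrow>
      N (\<Sum>i\<in>I. \<mu> i *\<^sub>R Q (A i) f) n = \<bar>\<Sum>i\<in>I. if n \<in> A (i::nat) then \<mu> i else 0\<bar> * N f n"
    and N_fin: "0 < t \<Longrightarrow> finite {n. t \<le> N f n}"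
    and K: "0 < K" "0 < t \<Longrightarrow> norm (Q {n. t \<le> N f n} f) \<le> K * norm f"
    and c: "0 < c" "\<lbrakk>finite E; 0 < t; \<And>n. n \<in> E \<Longrightarrow> t \<le> N f n\<rbrakk> \<Longrightarrow> c * (t * \<omega> (card E)) \<le> norm f"
    and close: "0 < \<theta> \<Longrightarrow> \<exists>m. hulls_close TYPE('z) \<theta> m"
begin

text \<open>\<open>E l\<close> need not exhaust its level. A chain of \<open>f\<close> therefore
  remains one for every vector with coefficients of the same size on these sets, whatever its other
  coefficients are.\<close>

definition chain :: "'z \<Rightarrow> nat \<Rightarrow> real \<Rightarrow> (nat \<Rightarrow> real) \<Rightarrow> (nat \<Rightarrow> nat set) \<Rightarrow> bool" where
  "chain f n \<rho> t E \<longleftrightarrow> (\<forall>l<n. 0 < t (Suc l) \<and> t (Suc l) < t l \<and> finite (E l) \<and>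
     (\<forall>i\<in>E l. t (Suc l) \<le> N f i \<and> N f i < t l) \<and> \<rho> \<le> t (Suc l) * \<omega> (card (E l)))"

definition growth :: "nat \<Rightarrow> real \<Rightarrow> bool" where
  "growth n R \<longleftrightarrow> (\<forall>f \<rho> t E. 0 < \<rho> \<longrightarrow> chain f n \<rho> t E \<longrightarrow> \<rho> * R \<le> norm f)"

lemma growth_one: "growth 1 c"
  unfolding growth_def
proof (intro allI impI)
  fix f \<rho> t E assume "0 < \<rho>" and ch: "chain f 1 \<rho> t E"
  have "\<rho> \<le> t 1 * \<omega> (card (E 0))" using ch by (simp add: chain_def)
  then have "\<rho> * c \<le> c * (t 1 * \<omega> (card (E 0)))" using c(1) by simp
  also have "\<dots> \<le> norm f" using ch by (intro c(2)) (auto simp: chain_def)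
  finally show "\<rho> * c \<le> norm f" .
qed

lemma chain_antimono:
  assumes "chain f n \<rho> t E" "i \<le> j" "j \<le> n" shows "t j \<le> t i"
  using assms(2,3)
proof (induction j rule: dec_induct)
  case (step j)
  then have "t (Suc j) < t j" using assms(1) by (simp add: chain_def)
  then show ?case using step by simp
qed simp

text \<open>Otherwise the projections of \<open>f\<close> onto the unions of the first \<open>k\<close> of \<open>m\<close> groups of \<open>n\<close>
  consecutive levels would contradict closeness of hulls: a difference of convex combinations
  keeps the coefficients of \<open>f\<close> on one of the groups, so its norm is still bounded below.\<close>

lemma growth_step:
  assumes g: "growth n R" and R: "0 < R" and m: "hulls_close TYPE('z) (1 / (2 * K)) m"
  shows "growth (n * m) (2 * R)"
  unfolding growth_def
proof (intro allI impI, rule ccontr)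
  fix f \<rho> t E assume \<rho>: "0 < \<rho>" and ch: "chain f (n * m) \<rho> t E" and "\<not> \<rho> * (2 * R) \<le> norm f"
  then have small: "norm f < 2 * R * \<rho>" by (simp add: mult_ac)
  define A where "A k = {i. t ((k + 1) * n) \<le> N f i}" for k
  \<comment> \<open>A bound for the projections of \<open>f\<close> under the hypothesis to be
    refuted; multiplied by \<open>1 / (2 * K)\<close> it becomes \<open>\<rho> * R\<close>.\<close>
  define D where "D = 2 * R * \<rho> * K"
  have D: "0 < D" using R \<rho> K(1) by (simp add: D_def)
  have tpos: "0 < t ((k + 1) * n)" if "k < m" "0 < n" for k
  proof -
    have "(k + 1) * n \<le> m * n" using that by (intro mult_le_mono1) simp
    then have "(k + 1) * n \<le> n * m" by (simp only: mult.commute[of m])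
    then have "(k + 1) * n - 1 < n * m" "Suc ((k + 1) * n - 1) = (k + 1) * n" using that by auto
    then show ?thesis using ch unfolding chain_def by metis
  qed
  show False
  proof (cases "n = 0")
    case True
    then have "growth 0 R" using g by simp
    \<comment> \<open>Every vector, also 0, has the empty chain, so \<open>growth 0 R\<close> cannot
      hold for positive \<open>R\<close>.\<close>
    have "1 * R \<le> norm (0::'z)"
      using \<open>growth 0 R\<close>[unfolded growth_def, THEN spec, THEN spec, of 1 0] by (simp add: chain_def)
    then show False using R by simp
  next
    case False
    then have n: "0 < n" by simp
    have fA: "finite (A k)" if "k < m" for k
      unfolding A_def by (rule N_fin[OF tpos[OF that n]])
    have "\<forall>k<m. norm ((1/D) *\<^sub>R Q (A k) f) \<le> 1"
    proof (intro allI impI)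
      fix k assume "k < m"
      have "norm (Q (A k) f) \<le> K * norm f" unfolding A_def by (rule K(2)[OF tpos[OF \<open>k < m\<close> n]])
      also have "\<dots> \<le> D" using small K(1) by (simp add: D_def mult.commute)
      finally show "norm ((1/D) *\<^sub>R Q (A k) f) \<le> 1" using D by simp
    qed
    with m obtain k \<mu> where k: "Suc k < m" and \<mu>: "\<forall>i. 0 \<le> \<mu> i" "(\<Sum>i\<le>k. \<mu> i) = 1"
      "(\<Sum>i\<in>{k<..<m}. \<mu> i) = (1::real)"
      and near: "norm ((\<Sum>i\<in>{k<..<m}. \<mu> i *\<^sub>R (1/D) *\<^sub>R Q (A i) f) - (\<Sum>i\<le>k. \<mu> i *\<^sub>R (1/D) *\<^sub>R Q (A i) f))
        < 1 / (2 * K)"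
      unfolding hulls_close_def
      by (elim allE[of _ "\<lambda>k. (1/D) *\<^sub>R Q (A k) f"]) blast
    define \<nu> where "\<nu> i = (if i \<le> k then - \<mu> i else \<mu> i)" for i
    define v where "v = (\<Sum>i<m. \<nu> i *\<^sub>R Q (A i) f)"
    have split: "{..<m} = {..k} \<union> {k<..<m}" using k by auto
    have "v = (\<Sum>i\<le>k. \<nu> i *\<^sub>R Q (A i) f) + (\<Sum>i\<in>{k<..<m}. \<nu> i *\<^sub>R Q (A i) f)"
      unfolding v_def split by (rule sum.union_disjoint) auto
    also have "(\<Sum>i\<le>k. \<nu> i *\<^sub>R Q (A i) f) = - (\<Sum>i\<le>k. \<mu> i *\<^sub>R Q (A i) f)"
      by (simp add: \<nu>_def flip: sum_negf)
    also have "(\<Sum>i\<in>{k<..<m}. \<nu> i *\<^sub>R Q (A i) f) = (\<Sum>i\<in>{k<..<m}. \<mu> i *\<^sub>R Q (A i) f)"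
      by (rule sum.cong) (auto simp: \<nu>_def)
    finally have "(1/D) *\<^sub>R v = (\<Sum>i\<in>{k<..<m}. \<mu> i *\<^sub>R (1/D) *\<^sub>R Q (A i) f) - (\<Sum>i\<le>k. \<mu> i *\<^sub>R (1/D) *\<^sub>R Q (A i) f)"
      by (simp add: scaleR_add_right scaleR_diff_right scaleR_sum_right mult.commute)
    with near have "norm ((1/D) *\<^sub>R v) < 1 / (2 * K)" by simp
    then have "norm v < D / (2 * K)" using D K(1) by (simp add: field_simps)
    then have v: "norm v < \<rho> * R" using K(1) by (simp add: D_def mult_ac)
    \<comment> \<open>The levels of the group right after the cut. Among the sets \<open>A j\<close>
      with \<open>j < m\<close>, their indices belong to those with \<open>j > k\<close> only, where
      the weights sum to 1; so \<open>v\<close> has coefficients of the same size as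
      \<open>f\<close> there.\<close>
    have "chain v n \<rho> (\<lambda>l. t (l + (k + 1) * n)) (\<lambda>l. E (l + (k + 1) * n))"
      unfolding chain_def
    proof (intro allI impI)
      fix l assume l: "l < n"
      have le: "(k + 1) * n + n \<le> n * m"
      proof -
        have "(Suc k + 1) * n \<le> m * n" using k by (intro mult_le_mono1) simp
        then show ?thesis by (simp add: algebra_simps)
      qed
      then have lt: "l + (k + 1) * n < n * m" using l by simp
      have Nv: "N v i = N f i" if i: "i \<in> E (l + (k + 1) * n)" for i
      proof -
        have i1: "t (Suc (l + (k + 1) * n)) \<le> N f i" "N f i < t (l + (k + 1) * n)"
          using ch lt i by (auto simp: chain_def)
        have out: "i \<notin> A j" if "j \<le> k" for j
        proof -
          have "t (l + (k + 1) * n) \<le> t ((j + 1) * n)"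
            using that lt by (intro chain_antimono[OF ch]) (auto intro: trans_le_add2 mult_le_mono1)
          then show ?thesis using i1 by (simp add: A_def)
        qed
        have in': "i \<in> A j" if "k < j" "j < m" for j
        proof -
          have "Suc (l + (k + 1) * n) \<le> (k + 1) * n + n" using l by simp
          also have "\<dots> = (Suc k + 1) * n" by simp
          also have "\<dots> \<le> (j + 1) * n" using that by (intro mult_le_mono1) simp
          finally have "Suc (l + (k + 1) * n) \<le> (j + 1) * n" .
          moreover have "(j + 1) * n \<le> m * n" using that by (intro mult_le_mono1) simp
          then have "(j + 1) * n \<le> n * m" by (simp only: mult.commute[of m])
          ultimately have "t ((j + 1) * n) \<le> t (Suc (l + (k + 1) * n))"
            by (rule chain_antimono[OF ch])
          then show ?thesis using i1 by (simp add: A_def)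
        qed
        have "N v i = \<bar>\<Sum>j<m. if i \<in> A j then \<nu> j else 0\<bar> * N f i"
          unfolding v_def by (rule N_comb) (auto simp: fA)
        also have "(\<Sum>j<m. if i \<in> A j then \<nu> j else 0) = (\<Sum>j\<in>{k<..<m}. \<mu> j)"
          using out in' by (intro sum.mono_neutral_cong_right) (auto simp: \<nu>_def)
        finally show ?thesis using \<mu> by simp
      qed
      have "0 < t (Suc (l + (k + 1) * n)) \<and> t (Suc (l + (k + 1) * n)) < t (l + (k + 1) * n) \<and>
        finite (E (l + (k + 1) * n)) \<and>
        (\<forall>i\<in>E (l + (k + 1) * n). t (Suc (l + (k + 1) * n)) \<le> N f i \<and> N f i < t (l + (k + 1) * n)) \<and>
        \<rho> \<le> t (Suc (l + (k + 1) * n)) * \<omega> (card (E (l + (k + 1) * n)))"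
        using ch lt unfolding chain_def by blast
      then show "0 < t (Suc l + (k + 1) * n) \<and> t (Suc l + (k + 1) * n) < t (l + (k + 1) * n) \<and>
        finite (E (l + (k + 1) * n)) \<and>
        (\<forall>i\<in>E (l + (k + 1) * n). t (Suc l + (k + 1) * n) \<le> N v i \<and> N v i < t (l + (k + 1) * n)) \<and>
        \<rho> \<le> t (Suc l + (k + 1) * n) * \<omega> (card (E (l + (k + 1) * n)))"
        using Nv by simp
    qed
    then have "\<rho> * R \<le> norm v" using g \<rho> unfolding growth_def by blast
    then show False using v by simp
  qed
qed

lemma growth_power: "\<exists>m\<ge>2. \<forall>i. growth (m ^ i) (2 ^ i * c)"
proof -
  obtain m where m: "hulls_close TYPE('z) (1 / (2 * K)) m"
    using close[of "1 / (2 * K)"] K(1) by auto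
  \<comment> \<open>Closeness for the zero sequence: it supplies a cut, which needs at least two
    members.\<close>
  have "\<exists>k. Suc k < m"
    using m unfolding hulls_close_def by (elim allE[of _ "\<lambda>_. 0"]) auto
  then have "2 \<le> m" by auto
  moreover have "growth (m ^ i) (2 ^ i * c)" for i
  proof (induction i)
    case 0
    then show ?case using growth_one by simp
  next
    case (Suc i)
    have "growth (m ^ i * m) (2 * (2 ^ i * c))"
      by (rule growth_step[OF Suc _ m]) (use c(1) in simp)
    then show ?case by (simp add: mult_ac)
  qed
  ultimately show ?thesis by blast
qed

end

section \<open>Power summability of the rearrangement at powers of \<open>M\<close>\<close>

locale regular_chain_space = chain_space N Q \<omega> K c
  for N :: "'z::real_normed_vector \<Rightarrow> nat \<Rightarrow> real" and Q \<omega> K c +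
  fixes M :: nat
  assumes M: "2 \<le> M" and \<omega>_pos: "0 < \<omega> 1"
    and \<omega>_double: "2 * \<omega> (M ^ k) \<le> \<omega> (M ^ Suc k)"
    and \<omega>_half: "n \<le> 2 * n' \<Longrightarrow> \<omega> n \<le> 2 * \<omega> n'"
begin

text \<open>The value at position \<open>M ^ k\<close> when positions are counted from 1.\<close>

definition decr :: "'z \<Rightarrow> nat \<Rightarrow> real" where
  "decr f k = rearrangement (N f) (M ^ k - 1)"

lemma \<omega>_power_pos: "0 < \<omega> (M ^ k)"
proof (induction k)
  case (Suc k)
  then show ?case using \<omega>_double[of k] by simp
qed (use \<omega>_pos in simp)

lemma \<omega>_double_less:
  assumes "k < k'" shows "2 * \<omega> (M ^ k) \<le> \<omega> (M ^ k')"
proof -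
  have "\<omega> (M ^ i) \<le> \<omega> (M ^ Suc i)" for i using \<omega>_double[of i] \<omega>_power_pos[of i] by linarith
  then have "\<omega> (M ^ Suc k) \<le> \<omega> (M ^ k')"
    by (rule lift_Suc_mono_le[of "\<lambda>i. \<omega> (M ^ i)"]) (rule Suc_leI[OF assms])
  then show ?thesis using \<omega>_double[of k] by linarith
qed

lemma N_superlevel: "0 < t \<Longrightarrow> finite {k. t \<le> norm (N f k)}"
  using N_fin[of t f] N_ge0 by simp

lemma decr_ge0: "0 \<le> decr f k"
  unfolding decr_def by (rule rearrangement_ge0[OF N_superlevel])

lemma card_at_decr: "0 < decr f k \<Longrightarrow> M ^ k \<le> card {i. decr f k \<le> N f i}"
  using card_at_rearrangement[OF N_superlevel, of f "M ^ k - 1"] M N_ge0 by (simp add: decr_def)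

lemma above_decr: "finite {i. decr f k < N f i}" "card {i. decr f k < N f i} < M ^ k"
proof -
  have "card {i. decr f k < N f i} \<le> M ^ k - 1"
    using above_rearrangement(2)[OF N_superlevel, of f "M ^ k - 1"] N_ge0 by (simp add: decr_def)
  moreover have "0 < M ^ k" using M by simp
  ultimately show "card {i. decr f k < N f i} < M ^ k" by linarith
  show "finite {i. decr f k < N f i}"
    using above_rearrangement(1)[OF N_superlevel, of f "M ^ k - 1"] N_ge0 by (simp add: decr_def)
qed

text \<open>Every second member of \<open>J\<close> yields a threshold; the members in between guarantee that
  passing to the next threshold at least doubles the level set.\<close>

lemma ex_chain:
  assumes J: "finite J" "2 * n < card J" and \<sigma>: "0 < \<sigma>"
    and X: "\<And>k. k \<in> J \<Longrightarrow> \<sigma> < decr f k * \<omega> (M ^ k)" "\<And>k. k \<in> J \<Longrightarrow> decr f k * \<omega> (M ^ k) \<le> 2 * \<sigma>"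
  shows "\<exists>t E. chain f n (\<sigma> / 2) t E"
proof -
  obtain h where h: "bij_betw h {..<card J} J" "strict_mono_on {..<card J} h"
    using ex_bij_betw_strict_mono_card[OF J(1)] by blast
  have hJ: "h i \<in> J" if "i \<le> 2 * n" for i
    using bij_betwE[OF h(1)] that J(2) by auto
  have hmono: "h i < h j" if "i < j" "j \<le> 2 * n" for i j
    using h(2) that J(2) by (auto simp: strict_mono_on_def)
  have pos: "0 < decr f k" if "k \<in> J" for k
    using X(1)[OF that] \<sigma> \<omega>_power_pos[of k] by (smt (verit) mult_nonpos_nonneg)
  \<comment> \<open>The products agree up to a factor of 2 while \<open>\<omega>\<close> at least
    doubles between distinct exponents, so the thresholds strictly decrease.\<close>
  have dec: "decr f k' < decr f k" if "k \<in> J" "k' \<in> J" "k < k'" for k k'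
  proof (rule ccontr)
    assume "\<not> ?thesis"
    then have "decr f k * (2 * \<omega> (M ^ k)) \<le> decr f k' * \<omega> (M ^ k')"
      using \<omega>_double_less[OF that(3)] \<omega>_power_pos[of k] by (intro mult_mono decr_ge0) auto
    then show False using X(1)[OF that(1)] X(2)[OF that(2)] by simp
  qed
  define t where "t l = decr f (h (2 * l))" for l
  define E where "E l = {i. t (Suc l) \<le> N f i \<and> N f i < t l}" for l
  have "chain f n (\<sigma> / 2) t E"
    unfolding chain_def
  proof (intro allI impI conjI ballI)
    fix l assume l: "l < n"
    let ?a = "h (2 * l)" and ?b = "h (2 * l + 1)" and ?c = "h (2 * l + 2)"
    have in': "?a \<in> J" "?b \<in> J" "?c \<in> J" and lt: "?a < ?b" "?b < ?c"
      using l by (auto intro: hJ hmono)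
    show tpos: "0 < t (Suc l)" using pos[OF in'(3)] by (simp add: t_def)
    show "t (Suc l) < t l" using dec[OF in'(1,3)] lt by (simp add: t_def)
    have fin: "finite {i. t (Suc l) \<le> N f i}" by (rule N_fin[OF tpos])
    then show finE: "finite (E l)" by (rule rev_finite_subset) (auto simp: E_def)
    show "t (Suc l) \<le> N f i" "N f i < t l" if "i \<in> E l" for i using that by (auto simp: E_def)
    have sub: "{i. t l \<le> N f i} \<subseteq> {i. decr f ?b < N f i}"
      using dec[OF in'(1,2) lt(1)] by (auto simp: t_def)
    have "M ^ ?c \<le> card {i. t (Suc l) \<le> N f i}"
      using card_at_decr[OF pos[OF in'(3)]] by (simp add: t_def)
    also have "{i. t (Suc l) \<le> N f i} \<subseteq> E l \<union> {i. decr f ?b < N f i}"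
      using sub by (auto simp: E_def not_less)
    then have "card {i. t (Suc l) \<le> N f i} \<le> card (E l \<union> {i. decr f ?b < N f i})"
      by (rule card_mono[rotated]) (simp add: finE above_decr)
    also have "\<dots> \<le> card (E l) + card {i. decr f ?b < N f i}" by (rule card_Un_le)
    finally have 1: "M ^ ?c < card (E l) + M ^ ?b" using above_decr(2)[of f ?b] by linarith
    \<comment> \<open>At most half of the \<open>M ^ ?c\<close> indices are lost to the levels
      above, so \<open>E l\<close> retains at least half and \<open>\<omega>\<close> at least half
      of its value.\<close>
    have "2 * M ^ ?b \<le> M * M ^ ?b" using M by (intro mult_le_mono1)
    also have "\<dots> = M ^ Suc ?b" by simp
    also have "\<dots> \<le> M ^ ?c" using lt M by (intro power_increasing) auto
    finally have "M ^ ?c \<le> 2 * card (E l)" using 1 by linarith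
    then have "\<omega> (M ^ ?c) \<le> 2 * \<omega> (card (E l))" by (rule \<omega>_half)
    then have "decr f ?c * \<omega> (M ^ ?c) \<le> decr f ?c * (2 * \<omega> (card (E l)))"
      by (intro mult_left_mono decr_ge0)
    then show "\<sigma> / 2 \<le> t (Suc l) * \<omega> (card (E l))"
      using X(1)[OF in'(3)] by (simp add: t_def)
  qed
  then show ?thesis by blast
qed

lemma decr_le_1:
  assumes "norm f \<le> c" shows "decr f k * \<omega> (M ^ k) \<le> 1"
proof (cases "decr f k = 0")
  case False
  then have pos: "0 < decr f k" using decr_ge0[of f k] by simp
  obtain E where E: "E \<subseteq> {i. decr f k \<le> N f i}" "card E = M ^ k" "finite E"
    using obtain_subset_with_card_n[OF card_at_decr[OF pos]] by blast
  have "c * (decr f k * \<omega> (card E)) \<le> norm f" using E pos by (intro c(2)) auto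
  then have "c * (decr f k * \<omega> (M ^ k)) \<le> c * 1" using assms E by simp
  then show ?thesis using c(1) by (simp only: mult_le_cancel_left_pos)
qed simp

text \<open>The exponents \<open>k\<close> are sorted by the dyadic size \<open>(1/2) ^ s\<close> of
  their terms. Too many of one size would form a long chain, whose growth contradicts
  \<open>norm f \<le> c\<close>. Hence the number of terms of this size is at most a constant times
  \<open>m ^ s\<close>, and an exponent \<open>r\<close> with \<open>2 * m \<le> 2 powr r\<close>
  makes the sum over \<open>s\<close> geometric.\<close>

theorem decr_summable:
  "\<exists>r0. \<forall>r\<ge>r0. \<exists>C. \<forall>f. norm f \<le> c \<longrightarrow> (\<forall>n. (\<Sum>k<n. (decr f k * \<omega> (M ^ k)) powr r) \<le> C)"
proof -
  obtain m :: nat where m: "2 \<le> m" and gr: "\<And>i. growth (m ^ i) (2 ^ i * c)"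
    using growth_power by blast
  show ?thesis
  proof (rule exI[of _ "real (2 * m)"], intro allI impI)
    fix r :: real assume r: "real (2 * m) \<le> r"
    have r2: "2 * real m \<le> 2 powr r"
    proof -
      have "2 * m < 2 ^ (2 * m)" by (rule less_exp)
      then have "real (2 * m) < 2 ^ (2 * m)" by (metis of_nat_less_iff of_nat_numeral of_nat_power)
      also have "(2::real) ^ (2 * m) = 2 powr real (2 * m)" by (simp only: powr_realpow zero_less_numeral)
      also have "\<dots> \<le> 2 powr r" using r by (intro powr_mono) auto
      finally show ?thesis by simp
    qed
    have geo: "real (m ^ s) * ((1/2) ^ s) powr r \<le> (1/2) ^ s" for s
    proof -
      have "((1/2::real) ^ s) powr r = 1 / (2 powr r) ^ s"
        by (simp add: power_one_over powr_divide powr_powr mult.commute flip: powr_realpow)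
      also have "\<dots> \<le> 1 / (2 * real m) ^ s"
        using r2 m by (intro divide_left_mono power_mono) auto
      finally have "real (m ^ s) * ((1/2) ^ s) powr r \<le> real (m ^ s) * (1 / (2 * real m) ^ s)"
        by (rule mult_left_mono) simp
      also have "\<dots> = (1/2) ^ s" using m by (simp add: power_mult_distrib power_one_over)
      finally show ?thesis .
    qed
    have "(\<Sum>k<n. (decr f k * \<omega> (M ^ k)) powr r) \<le> 4 * real (m ^ 3)" if f: "norm f \<le> c" for f n
    proof -
      define X where "X k = decr f k * \<omega> (M ^ k)" for k
      have X0: "0 \<le> X k" and X1: "X k \<le> 1" for k
        using decr_ge0 \<omega>_power_pos[of k] decr_le_1[OF f] by (auto simp: X_def less_imp_le)
      define G where "G = {k. k < n \<and> 0 < X k}"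
      define lev where "lev k = (LEAST s. (1/2) ^ Suc s < X k)" for k
      have lev: "(1/2) ^ Suc (lev k) < X k" "X k \<le> (1/2) ^ lev k" if kG: "k \<in> G" for k
      proof -
        obtain s where "(1/2::real) ^ s < X k"
          using real_arch_pow_inv[of "X k" "1/2"] kG by (auto simp: G_def)
        then have "(1/2::real) ^ Suc s < X k" using zero_le_power[of "1/2::real" s] by (simp only: power_Suc) linarith
        then show "(1/2) ^ Suc (lev k) < X k" unfolding lev_def by (rule LeastI)
        show "X k \<le> (1/2) ^ lev k"
        proof (cases "lev k")
          case 0
          then show ?thesis using X1 by simp
        next
          case (Suc s)
          then have "\<not> (1/2) ^ Suc s < X k" unfolding lev_def by (intro not_less_Least) simp
          then show ?thesis using Suc by simp
        qed
      qed
      have fG: "finite G" by (simp add: G_def)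
      have card: "real (card {k \<in> G. lev k = s}) \<le> 2 * real (m ^ 3) * real (m ^ s)" for s
      proof (rule ccontr)
        assume "\<not> ?thesis"
        then have "real (2 * m ^ (s + 3)) < real (card {k \<in> G. lev k = s})"
          by (simp add: power_add mult_ac)
        then have "2 * m ^ (s + 3) < card {k \<in> G. lev k = s}" by (simp only: of_nat_less_iff)
        \<comment> \<open>The 3 in \<open>s + 3\<close> compensates the factor
          \<open>(1/2) ^ (s + 2)\<close> in the level size of the chain and leaves one more factor
          of 2, so that the norm is forced up to \<open>2 * c\<close>.\<close>
        then obtain t E where ch: "chain f (m ^ (s + 3)) ((1/2) ^ Suc s / 2) t E"
          using ex_chain[of "{k \<in> G. lev k = s}" "m ^ (s + 3)" "(1/2) ^ Suc s" f] lev fG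
          by (auto simp: X_def)
        have "(1/2) ^ Suc s / 2 * (2 ^ (s + 3) * c) \<le> norm f"
          by (rule gr[of "s + 3", unfolded growth_def, rule_format, OF _ ch]) simp
        also have "(1/2) ^ Suc s / 2 * (2 ^ (s + 3) * c) = 2 * c"
          by (simp add: power_add power_one_over)
        finally show False using f c(1) by simp
      qed
      have "(\<Sum>k<n. X k powr r) = (\<Sum>k\<in>G. X k powr r)"
        using X0 by (intro sum.mono_neutral_right) (auto simp: G_def le_less)
      also have "\<dots> = (\<Sum>s\<in>lev ` G. \<Sum>k\<in>{k \<in> G. lev k = s}. X k powr r)"
        by (rule sum.image_gen[OF fG])
      also have "\<dots> \<le> (\<Sum>s\<in>lev ` G. 2 * real (m ^ 3) * (1/2) ^ s)"
      proof (rule sum_mono)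
        fix s
        have "(\<Sum>k\<in>{k \<in> G. lev k = s}. X k powr r) \<le> (\<Sum>k\<in>{k \<in> G. lev k = s}. ((1/2) ^ s) powr r)"
          using lev r X0 by (intro sum_mono powr_mono2) auto
        also have "\<dots> \<le> 2 * real (m ^ 3) * real (m ^ s) * ((1/2) ^ s) powr r"
          using mult_right_mono[OF card] by simp
        also have "\<dots> \<le> 2 * real (m ^ 3) * (1/2) ^ s"
          using mult_left_mono[OF geo[of s], of "2 * real (m ^ 3)"] by (simp add: mult.assoc)
        finally show "(\<Sum>k\<in>{k \<in> G. lev k = s}. X k powr r) \<le> 2 * real (m ^ 3) * (1/2) ^ s" .
      qed
      also have "\<dots> = 2 * real (m ^ 3) * (\<Sum>s\<in>lev ` G. (1/2) ^ s)" by (rule sum_distrib_left[symmetric])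
      finally have "(\<Sum>k<n. X k powr r) \<le> 2 * real (m ^ 3) * (\<Sum>s\<in>lev ` G. (1/2) ^ s)" .
      moreover have "(\<Sum>s\<in>lev ` G. (1/2::real) ^ s) \<le> (\<Sum>s. (1/2) ^ s)"
        using fG by (intro sum_le_suminf summable_geometric) auto
      moreover have "(\<Sum>s. (1/2::real) ^ s) = 2" by (simp add: suminf_geometric)
      ultimately have "(\<Sum>k<n. X k powr r) \<le> 2 * real (m ^ 3) * 2"
        using mult_left_mono[of "\<Sum>s\<in>lev ` G. (1/2::real) ^ s" 2 "2 * real (m ^ 3)"] by linarith
      then show "(\<Sum>k<n. (decr f k * \<omega> (M ^ k)) powr r) \<le> 4 * real (m ^ 3)"
        unfolding X_def by simp
    qed
    then show "\<exists>C. \<forall>f. norm f \<le> c \<longrightarrow> (\<forall>n. (\<Sum>k<n. (decr f k * \<omega> (M ^ k)) powr r) \<le> C)" by blast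
  qed
qed

end

section \<open>Almost greedy bases\<close>

text \<open>A full level set splits no tie, so the rule for ties does not affect it.\<close>

lemma greedy_set_superlevel:
  assumes fin: "finite {n. t \<le> norm (a n)}"
  shows "greedy_set a (card {n. t \<le> norm (a n)}) = {n. t \<le> norm (a n)}" (is "greedy_set a (card ?E) = ?E")
proof (rule set_eqI)
  fix n
  show "n \<in> greedy_set a (card ?E) \<longleftrightarrow> n \<in> ?E"
  proof
    assume n: "n \<in> ?E"
    have sub: "greedy_before a n \<subseteq> ?E - {n}" using n by (auto simp: greedy_before_def)
    have "card (greedy_before a n) \<le> card (?E - {n})" using fin by (intro card_mono[OF _ sub]) auto
    also have "\<dots> < card ?E" using fin n by (intro psubset_card_mono) auto
    finally show "n \<in> greedy_set a (card ?E)"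
      using finite_subset[OF sub] fin by (simp add: greedy_set_def)
  next
    assume n: "n \<in> greedy_set a (card ?E)"
    show "n \<in> ?E"
    proof (rule ccontr)
      assume "n \<notin> ?E"
      then have "?E \<subseteq> greedy_before a n" by (auto simp: greedy_before_def)
      then have "card ?E \<le> card (greedy_before a n)" using n by (intro card_mono) (auto simp: greedy_set_def)
      then show False using n by (simp add: greedy_set_def)
    qed
  qed
qed

locale ag_basis = banach_over smul
  for smul :: "'k::{real_normed_field,euclidean_space} \<Rightarrow> 'a::banach \<Rightarrow> 'a" +
  fixes x :: "nat \<Rightarrow> 'a" and xs :: "nat \<Rightarrow> 'a \<Rightarrow> 'k"
  assumes sr: "superreflexive (space_of smul)"
    and basis: "is_basis smul x xs"
    and ag: "almost_greedy smul x xs"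
begin

abbreviation \<phi> :: "nat \<Rightarrow> real" where "\<phi> \<equiv> fundamental_fun smul x"

abbreviation P :: "nat set \<Rightarrow> 'a \<Rightarrow> 'a" where "P \<equiv> coord_proj smul x xs"

lemma linear_xs: "Vector_Spaces.linear smul (*) (xs n)"
  using basis by (simp add: is_basis_def)

lemma xs_add: "xs n (f + g) = xs n f + xs n g"
  and xs_smul: "xs n (smul c f) = c * xs n f"
  and xs_zero: "xs n 0 = 0"
  and xs_sum: "xs n (\<Sum>i\<in>I. F i) = (\<Sum>i\<in>I. xs n (F i))"
proof -
  interpret l: Vector_Spaces.linear smul "(*)" "xs n" by (rule linear_xs)
  show "xs n (f + g) = xs n f + xs n g" "xs n (smul c f) = c * xs n f" "xs n 0 = 0"
    "xs n (\<Sum>i\<in>I. F i) = (\<Sum>i\<in>I. xs n (F i))"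
    by (simp_all add: l.add l.scale l.zero l.sum)
qed

lemma xs_scaleR: "xs n (r *\<^sub>R f) = r *\<^sub>R xs n f"
  using xs_smul[of n "of_real r" f] by (simp add: scale_of_real scaleR_conv_of_real)

lemma smul_scaleR: "smul (r *\<^sub>R c) v = r *\<^sub>R smul c v"
  by (simp add: scaleR_conv_of_real scale_of_real flip: scale_scale)

lemma xs_x: "xs n (x m) = (if n = m then 1 else 0)"
  using basis by (simp add: is_basis_def)

lemma xs_comb: "finite A \<Longrightarrow> xs n (\<Sum>i\<in>A. smul (a i) (x i)) = (if n \<in> A then a n else 0)"
  by (simp add: xs_sum xs_smul xs_x if_distrib cong: if_cong)

lemma xs_P: "finite A \<Longrightarrow> xs n (P A f) = (if n \<in> A then xs n f else 0)"
  unfolding coord_proj_def by (rule xs_comb)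

lemma c0_xs: "(\<lambda>n. xs n f) \<in> c0"
  using ag by (simp add: almost_greedy_def coeff_transform_def)

lemma finite_level: "0 < t \<Longrightarrow> finite {n. t \<le> norm (xs n f)}"
  using c0_finite[OF c0_xs] .

lemma ex_bound_x: "\<exists>B>0. \<forall>n. norm (x n) \<le> B"
proof -
  obtain B where "\<forall>n. norm (x n) \<le> B" using basis by (auto simp: is_basis_def bdd_above_def)
  then show ?thesis by (intro exI[of _ "max B 1"]) (auto simp: le_max_iff_disj)
qed

lemma
  assumes "finite A" "\<And>n. n \<in> A \<Longrightarrow> norm (\<epsilon> n) = 1"
  shows \<phi>_upper': "card A \<le> m \<Longrightarrow> norm (\<Sum>n\<in>A. smul (\<epsilon> n) (x n)) \<le> \<phi> m"
    and \<phi>_upper: "norm (\<Sum>n\<in>A. smul (\<epsilon> n) (x n)) \<le> \<phi> (card A)"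
proof -
  show *: "norm (\<Sum>n\<in>A. smul (\<epsilon> n) (x n)) \<le> \<phi> m" if "card A \<le> m" for m
  unfolding fundamental_fun_def
  proof (rule cSup_upper)
    obtain B where B: "0 < B" "\<And>n. norm (x n) \<le> B" using ex_bound_x by blast
    show "bdd_above {norm (\<Sum>n\<in>A. smul (\<epsilon> n) (x n)) |A \<epsilon>. finite A \<and> card A \<le> m \<and> (\<forall>n\<in>A. norm (\<epsilon> n) = 1)}"
    proof (rule bdd_aboveI[of _ "m * B"], clarsimp)
      fix A and \<epsilon> :: "nat \<Rightarrow> 'k"
      assume A: "finite A" "card A \<le> m" "\<forall>n\<in>A. norm (\<epsilon> n) = 1"
      have "norm (\<Sum>n\<in>A. smul (\<epsilon> n) (x n)) \<le> (\<Sum>n\<in>A. B)"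
        using A B by (intro sum_norm_le) (simp add: norm_scale)
      also have "\<dots> \<le> m * B" using A B by simp
      finally show "norm (\<Sum>n\<in>A. smul (\<epsilon> n) (x n)) \<le> m * B" .
    qed
  qed (use assms that in blast)
  show "norm (\<Sum>n\<in>A. smul (\<epsilon> n) (x n)) \<le> \<phi> (card A)" by (rule *) simp
qed

lemma \<phi>_least:
  assumes "\<And>A \<epsilon>. finite A \<Longrightarrow> card A \<le> m \<Longrightarrow> \<forall>n\<in>A. norm (\<epsilon> n) = 1 \<Longrightarrow> norm (\<Sum>n\<in>A. smul (\<epsilon> n) (x n)) \<le> b"
  shows "\<phi> m \<le> b"
  unfolding fundamental_fun_def
proof (rule cSup_least)
  have "norm (\<Sum>n\<in>{}. smul (1::'k) (x n)) \<in>
    {norm (\<Sum>n\<in>A. smul (\<epsilon> n) (x n)) |A \<epsilon>. finite A \<and> card A \<le> m \<and> (\<forall>n\<in>A. norm (\<epsilon> n) = 1)}"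
    by (intro CollectI exI[of _ "{}"] exI[of _ "\<lambda>_. 1"]) simp
  then show "{norm (\<Sum>n\<in>A. smul (\<epsilon> n) (x n)) |A \<epsilon>. finite A \<and> card A \<le> m \<and> (\<forall>n\<in>A. norm (\<epsilon> n) = 1)} \<noteq> {}"
    by blast
qed (use assms in blast)

lemma \<phi>_mono: "m \<le> n \<Longrightarrow> \<phi> m \<le> \<phi> n"
  by (rule \<phi>_least) (rule \<phi>_upper', auto)

lemma \<phi>_zero: "\<phi> 0 = 0"
proof (rule antisym)
  show "\<phi> 0 \<le> 0" by (rule \<phi>_least) auto
  show "0 \<le> \<phi> 0" using \<phi>_upper'[of "{}" "\<lambda>_. 1" 0] by simp
qed

lemma \<phi>_add: "\<phi> (m + n) \<le> \<phi> m + \<phi> n"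
proof (rule \<phi>_least)
  fix A :: "nat set" and \<epsilon> :: "nat \<Rightarrow> 'k"
  assume A: "finite A" "card A \<le> m + n" "\<forall>n\<in>A. norm (\<epsilon> n) = 1"
  obtain B where B: "B \<subseteq> A" "card B = min m (card A)" "finite B"
    using obtain_subset_with_card_n[of "min m (card A)" A] by auto
  have "(\<Sum>n\<in>A. smul (\<epsilon> n) (x n)) = (\<Sum>n\<in>A - B. smul (\<epsilon> n) (x n)) + (\<Sum>n\<in>B. smul (\<epsilon> n) (x n))"
    by (rule sum.subset_diff[OF B(1) A(1)])
  then have "norm (\<Sum>n\<in>A. smul (\<epsilon> n) (x n)) \<le> norm (\<Sum>n\<in>A - B. smul (\<epsilon> n) (x n)) + norm (\<Sum>n\<in>B. smul (\<epsilon> n) (x n))"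
    using norm_triangle_ineq by metis
  also have "norm (\<Sum>n\<in>A - B. smul (\<epsilon> n) (x n)) \<le> \<phi> n"
    using A B by (intro \<phi>_upper') (auto simp: card_Diff_subset)
  also have "norm (\<Sum>n\<in>B. smul (\<epsilon> n) (x n)) \<le> \<phi> m"
    using A B by (intro \<phi>_upper') auto
  finally show "norm (\<Sum>n\<in>A. smul (\<epsilon> n) (x n)) \<le> \<phi> m + \<phi> n" by simp
qed

lemma \<phi>_mult: "\<phi> (k * n) \<le> k * \<phi> n"
proof (induction k)
  case (Suc k)
  have "\<phi> (Suc k * n) \<le> \<phi> n + \<phi> (k * n)" using \<phi>_add[of n "k * n"] by simp
  then show ?case using Suc by (simp add: algebra_simps)
qed (simp add: \<phi>_zero)

lemma \<phi>_pos: assumes "1 \<le> n" shows "0 < \<phi> n"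
proof -
  have "x 0 \<noteq> 0" using xs_x[of 0 0] xs_zero[of 0] by force
  then have "0 < norm (\<Sum>n\<in>{0}. smul ((\<lambda>_. 1) n) (x n))" by simp
  also have "\<dots> \<le> \<phi> n" by (rule \<phi>_upper') (use assms in auto)
  finally show ?thesis .
qed

lemma \<phi>_ge0: "0 \<le> \<phi> n"
  using \<phi>_zero \<phi>_pos[of n] by (cases "n = 0") auto

lemma ex_ag_constant:
  "\<exists>C\<ge>1. \<forall>f t A. 0 < t \<longrightarrow> finite A \<longrightarrow> card A \<le> card {n. t \<le> norm (xs n f)} \<longrightarrow>
    norm (f - P {n. t \<le> norm (xs n f)} f) \<le> C * norm (f - P A f)"
proof -
  obtain C where C: "\<And>f m A. finite A \<Longrightarrow> card A \<le> m \<Longrightarrow>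
      norm (f - greedy_sum smul x xs m f) \<le> C * norm (f - P A f)"
    using ag unfolding almost_greedy_def by blast
  have "norm (f - P {n. t \<le> norm (xs n f)} f) \<le> max C 1 * norm (f - P A f)"
    if *: "0 < t" "finite A" "card A \<le> card {n. t \<le> norm (xs n f)}" for f t A
  proof -
    have "greedy_sum smul x xs (card {n. t \<le> norm (xs n f)}) f = P {n. t \<le> norm (xs n f)} f"
      using greedy_set_superlevel[OF finite_level[OF *(1)]]
      by (simp add: greedy_sum_def coeff_transform_def)
    then have "norm (f - P {n. t \<le> norm (xs n f)} f) \<le> C * norm (f - P A f)"
      using C[OF *(2,3)] by metis
    also have "\<dots> \<le> max C 1 * norm (f - P A f)" by (intro mult_right_mono) auto
    finally show ?thesis .
  qed
  then show ?thesis by (intro exI[of _ "max C 1"]) auto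
qed

definition C :: real where
  "C = (SOME C. 1 \<le> C \<and> (\<forall>f t A. 0 < t \<longrightarrow> finite A \<longrightarrow> card A \<le> card {n. t \<le> norm (xs n f)} \<longrightarrow>
    norm (f - P {n. t \<le> norm (xs n f)} f) \<le> C * norm (f - P A f)))"

lemma C_ge1: "1 \<le> C"
  and ag_C: "0 < t \<Longrightarrow> finite A \<Longrightarrow> card A \<le> card {n. t \<le> norm (xs n f)} \<Longrightarrow>
    norm (f - P {n. t \<le> norm (xs n f)} f) \<le> C * norm (f - P A f)"
  using someI_ex[OF ex_ag_constant] unfolding C_def by blast+

text \<open>The empty set is the competitor; the bound is for the projection adapted to
  \<open>f\<close>, not for a fixed set of indices.\<close>

lemma norm_P_level: assumes "0 < t" shows "norm (P {n. t \<le> norm (xs n f)} f) \<le> (1 + C) * norm f"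
proof -
  have "norm (f - P {n. t \<le> norm (xs n f)} f) \<le> C * norm (f - P {} f)" using assms by (intro ag_C) auto
  then have "norm (f - P {n. t \<le> norm (xs n f)} f) \<le> C * norm f" by (simp add: coord_proj_def)
  moreover have "norm (P {n. t \<le> norm (xs n f)} f) \<le> norm f + norm (f - P {n. t \<le> norm (xs n f)} f)"
    using norm_triangle_sub norm_minus_commute by metis
  ultimately show ?thesis by (simp add: algebra_simps)
qed

text \<open>Adding terms of size \<open>t / 2\<close> outside the level set does not change the greedy sum, while
  projecting them away is a competitor.\<close>

lemma disjoint_le_level:
  assumes t: "0 < t" and E: "E = {n. t \<le> norm (xs n f)}"
    and D: "finite D" "D \<inter> E = {}" "card D \<le> card E" "\<And>n. n \<in> D \<Longrightarrow> norm (\<delta> n) = 1"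
  shows "t / 2 * norm (\<Sum>n\<in>D. smul (\<delta> n) (x n)) \<le> C * norm (P E f)"
proof -
  have fE: "finite E" unfolding E by (rule finite_level[OF t])
  define u where "u = (\<Sum>n\<in>D. smul (\<delta> n) (x n))"
  \<comment> \<open>The size \<open>t / 2\<close> lies strictly below \<open>t\<close>, so
    \<open>E\<close> is still the whole level set of \<open>g\<close>.\<close>
  define g where "g = P E f + (t / 2) *\<^sub>R u"
  have xs_u: "xs n u = (if n \<in> D then \<delta> n else 0)" for n
    unfolding u_def by (rule xs_comb[OF D(1)])
  have xs_g: "xs n g = (if n \<in> E then xs n f else if n \<in> D then (t / 2) *\<^sub>R \<delta> n else 0)" for n
    using D(2) by (auto simp: g_def xs_add xs_scaleR xs_P[OF fE] xs_u)
  have lev: "{n. t \<le> norm (xs n g)} = E"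
    using t D(4) by (auto simp: xs_g E)
  have PE: "P E g = P E f"
    unfolding coord_proj_def by (rule sum.cong) (auto simp: xs_g)
  have PD: "P D g = (t / 2) *\<^sub>R u"
  proof -
    show ?thesis
      unfolding coord_proj_def u_def scaleR_sum_right
      by (intro sum.cong refl) (use D(2) in \<open>auto simp: xs_g simp flip: smul_scaleR\<close>)
  qed
  have "norm (g - P E g) \<le> C * norm (g - P D g)"
    using ag_C[OF t D(1), of g] D(3) by (simp add: lev)
  then have "norm ((t / 2) *\<^sub>R u) \<le> C * norm (P E f)"
    by (simp add: PE PD) (simp add: g_def)
  then show ?thesis using t by (simp add: u_def)
qed

text \<open>The product of the losses in the lower estimate: \<open>2 * C\<close> for each of two
  comparisons of sets, and \<open>1 + C\<close> for the projection onto a level set.\<close>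

definition c :: real where "c = 1 / (4 * C^2 * (1 + C))"

lemma c_pos: "0 < c"
  using C_ge1 by (simp add: c_def)

text \<open>This is democracy together with a lower bound by the smallest coefficient. An arbitrary
  signed set \<open>B\<close> is compared with the sum over an auxiliary set, and the latter with
  the level set of \<open>f\<close>.\<close>

lemma level_lower:
  assumes t: "0 < t" and E: "finite E" "\<And>n. n \<in> E \<Longrightarrow> t \<le> norm (xs n f)"
  shows "c * (t * \<phi> (card E)) \<le> norm f"
proof -
  define F where "F = {n. t \<le> norm (xs n f)}"
  have F: "finite F" "E \<subseteq> F" using finite_level[OF t] E(2) by (auto simp: F_def)
  have "\<phi> (card F) \<le> 4 * C^2 * (1 + C) * norm f / t"
  proof (rule \<phi>_least)
    fix B :: "nat set" and \<delta> :: "nat \<Rightarrow> 'k"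
    assume B: "finite B" "card B \<le> card F" "\<forall>n\<in>B. norm (\<delta> n) = 1"
    \<comment> \<open>The comparison lemma needs disjoint sets, while \<open>B\<close> and
      \<open>F\<close> may overlap; \<open>D\<close> is disjoint from both.\<close>
    have "infinite (- (B \<union> F))" using B F by (simp add: Compl_eq_Diff_UNIV Diff_infinite_finite)
    then obtain D where D: "D \<subseteq> - (B \<union> F)" "card D = card F" "finite D"
      using infinite_arbitrarily_large by metis
    define u where "u = (\<Sum>n\<in>D. smul 1 (x n))"
    have xs_u: "xs n u = (if n \<in> D then 1 else 0)" for n
      unfolding u_def by (rule xs_comb[OF D(3)])
    have Du: "D = {n. 1 \<le> norm (xs n u)}" by (auto simp: xs_u)
    have PDu: "P D u = u"
      unfolding coord_proj_def using xs_u by (simp add: u_def)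
    have "1 / 2 * norm (\<Sum>n\<in>B. smul (\<delta> n) (x n)) \<le> C * norm u"
      using disjoint_le_level[OF _ Du B(1), of \<delta>] B D PDu by auto
    then have 1: "norm (\<Sum>n\<in>B. smul (\<delta> n) (x n)) \<le> 2 * C * norm u" by simp
    have "t / 2 * norm u \<le> C * norm (P F f)"
      unfolding u_def by (rule disjoint_le_level[OF t F_def]) (use D in auto)
    also have "\<dots> \<le> C * ((1 + C) * norm f)"
      using norm_P_level[OF t, of f] C_ge1 unfolding F_def by (intro mult_left_mono) auto
    finally have "norm u \<le> 2 * C * (1 + C) * norm f / t" using t by (simp add: field_simps)
    then have "2 * C * norm u \<le> 2 * C * (2 * C * (1 + C) * norm f / t)"
      using C_ge1 by (intro mult_left_mono) auto
    then show "norm (\<Sum>n\<in>B. smul (\<delta> n) (x n)) \<le> 4 * C^2 * (1 + C) * norm f / t"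
      using 1 by (simp add: power2_eq_square mult_ac)
  qed
  then have "\<phi> (card E) \<le> 4 * C^2 * (1 + C) * norm f / t"
    using \<phi>_mono[OF card_mono[OF F]] by simp
  then have "t * \<phi> (card E) \<le> 4 * C^2 * (1 + C) * norm f" using t by (simp add: field_simps)
  moreover have "0 < 4 * C^2 * (1 + C)" using C_ge1 by simp
  ultimately have "t * \<phi> (card E) / (4 * C^2 * (1 + C)) \<le> norm f"
    by (simp only: pos_divide_le_eq mult.commute[of "norm f"])
  then show ?thesis by (simp add: c_def)
qed

lemma xs_bound: "norm (xs n f) \<le> norm f / (c * \<phi> 1)"
proof (cases "xs n f = 0")
  case False
  then have "c * (norm (xs n f) * \<phi> (card {n})) \<le> norm f" by (intro level_lower) auto
  then show ?thesis using c_pos \<phi>_pos[of 1] by (simp add: field_simps)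
qed (use c_pos \<phi>_pos[of 1] in simp)

sublocale primal: chain_space "\<lambda>f n. norm (xs n f)" P \<phi> "1 + C" c
proof
  fix I :: "nat set" and A :: "nat \<Rightarrow> nat set" and \<mu> f n
  assume "finite I" and fin: "\<And>i. i \<in> I \<Longrightarrow> finite (A i)"
  have "xs n (\<Sum>i\<in>I. \<mu> i *\<^sub>R P (A i) f) = (\<Sum>i\<in>I. (if n \<in> A i then \<mu> i else 0) *\<^sub>R xs n f)"
    unfolding xs_sum by (rule sum.cong) (auto simp: xs_scaleR xs_P fin)
  also have "\<dots> = (\<Sum>i\<in>I. if n \<in> A i then \<mu> i else 0) *\<^sub>R xs n f" by (rule scaleR_sum_left[symmetric])
  finally show "norm (xs n (\<Sum>i\<in>I. \<mu> i *\<^sub>R P (A i) f)) = \<bar>\<Sum>i\<in>I. if n \<in> A i then \<mu> i else 0\<bar> * norm (xs n f)"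
    by simp
qed (use C_ge1 norm_P_level c_pos level_lower finite_level superreflexive_hulls_close[OF sr] in auto)


section \<open>Regularity of the fundamental function\<close>

text \<open>A slight perturbation of a constant sequence is a chain.\<close>

lemma ex_lower_regular: "\<exists>L\<ge>1. \<forall>n. 2 * \<phi> n \<le> \<phi> (L * n)"
proof -
  obtain m :: nat where m: "2 \<le> m" and gr: "\<And>i. primal.growth (m ^ i) (2 ^ i * c)"
    using primal.growth_power by blast
  \<comment> \<open>A gain of 4, since a factor of 2 will be lost to the perturbation.\<close>
  obtain i where "4 / c < 2 ^ i" using real_arch_pow[of 2 "4 / c"] by auto
  then have i: "4 \<le> 2 ^ i * c" using c_pos by (simp add: field_simps)
  define L where "L = m ^ i"
  have L: "1 \<le> L" using m by (simp add: L_def)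
  obtain B where B: "0 < B" "\<And>n. norm (x n) \<le> B" using ex_bound_x by blast
  have "2 * \<phi> n \<le> \<phi> (L * n)" for n
  proof (cases "n = 0")
    case False
    \<comment> \<open>Chosen so that the \<open>L * n\<close> perturbed coefficients, each off by at
      most \<open>\<eta> * L\<close>, change the norm by at most \<open>\<phi> 1\<close>.\<close>
    define \<eta> where "\<eta> = \<phi> 1 / (real L * real (L * n) * B)"
    have \<eta>: "0 < \<eta>" using False L B(1) \<phi>_pos[of 1] by (simp add: \<eta>_def)
    define t where "t l = 1 + \<eta> * (real L + 1 - real l)" for l
    define E where "E l = {l * n..<l * n + n}" for l
    define f where "f = (\<Sum>j<L * n. smul (of_real (t (Suc (j div n)))) (x j))"
    have t1: "1 \<le> t (Suc l)" if "l < L" for l using that \<eta> by (simp add: t_def)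
    have xs_f: "xs j f = (if j < L * n then of_real (t (Suc (j div n))) else 0)" for j
      unfolding f_def by (subst xs_comb) auto
    have "primal.chain f L (\<phi> n) t E"
      unfolding primal.chain_def
    proof (intro allI impI conjI)
      fix l assume l: "l < L"
      show "0 < t (Suc l)" using t1[OF l] by simp
      show "t (Suc l) < t l" using \<eta> by (simp add: t_def)
      show "finite (E l)" by (simp add: E_def)
      show "\<phi> n \<le> t (Suc l) * \<phi> (card (E l))"
        using mult_right_mono[OF t1[OF l] \<phi>_ge0[of n]] by (simp add: E_def)
      have "norm (xs j f) = t (Suc l)" if j: "j \<in> E l" for j
      proof -
        have "Suc l * n \<le> L * n" using l by (intro mult_le_mono1) simp
        then have "j < L * n" using j by (simp add: E_def)
        moreover have "j div n = l"
          using j False by (intro div_nat_eqI) (auto simp: E_def mult.commute)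
        ultimately show ?thesis using t1[OF l] by (simp add: xs_f)
      qed
      then show "\<forall>j\<in>E l. t (Suc l) \<le> norm (xs j f) \<and> norm (xs j f) < t l"
        using \<open>t (Suc l) < t l\<close> by simp
    qed
    then have 1: "\<phi> n * (2 ^ i * c) \<le> norm f"
      using gr[of i] \<phi>_pos[of n] False unfolding primal.growth_def L_def by auto
    have "f = (\<Sum>j<L * n. smul 1 (x j)) + (\<Sum>j<L * n. smul (of_real (t (Suc (j div n)) - 1)) (x j))"
      unfolding f_def sum.distrib[symmetric]
      by (intro sum.cong refl) (simp only: scale_left_distrib[symmetric], simp)
    then have "norm f \<le> norm (\<Sum>j<L * n. smul 1 (x j)) + norm (\<Sum>j<L * n. smul (of_real (t (Suc (j div n)) - 1)) (x j))"
      using norm_triangle_ineq by metis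
    also have "norm (\<Sum>j<L * n. smul 1 (x j)) \<le> \<phi> (L * n)" by (rule \<phi>_upper') auto
    also have "norm (\<Sum>j<L * n. smul (of_real (t (Suc (j div n)) - 1)) (x j)) \<le> (\<Sum>j<L * n. \<eta> * real L * B)"
    proof (rule sum_norm_le)
      fix j assume "j \<in> {..<L * n}"
      then have "j div n < L" by (simp add: less_mult_imp_div_less)
      then have "\<bar>t (Suc (j div n)) - 1\<bar> \<le> \<eta> * real L" using \<eta> by (simp add: t_def)
      then show "norm (smul (of_real (t (Suc (j div n)) - 1)) (x j)) \<le> \<eta> * real L * B"
        using B \<eta> unfolding norm_scale norm_of_real by (intro mult_mono) auto
    qed
    also have "\<dots> = \<phi> 1" using False L B(1) by (simp add: \<eta>_def)
    also have "\<phi> 1 \<le> \<phi> (L * n)" using False L by (intro \<phi>_mono) (simp add: Suc_le_eq)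
    finally have "\<phi> n * (2 ^ i * c) \<le> 2 * \<phi> (L * n)" using 1 by simp
    moreover have "\<phi> n * 4 \<le> \<phi> n * (2 ^ i * c)" using i \<phi>_ge0 by (intro mult_left_mono)
    ultimately show ?thesis by simp
  qed (simp add: \<phi>_zero)
  then show ?thesis using L by blast
qed

text \<open>For suitable signs the sum of \<open>D\<close> consecutive blocks of length
  \<open>n\<close> is small compared with \<open>D * \<phi> n\<close>, by iterating the sign bound.
  For all signs, however, its norm is at least \<open>c * \<phi> (D * n)\<close>, by the lower
  estimate. Enough iterations absorb \<open>c\<close> and give the factor 8.\<close>

lemma ex_upper_regular: "\<exists>D\<ge>1. \<forall>n. 8 * \<phi> (D * n) \<le> real D * \<phi> n"
proof -
  obtain m where sb: "sign_bound TYPE('a) m (m - 1/2)" using superreflexive_sign_bound[OF sr] by blast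
  have "(0::real) \<le> m - 1/2"
    using sb[unfolded sign_bound_def, THEN spec, of "\<lambda>_. 0"] by auto
  then have m: "1 \<le> m" by (cases m) auto
  define \<beta> where "\<beta> = real m - 1/2"
  have \<beta>: "0 < \<beta>" "\<beta> / m < 1" using m by (auto simp: \<beta>_def field_simps)
  obtain k where "(\<beta> / m) ^ k < c / 8" using real_arch_pow_inv[of "c / 8" "\<beta> / m"] c_pos \<beta> by auto
  then have k: "\<beta> ^ k \<le> c / 8 * real (m ^ k)" using m by (simp add: power_divide field_simps)
  define D where "D = m ^ k"
  have sbD: "sign_bound TYPE('a) D (\<beta> ^ k)"
    using sign_bound_power[OF sb] \<beta> by (simp add: D_def \<beta>_def)
  have "8 * \<phi> (D * n) \<le> real D * \<phi> n" for n
  proof (cases "n = 0")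
    case False
    define u where "u i = (\<Sum>j\<in>{i * n..<i * n + n}. smul 1 (x j))" for i
    have "norm (u i) \<le> \<phi> n" for i unfolding u_def by (rule \<phi>_upper') auto
    then obtain e where e: "\<forall>i. e i = 1 \<or> e i = (-1::real)" "norm (\<Sum>i<D. e i *\<^sub>R u i) \<le> \<phi> n * \<beta> ^ k"
      using sign_bound_scaled[OF sbD \<phi>_ge0] by blast
    have "(\<Sum>i<D. e i *\<^sub>R u i) = (\<Sum>i<D. \<Sum>j\<in>{i * n..<i * n + n}. smul (of_real (e (j div n))) (x j))"
      unfolding u_def scaleR_sum_right
    proof (intro sum.cong refl)
      fix i j assume "j \<in> {i * n..<i * n + n}"
      then have "j div n = i" using False by (intro div_nat_eqI) (auto simp: mult.commute)
      then show "e i *\<^sub>R smul 1 (x j) = smul (of_real (e (j div n))) (x j)"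
        by (simp add: scale_of_real)
    qed
    also have "\<dots> = (\<Sum>j<D * n. smul (of_real (e (j div n))) (x j))" by (rule sum.nat_group)
    finally have sum: "(\<Sum>i<D. e i *\<^sub>R u i) = (\<Sum>j<D * n. smul (of_real (e (j div n))) (x j))" .
    have "c * (1 * \<phi> (card {..<D * n})) \<le> norm (\<Sum>j<D * n. smul (of_real (e (j div n))) (x j))"
    proof (rule level_lower)
      fix j assume "j \<in> {..<D * n}"
      then show "1 \<le> norm (xs j (\<Sum>j<D * n. smul (of_real (e (j div n))) (x j)))"
        using e(1)[THEN spec, of "j div n"] by (subst xs_comb) auto
    qed auto
    then have "c * \<phi> (D * n) \<le> \<phi> n * \<beta> ^ k" using e(2) by (simp add: sum)
    also have "\<dots> \<le> \<phi> n * (c / 8 * D)"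
      using k \<phi>_ge0 unfolding D_def by (intro mult_left_mono)
    finally show ?thesis using c_pos by (simp add: field_simps)
  qed (simp add: \<phi>_zero)
  moreover have "1 \<le> D" using m by (simp add: D_def)
  ultimately show ?thesis by blast
qed

definition L :: nat where "L = (SOME L. 1 \<le> L \<and> (\<forall>n. 2 * \<phi> n \<le> \<phi> (L * n)))"

definition D :: nat where "D = (SOME D. 1 \<le> D \<and> (\<forall>n. 8 * \<phi> (D * n) \<le> real D * \<phi> n))"

lemma L: "1 \<le> L" "2 * \<phi> n \<le> \<phi> (L * n)"
  using someI_ex[OF ex_lower_regular] unfolding L_def by blast+

lemma D: "1 \<le> D" "8 * \<phi> (D * n) \<le> real D * \<phi> n"
  using someI_ex[OF ex_upper_regular] unfolding D_def by blast+

lemma D_ge8: "8 \<le> D"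
proof -
  have "8 * \<phi> 1 \<le> 8 * \<phi> (D * 1)" using D(1) by (intro mult_left_mono \<phi>_mono) auto
  also have "\<dots> \<le> real D * \<phi> 1" by (rule D)
  finally show ?thesis using \<phi>_pos[of 1] by simp
qed

text \<open>The two scales have to agree, since the final estimate pairs the primal with the dual one.\<close>

definition M :: nat where "M = L * D"

lemma M_ge2: "2 \<le> M"
proof -
  have "1 * 8 \<le> L * D" using L(1) D_ge8 by (rule mult_le_mono)
  then show ?thesis by (simp add: M_def)
qed

lemma \<phi>_M_lower: "2 * \<phi> n \<le> \<phi> (M * n)"
proof -
  have "L * n * 1 \<le> L * n * D" using D(1) by (intro mult_le_mono2)
  then have "\<phi> (L * n) \<le> \<phi> (M * n)" by (intro \<phi>_mono) (simp add: M_def mult_ac)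
  then show ?thesis using L(2)[of n] by simp
qed

lemma \<phi>_M_upper: "8 * \<phi> (M * n) \<le> M * \<phi> n"
proof -
  have "8 * \<phi> (M * n) \<le> real L * (8 * \<phi> (D * n))"
    using \<phi>_mult[of L "D * n"] by (simp add: M_def mult.assoc)
  also have "\<dots> \<le> real L * (real D * \<phi> n)" by (intro mult_left_mono D) simp
  finally show ?thesis by (simp add: M_def)
qed

sublocale primal: regular_chain_space "\<lambda>f n. norm (xs n f)" P \<phi> "1 + C" c M
proof
  show "2 * \<phi> (M ^ k) \<le> \<phi> (M ^ Suc k)" for k using \<phi>_M_lower[of "M ^ k"] by simp
  show "\<phi> n \<le> 2 * \<phi> n'" if "n \<le> 2 * n'" for n n'
    using \<phi>_mono[OF that] \<phi>_mult[of 2 n'] by simp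
qed (use M_ge2 \<phi>_pos[of 1] in auto)

text \<open>Strong induction from \<open>n = m div D\<close> to \<open>m\<close>. The induction
  hypothesis and the terms beyond \<open>n\<close> contribute at most \<open>m / \<phi> n\<close>
  each, and upper regularity turns \<open>2 * m / \<phi> n\<close> back into
  \<open>D * m / \<phi> m\<close>. If \<open>n = 0\<close>, the crude bound
  \<open>\<phi> m \<le> D * \<phi> 1\<close> is enough.\<close>

lemma sum_inverse_\<phi>: "1 \<le> m \<Longrightarrow> (\<Sum>k\<in>{1..m}. 1 / \<phi> k) \<le> D * m / \<phi> m"
proof (induction m rule: less_induct)
  case (less m)
  define n where "n = m div D"
  have D0: "0 < D" using D(1) by simp
  have mn: "D * n \<le> m" "m < D * n + D"
    using D0 by (auto simp: n_def) (metis add.commute dividend_less_times_div mult.commute add_0_right mult_Suc_right)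
  show ?case
  proof (cases "n = 0")
    case True
    have "(\<Sum>k\<in>{1..m}. 1 / \<phi> k) \<le> (\<Sum>k\<in>{1..m}. 1 / \<phi> 1)"
      by (intro sum_mono divide_left_mono \<phi>_mono mult_pos_pos \<phi>_pos) auto
    also have "\<dots> = m / \<phi> 1" by simp
    also have "\<dots> \<le> D * m / \<phi> m"
    proof -
      have "\<phi> m \<le> \<phi> (D * 1)" using mn True by (intro \<phi>_mono) simp
      also have "\<dots> \<le> D * \<phi> 1" by (rule \<phi>_mult)
      finally have "m * \<phi> m \<le> m * (D * \<phi> 1)" by (intro mult_left_mono) auto
      then show ?thesis using \<phi>_pos[of 1] \<phi>_pos[OF less.prems] by (simp add: field_simps)
    qed
    finally show ?thesis .
  next
    case False
    then have n1: "1 \<le> n" by simp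
    have "n * 2 \<le> D * n" using D_ge8 by simp
    then have nm: "n < m" using mn n1 by linarith
    have "(\<Sum>k\<in>{1..m}. 1 / \<phi> k) = (\<Sum>k\<in>{1..n}. 1 / \<phi> k) + (\<Sum>k\<in>{n<..m}. 1 / \<phi> k)"
      using nm by (subst sum.union_disjoint[symmetric]) (auto intro!: sum.cong)
    also have "(\<Sum>k\<in>{1..n}. 1 / \<phi> k) \<le> D * n / \<phi> n" by (rule less.IH[OF nm n1])
    also have "(\<Sum>k\<in>{n<..m}. 1 / \<phi> k) \<le> (\<Sum>k\<in>{n<..m}. 1 / \<phi> n)"
      using n1 by (intro sum_mono divide_left_mono \<phi>_mono mult_pos_pos \<phi>_pos) auto
    also have "\<dots> \<le> m / \<phi> n" using \<phi>_pos[OF n1] by (simp add: divide_right_mono)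
    also have "D * n / \<phi> n + m / \<phi> n \<le> 2 * m / \<phi> n"
    proof -
      have "real D * real n \<le> real m" using mn(1) by (metis of_nat_le_iff of_nat_mult)
      then show ?thesis using \<phi>_pos[OF n1] by (simp add: divide_right_mono flip: add_divide_distrib)
    qed
    also have "\<dots> \<le> D * m / \<phi> m"
    proof -
      have "\<phi> m \<le> \<phi> (2 * (D * n))"
      proof (rule \<phi>_mono)
        have "D * 1 \<le> D * n" using n1 by (rule mult_le_mono2)
        then show "m \<le> 2 * (D * n)" using mn by linarith
      qed
      also have "\<dots> \<le> 2 * \<phi> (D * n)" using \<phi>_mult[of 2 "D * n"] by simp
      finally have "2 * \<phi> m \<le> D * \<phi> n" using D(2)[of n] \<phi>_ge0[of "D * n"] by linarith
      then have "real m * (2 * \<phi> m) \<le> real m * (D * \<phi> n)" by (intro mult_left_mono) auto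
      then show ?thesis using \<phi>_pos[OF n1] \<phi>_pos[OF less.prems] by (simp add: field_simps)
    qed
    finally show ?thesis by simp
  qed
qed

text \<open>In decreasing order, the coefficient number \<open>k\<close> is at most
  \<open>norm f / (c * \<phi> k)\<close> by the lower estimate. The induction removes the smallest
  one.\<close>

lemma sum_coeffs_le:
  assumes "finite B" shows "(\<Sum>n\<in>B. norm (xs n f)) \<le> norm f / c * (\<Sum>k\<in>{1..card B}. 1 / \<phi> k)"
  using assms
proof (induction "card B" arbitrary: B)
  case (Suc N)
  obtain b where b: "b \<in> B" "\<And>n. n \<in> B \<Longrightarrow> norm (xs b f) \<le> norm (xs n f)"
  proof -
    have "\<exists>b\<in>B. \<forall>n\<in>B. norm (xs b f) \<le> norm (xs n f)"
      using ex_min_if_finite[of "(\<lambda>n. norm (xs n f)) ` B"] Suc by (fastforce simp: not_less)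
    then show ?thesis using that by blast
  qed
  have cB: "1 \<le> card B" "card (B - {b}) = N" using Suc b by auto
  have "(\<Sum>n\<in>B. norm (xs n f)) = norm (xs b f) + (\<Sum>n\<in>B - {b}. norm (xs n f))"
    using Suc b by (intro sum.remove) auto
  also have "(\<Sum>n\<in>B - {b}. norm (xs n f)) \<le> norm f / c * (\<Sum>k\<in>{1..N}. 1 / \<phi> k)"
    using Suc.hyps(1)[of "B - {b}"] cB Suc.prems by auto
  also have "norm (xs b f) \<le> norm f / c * (1 / \<phi> (Suc N))"
  proof (cases "xs b f = 0")
    case True
    then show ?thesis using c_pos \<phi>_ge0[of "Suc N"] by simp
  next
    case False
    then have "c * (norm (xs b f) * \<phi> (card B)) \<le> norm f"
      using Suc.prems b(2) by (intro level_lower) auto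
    then show ?thesis using c_pos \<phi>_pos[OF cB(1)] Suc.hyps(2) by (simp add: field_simps)
  qed
  finally show ?case using Suc.hyps(2)[symmetric] by (simp add: algebra_simps)
qed auto

text \<open>In terms of the dual basis: signed sums of at most \<open>m\<close> coefficient
  functionals have norm at most a constant times \<open>m / \<phi> m\<close>.\<close>

lemma bidemocracy:
  assumes "finite B" "card B \<le> m" "1 \<le> m"
  shows "(\<Sum>n\<in>B. norm (xs n f)) \<le> norm f / c * (D * m / \<phi> m)"
proof -
  have "(\<Sum>k\<in>{1..card B}. 1 / \<phi> k) \<le> (\<Sum>k\<in>{1..m}. 1 / \<phi> k)"
    using assms by (intro sum_mono2) (auto simp: \<phi>_ge0)
  also have "\<dots> \<le> D * m / \<phi> m" by (rule sum_inverse_\<phi>[OF assms(3)])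
  finally have "norm f / c * (\<Sum>k\<in>{1..card B}. 1 / \<phi> k) \<le> norm f / c * (D * m / \<phi> m)"
    using c_pos by (intro mult_left_mono) auto
  then show ?thesis using sum_coeffs_le[OF assms(1), of f] by simp
qed


section \<open>The dual basis\<close>

definition \<psi> :: "nat \<Rightarrow> real" where "\<psi> n = n / \<phi> n"

text \<open>The dual consists of real functionals, so the coefficient of \<open>g\<close> at
  \<open>x n\<close> is itself a real functional on the scalars, the restriction of \<open>g\<close>
  to the line through \<open>x n\<close>. Its norm serves as the size of the coefficient.\<close>

definition dN :: "('a \<Rightarrow>\<^sub>L real) \<Rightarrow> nat \<Rightarrow> real" where
  "dN g n = onorm (\<lambda>c. blinfun_apply g (smul c (x n)))"

definition dQ :: "nat set \<Rightarrow> ('a \<Rightarrow>\<^sub>L real) \<Rightarrow> 'a \<Rightarrow>\<^sub>L real" where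
  "dQ A g = Blinfun (\<lambda>v. blinfun_apply g (P A v))"

lemma bounded_linear_coeff: "bounded_linear (\<lambda>c. blinfun_apply g (smul c (x n)))"
proof (rule bounded_linear_intro)
  fix c c' :: 'k and r :: real
  show "blinfun_apply g (smul (c + c') (x n)) = blinfun_apply g (smul c (x n)) + blinfun_apply g (smul c' (x n))"
    by (simp add: scale_left_distrib blinfun.add_right)
  show "blinfun_apply g (smul (r *\<^sub>R c) (x n)) = r *\<^sub>R blinfun_apply g (smul c (x n))"
    by (simp add: smul_scaleR blinfun.scaleR_right)
  show "norm (blinfun_apply g (smul c (x n))) \<le> norm c * (norm g * norm (x n))"
    using norm_blinfun[of g "smul c (x n)"] by (simp add: norm_scale mult_ac)
qed

lemma dN_ge0: "0 \<le> dN g n"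
  unfolding dN_def by (rule onorm_pos_le[OF bounded_linear_coeff])

lemma coeff_le_dN: "\<bar>blinfun_apply g (smul a (x n))\<bar> \<le> norm a * dN g n"
  using onorm[OF bounded_linear_coeff[of g n], of a] by (simp add: dN_def mult.commute)

lemma bounded_linear_P: assumes "finite A" shows "bounded_linear (P A)"
proof (rule bounded_linear_intro)
  fix f g and r :: real
  show "P A (f + g) = P A f + P A g"
    by (simp add: coord_proj_def xs_add scale_left_distrib sum.distrib)
  show "P A (r *\<^sub>R f) = r *\<^sub>R P A f"
    by (simp add: coord_proj_def xs_scaleR smul_scaleR scaleR_sum_right)
  have "norm (P A f) \<le> (\<Sum>n\<in>A. norm f / (c * \<phi> 1) * norm (x n))"
    unfolding coord_proj_def by (intro sum_norm_le) (unfold norm_scale, intro mult_right_mono xs_bound norm_ge_zero)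
  also have "\<dots> = norm f * (\<Sum>n\<in>A. norm (x n) / (c * \<phi> 1))"
    by (simp add: sum_distrib_left)
  finally show "norm (P A f) \<le> norm f * (\<Sum>n\<in>A. norm (x n) / (c * \<phi> 1))" .
qed

lemma dQ_apply: "finite A \<Longrightarrow> blinfun_apply (dQ A g) v = blinfun_apply g (P A v)"
  unfolding dQ_def
  by (subst bounded_linear_Blinfun_apply)
    (auto intro: bounded_linear_compose[OF blinfun.bounded_linear_right bounded_linear_P])

lemma apply_P: "blinfun_apply g (P A v) = (\<Sum>n\<in>A. blinfun_apply g (smul (xs n v) (x n)))"
  by (simp add: coord_proj_def blinfun.sum_right)

text \<open>The factor 2 makes it enough to find a nearly norming scalar, which is then normalized
  and given the right sign.\<close>

lemma ex_sign: "\<exists>e. norm e = 1 \<and> dN g n \<le> 2 * blinfun_apply g (smul e (x n))"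
proof (cases "dN g n = 0")
  case True
  have "0 \<le> blinfun_apply g (smul 1 (x n)) \<or> 0 \<le> blinfun_apply g (smul (-1) (x n))"
    using linear by (simp add: blinfun.minus_right)
  then show ?thesis using True by (metis mult_nonneg_nonneg norm_minus_cancel norm_one zero_le_numeral)
next
  case False
  then have pos: "0 < dN g n" using dN_ge0[of g n] by simp
  have "\<exists>a. dN g n / 2 * norm a < \<bar>blinfun_apply g (smul a (x n))\<bar>"
  proof (rule ccontr)
    assume "\<not> ?thesis"
    then have "\<And>a. norm (blinfun_apply g (smul a (x n))) \<le> dN g n / 2 * norm a"
      by (simp add: not_less)
    then have "dN g n \<le> dN g n / 2" unfolding dN_def by (intro onorm_le) auto
    then show False using pos by simp
  qed
  then obtain a where a: "dN g n / 2 * norm a < \<bar>blinfun_apply g (smul a (x n))\<bar>" by blast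
  then have a0: "a \<noteq> 0" by auto
  define s where "s = sgn (blinfun_apply g (smul a (x n))) / norm a"
  have "blinfun_apply g (smul a (x n)) \<noteq> 0" using a mult_nonneg_nonneg[OF less_imp_le[OF pos] norm_ge_zero, of a] by auto
  then have "norm (s *\<^sub>R a) = 1" using a0 by (simp add: s_def abs_sgn_eq)
  moreover have "dN g n \<le> 2 * blinfun_apply g (smul (s *\<^sub>R a) (x n))"
  proof -
    have "blinfun_apply g (smul (s *\<^sub>R a) (x n)) = \<bar>blinfun_apply g (smul a (x n))\<bar> / norm a"
      by (simp add: smul_scaleR blinfun.scaleR_right s_def abs_sgn mult.commute)
    moreover have "dN g n / 2 < \<bar>blinfun_apply g (smul a (x n))\<bar> / norm a"
      using a a0 by (subst pos_less_divide_eq) auto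
    ultimately show ?thesis by linarith
  qed
  ultimately show ?thesis by blast
qed

lemma sum_dN_le: assumes "finite A" shows "(\<Sum>n\<in>A. dN g n) \<le> 2 * norm g * \<phi> (card A)"
proof -
  obtain e where e: "\<And>n. norm (e n) = 1" "\<And>n. dN g n \<le> 2 * blinfun_apply g (smul (e n) (x n))"
    using ex_sign[of g] by metis
  have "(\<Sum>n\<in>A. dN g n) \<le> (\<Sum>n\<in>A. 2 * blinfun_apply g (smul (e n) (x n)))" by (intro sum_mono e)
  also have "\<dots> = 2 * blinfun_apply g (\<Sum>n\<in>A. smul (e n) (x n))"
    by (simp add: blinfun.sum_right sum_distrib_left)
  also have "\<dots> \<le> 2 * (norm g * norm (\<Sum>n\<in>A. smul (e n) (x n)))"
    using norm_blinfun[of g "\<Sum>n\<in>A. smul (e n) (x n)"] by simp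
  also have "\<dots> \<le> 2 * (norm g * \<phi> (card A))"
    using assms e by (intro mult_left_mono \<phi>_upper) auto
  finally show ?thesis by simp
qed

lemma dual_level_lower:
  assumes "finite E" "0 < t" "\<And>n. n \<in> E \<Longrightarrow> t \<le> dN g n"
  shows "1/2 * (t * \<psi> (card E)) \<le> norm g"
proof (cases "E = {}")
  case False
  then have "1 \<le> card E" using assms(1) by (simp add: Suc_le_eq card_gt_0_iff)
  have "card E * t \<le> (\<Sum>n\<in>E. dN g n)" using sum_bounded_below[of E t "dN g"] assms(3) by simp
  also have "\<dots> \<le> 2 * norm g * \<phi> (card E)" by (rule sum_dN_le[OF assms(1)])
  finally show ?thesis using \<phi>_pos[OF \<open>1 \<le> card E\<close>] by (simp add: \<psi>_def field_simps)
qed (simp add: \<psi>_def)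

lemma \<psi>_double: "2 * \<psi> (M ^ k) \<le> \<psi> (M ^ Suc k)"
proof -
  have p: "0 < \<phi> (M ^ k)" "0 < \<phi> (M ^ Suc k)" using M_ge2 by (auto intro!: \<phi>_pos)
  have "8 * \<phi> (M ^ Suc k) \<le> M * \<phi> (M ^ k)" using \<phi>_M_upper[of "M ^ k"] by simp
  then have "2 * \<phi> (M ^ Suc k) \<le> M * \<phi> (M ^ k)" using p by linarith
  then have "real (M ^ k) * (2 * \<phi> (M ^ Suc k)) \<le> real (M ^ k) * (M * \<phi> (M ^ k))"
    by (intro mult_left_mono) auto
  then show ?thesis using p by (simp add: \<psi>_def field_simps)
qed

text \<open>Subadditivity makes \<open>\<phi> n / n\<close> decreasing up to a factor of 2: for
  \<open>n \<le> n'\<close>, \<open>n'\<close> indices are covered by \<open>n' div n + 1\<close>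
  blocks of length \<open>n\<close>. For \<open>n > n'\<close>, monotonicity of
  \<open>\<phi>\<close> is enough.\<close>

lemma \<psi>_half: assumes "n \<le> 2 * n'" shows "\<psi> n \<le> 2 * \<psi> n'"
proof (cases "n = 0")
  case False
  then have n1: "1 \<le> n" "1 \<le> n'" using assms by auto
  have "n * \<phi> n' \<le> 2 * (n' * \<phi> n)"
  proof (cases "n \<le> n'")
    case True
    have "n' \<le> (n' div n + 1) * n" using n1 by (simp add: dividend_less_div_times less_imp_le)
    then have "\<phi> n' \<le> (n' div n + 1) * \<phi> n" using \<phi>_mono \<phi>_mult[of "n' div n + 1" n] order_trans by blast
    then have "n * \<phi> n' \<le> n * ((n' div n + 1) * \<phi> n)" by (intro mult_left_mono) auto
    also have "\<dots> = real (n * (n' div n) + n) * \<phi> n" by (simp add: algebra_simps)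
    also have "\<dots> \<le> real (2 * n') * \<phi> n"
    proof (rule mult_right_mono[OF _ \<phi>_ge0])
      have "n * (n' div n) \<le> n'" by simp
      then have "n * (n' div n) + n \<le> 2 * n'" using True by linarith
      then show "real (n * (n' div n) + n) \<le> real (2 * n')" by (simp only: of_nat_le_iff)
    qed
    finally show ?thesis by simp
  next
    case False
    have "n * \<phi> n' \<le> real (2 * n') * \<phi> n"
      using assms False \<phi>_mono[of n' n] \<phi>_ge0 by (intro mult_mono) (auto simp del: of_nat_mult)
    then show ?thesis by simp
  qed
  then show ?thesis using \<phi>_pos[OF n1(1)] \<phi>_pos[OF n1(2)] by (simp add: \<psi>_def field_simps)
qed (use \<phi>_ge0 in \<open>simp add: \<psi>_def\<close>)

lemma \<psi>_power: "2 ^ k * \<psi> 1 \<le> \<psi> (M ^ k)"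
proof (induction k)
  case (Suc k)
  then show ?case using \<psi>_double[of k] by simp
qed simp

text \<open>\<open>\<psi>\<close> is unbounded by upper regularity, so the lower estimate in the
  dual limits the size of every level set.\<close>

lemma dual_finite: assumes t: "0 < t" shows "finite {n. t \<le> dN g n}"
proof (rule ccontr)
  assume inf: "infinite {n. t \<le> dN g n}"
  have \<psi>1: "0 < \<psi> 1" using \<phi>_pos[of 1] by (simp add: \<psi>_def)
  obtain k where k: "2 * norm g / (t * \<psi> 1) < 2 ^ k" using real_arch_pow[of 2] by auto
  obtain E where E: "E \<subseteq> {n. t \<le> dN g n}" "finite E" "card E = M ^ k"
    using infinite_arbitrarily_large[OF inf] by blast
  have "1/2 * (t * \<psi> (M ^ k)) \<le> norm g" using dual_level_lower[OF E(2) t, of g] E by auto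
  moreover have "t * (2 ^ k * \<psi> 1) \<le> t * \<psi> (M ^ k)" using t by (intro mult_left_mono \<psi>_power) auto
  ultimately have "t * \<psi> 1 * 2 ^ k \<le> 2 * norm g" by (simp add: mult_ac)
  then show False using k t \<psi>1 by (simp add: field_simps)
qed

text \<open>The summands bound three pieces of \<open>g (P A v)\<close>: the projection of
  \<open>v\<close> onto its own level set \<open>B\<close>, the part on \<open>A - B\<close>, and
  the part on \<open>B - A\<close>.\<close>

definition dK :: real where "dK = 1 + C + 4 / c + 2 * D / c"

text \<open>Compare the projection onto a level set \<open>A\<close> of \<open>g\<close> with the one onto a level set \<open>B\<close> of \<open>v\<close>
  that has at most as many elements; on \<open>A - B\<close> the coefficients of \<open>v\<close> are small, and on \<open>B - A\<close>
  those of \<open>g\<close>.\<close>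

lemma dual_level_bound:
  assumes t: "0 < t" shows "norm (dQ {n. t \<le> dN g n} g) \<le> dK * norm g"
proof -
  define A where "A = {n. t \<le> dN g n}"
  have fA: "finite A" unfolding A_def by (rule dual_finite[OF t])
  have dK: "0 \<le> dK" using C_ge1 c_pos by (simp add: dK_def)
  have "\<bar>blinfun_apply g (P A v)\<bar> \<le> dK * norm g * norm v" for v
  proof (cases "A = {} \<or> v = 0")
    case True
    then show ?thesis using dK by (auto simp: coord_proj_def xs_zero)
  next
    case False
    define m where "m = card A"
    have m: "1 \<le> m" using False fA by (simp add: m_def Suc_le_eq card_gt_0_iff)
    have \<phi>m: "0 < \<phi> m" by (rule \<phi>_pos[OF m])
    \<comment> \<open>With the factor 2, the lower estimate for \<open>v\<close> gives
      \<open>2 * \<phi> (card B) \<le> \<phi> m\<close>, which forces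
      \<open>card B < m\<close>.\<close>
    define \<tau> where "\<tau> = 2 * norm v / (c * \<phi> m)"
    have \<tau>: "0 < \<tau>" using False c_pos \<phi>m by (simp add: \<tau>_def)
    define B where "B = {n. \<tau> \<le> norm (xs n v)}"
    have fB: "finite B" unfolding B_def by (rule finite_level[OF \<tau>])
    have "c * (\<tau> * \<phi> (card B)) \<le> norm v" by (rule level_lower[OF \<tau> fB]) (simp add: B_def)
    then have "2 * norm v * \<phi> (card B) \<le> norm v * \<phi> m"
      using c_pos \<phi>m by (simp add: \<tau>_def field_simps)
    then have "2 * \<phi> (card B) \<le> \<phi> m" using False by simp
    then have "\<not> m \<le> card B" using \<phi>_mono[of m "card B"] \<phi>m by linarith
    then have cB: "card B \<le> m" by simp
    let ?s = "\<lambda>n. blinfun_apply g (smul (xs n v) (x n))"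
    have "(\<Sum>n\<in>A. ?s n) + (\<Sum>n\<in>B - A. ?s n) = (\<Sum>n\<in>A \<union> B. ?s n)"
      using fA fB by (subst sum.union_disjoint[symmetric]) (auto intro: sum.cong)
    also have "\<dots> = (\<Sum>n\<in>B. ?s n) + (\<Sum>n\<in>A - B. ?s n)"
      using fA fB by (subst sum.union_disjoint[symmetric]) (auto intro: sum.cong)
    finally have eq: "blinfun_apply g (P A v) = blinfun_apply g (P B v) + (\<Sum>n\<in>A - B. ?s n) - (\<Sum>n\<in>B - A. ?s n)"
      by (simp add: apply_P)
    have 1: "\<bar>blinfun_apply g (P B v)\<bar> \<le> (1 + C) * (norm g * norm v)"
    proof -
      have "\<bar>blinfun_apply g (P B v)\<bar> \<le> norm g * norm (P B v)" using norm_blinfun[of g "P B v"] by simp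
      also have "\<dots> \<le> norm g * ((1 + C) * norm v)"
        unfolding B_def by (intro mult_left_mono norm_P_level \<tau>) simp
      finally show ?thesis by (simp add: mult_ac)
    qed
    have 2: "\<bar>\<Sum>n\<in>A - B. ?s n\<bar> \<le> 4 / c * (norm g * norm v)"
    proof -
      have "\<bar>\<Sum>n\<in>A - B. ?s n\<bar> \<le> (\<Sum>n\<in>A - B. \<bar>?s n\<bar>)" by (rule sum_abs)
      also have "\<dots> \<le> (\<Sum>n\<in>A - B. \<tau> * dN g n)"
      proof (rule sum_mono)
        fix n assume "n \<in> A - B"
        then have "norm (xs n v) \<le> \<tau>" by (simp add: B_def)
        then show "\<bar>?s n\<bar> \<le> \<tau> * dN g n"
          using coeff_le_dN[of g "xs n v" n] mult_right_mono[OF _ dN_ge0] order_trans by blast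
      qed
      also have "\<dots> \<le> (\<Sum>n\<in>A. \<tau> * dN g n)"
        using fA \<tau> dN_ge0 by (intro sum_mono2) (auto simp: less_imp_le)
      also have "\<dots> \<le> \<tau> * (2 * norm g * \<phi> m)"
        unfolding sum_distrib_left[symmetric] m_def using \<tau> by (intro mult_left_mono sum_dN_le fA) auto
      also have "\<dots> = 4 / c * (norm g * norm v)" using \<phi>m c_pos by (simp add: \<tau>_def field_simps)
      finally show ?thesis .
    qed
    have 3: "\<bar>\<Sum>n\<in>B - A. ?s n\<bar> \<le> 2 * D / c * (norm g * norm v)"
    proof -
      have "\<bar>\<Sum>n\<in>B - A. ?s n\<bar> \<le> (\<Sum>n\<in>B - A. \<bar>?s n\<bar>)" by (rule sum_abs)
      also have "\<dots> \<le> (\<Sum>n\<in>B - A. norm (xs n v) * t)"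
      proof (rule sum_mono)
        fix n assume "n \<in> B - A"
        then have "dN g n \<le> t" by (simp add: A_def)
        then show "\<bar>?s n\<bar> \<le> norm (xs n v) * t"
          using coeff_le_dN[of g "xs n v" n] mult_left_mono[OF _ norm_ge_zero] order_trans by blast
      qed
      also have "\<dots> \<le> (\<Sum>n\<in>B. norm (xs n v) * t)"
        using fB t by (intro sum_mono2) auto
      also have "\<dots> = t * (\<Sum>n\<in>B. norm (xs n v))" by (simp add: sum_distrib_left mult.commute)
      also have "\<dots> \<le> t * (norm v / c * (D * m / \<phi> m))"
        using t by (intro mult_left_mono bidemocracy fB cB m) auto
      also have "\<dots> = D / c * norm v * (t * (m / \<phi> m))" by simp
      \<comment> \<open>The factor \<open>m / \<phi> m\<close> left by bidemocracy is
        \<open>\<psi> m\<close>; the lower estimate for \<open>g\<close> on its own level set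
        \<open>A\<close> absorbs it.\<close>
      also have "\<dots> \<le> D / c * norm v * (2 * norm g)"
      proof (rule mult_left_mono)
        show "t * (m / \<phi> m) \<le> 2 * norm g"
          using dual_level_lower[OF fA t, of g] by (simp add: A_def m_def \<psi>_def)
      qed (use c_pos in simp)
      finally show ?thesis by (simp add: mult_ac)
    qed
    have "\<bar>blinfun_apply g (P A v)\<bar> \<le> (1 + C) * (norm g * norm v) + 4 / c * (norm g * norm v)
        + 2 * D / c * (norm g * norm v)"
      using 1 2 3 unfolding eq by linarith
    then show ?thesis by (simp add: dK_def algebra_simps)
  qed
  then show ?thesis
    unfolding A_def[symmetric] using dK by (intro norm_blinfun_bound) (auto simp: dQ_apply[OF fA])
qed

sublocale dual: chain_space dN dQ \<psi> dK "1/2"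
proof
  fix I :: "nat set" and A :: "nat \<Rightarrow> nat set" and \<mu> :: "nat \<Rightarrow> real" and g n
  assume "finite I" and fin: "\<And>i. i \<in> I \<Longrightarrow> finite (A i)"
  define r where "r = (\<Sum>i\<in>I. if n \<in> A i then \<mu> i else 0)"
  have "blinfun_apply (\<Sum>i\<in>I. \<mu> i *\<^sub>R dQ (A i) g) (smul a (x n)) = r *\<^sub>R blinfun_apply g (smul a (x n))" for a
  proof -
    have P: "P (A i) (smul a (x n)) = (if n \<in> A i then smul a (x n) else 0)" if "i \<in> I" for i
    proof -
      have "P (A i) (smul a (x n)) = (\<Sum>j\<in>A i. if j = n then smul a (x n) else 0)"
        unfolding coord_proj_def by (intro sum.cong) (auto simp: xs_smul xs_x)
      then show ?thesis using fin[OF that] by simp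
    qed
    have "blinfun_apply (\<Sum>i\<in>I. \<mu> i *\<^sub>R dQ (A i) g) (smul a (x n))
        = (\<Sum>i\<in>I. \<mu> i * blinfun_apply g (P (A i) (smul a (x n))))"
      by (simp add: blinfun.sum_left blinfun.scaleR_left dQ_apply fin)
    also have "\<dots> = (\<Sum>i\<in>I. (if n \<in> A i then \<mu> i else 0) * blinfun_apply g (smul a (x n)))"
      by (rule sum.cong) (auto simp: P)
    finally show ?thesis by (simp add: r_def sum_distrib_right)
  qed
  then have "dN (\<Sum>i\<in>I. \<mu> i *\<^sub>R dQ (A i) g) n = onorm (\<lambda>a. r *\<^sub>R blinfun_apply g (smul a (x n)))"
    unfolding dN_def by (intro arg_cong[of _ _ onorm]) (rule ext)
  also have "\<dots> = \<bar>r\<bar> * dN g n" unfolding dN_def by (rule onorm_scaleR[OF bounded_linear_coeff])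
  finally show "dN (\<Sum>i\<in>I. \<mu> i *\<^sub>R dQ (A i) g) n = \<bar>\<Sum>i\<in>I. if n \<in> A i then \<mu> i else 0\<bar> * dN g n"
    by (simp add: r_def)
next
  show "0 < dK" using C_ge1 c_pos D(1) unfolding dK_def by (intro add_pos_pos) auto
qed (use dN_ge0 dual_finite dual_level_bound dual_level_lower superreflexive_hulls_close_dual[OF sr] in auto)

sublocale dual: regular_chain_space dN dQ \<psi> dK "1/2" M
proof
  show "0 < \<psi> 1" unfolding \<psi>_def using \<phi>_pos[of 1] by simp
qed (use M_ge2 \<psi>_double \<psi>_half in auto)

end

section \<open>Embeddings\<close>

lemma rearrangement_le_scaled:
  assumes fin: "\<And>t. 0 < t \<Longrightarrow> finite {k. t \<le> norm (g k)}"
    and s: "0 < s" and f: "\<And>k. norm (f k) = s * norm (g k)"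
  shows "rearrangement f n \<le> s * rearrangement g n"
proof -
  have "{k. s * rearrangement g n < norm (f k)} = {k. rearrangement g n < norm (g k)}"
    using s by (simp add: f)
  then show ?thesis
    using above_rearrangement[OF fin, of n] rearrangement_ge0[OF fin, of n] s
    by (intro rearrangement_le) auto
qed

lemma rearrangement_norm: "rearrangement (\<lambda>k. norm (f k)) = rearrangement f"
  by (simp add: rearrangement_def fun_eq_iff)

text \<open>A discrete form of \<open>\<Sum> a n * b n \<le> \<Sum> a\<^sup>* n * b\<^sup>* n\<close>: outside a set of at most
  \<open>2 * M ^ k\<close> indices both factors are bounded by their values at position \<open>M ^ k\<close>.\<close>

lemma sum_prod_le_rearrangements:
  fixes a b :: "nat \<Rightarrow> real" and M :: nat
  assumes M: "2 \<le> M" and F: "finite F" "\<And>n. n \<notin> F \<Longrightarrow> a n = 0"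
    and a0: "\<And>n. 0 \<le> a n" and b0: "\<And>n. 0 \<le> b n" and b: "\<And>t. 0 < t \<Longrightarrow> finite {n. t \<le> b n}"
  shows "(\<Sum>n\<in>F. a n * b n) \<le> (\<Sum>k<card F. 2 * real (M ^ Suc k) *
    (rearrangement a (M ^ k - 1) * rearrangement b (M ^ k - 1)))"
proof -
  have fa: "finite {n. t \<le> norm (a n)}" if "0 < t" for t
    by (rule finite_subset[OF _ F(1)]) (use F(2) that in force)
  have fb: "finite {n. t \<le> norm (b n)}" if "0 < t" for t
    using b[OF that] b0 by simp
  define \<alpha> where "\<alpha> k = rearrangement a (M ^ k - 1)" for k
  define \<beta> where "\<beta> k = rearrangement b (M ^ k - 1)" for k
  define S where "S k = {n. \<alpha> k < a n} \<union> {n. \<beta> k < b n}" for k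
  have lev: "finite {n. \<alpha> k < a n}" "card {n. \<alpha> k < a n} \<le> M ^ k - 1"
    "finite {n. \<beta> k < b n}" "card {n. \<beta> k < b n} \<le> M ^ k - 1" for k
    using above_rearrangement[of a, OF fa, of "M ^ k - 1"] above_rearrangement[of b, OF fb, of "M ^ k - 1"]
      a0 b0 by (simp_all add: \<alpha>_def \<beta>_def)
  have S: "finite (S k)" "card (S k) \<le> 2 * (M ^ k - 1)" for k
  proof -
    show "finite (S k)" using lev by (simp add: S_def)
    have "card (S k) \<le> card {n. \<alpha> k < a n} + card {n. \<beta> k < b n}"
      unfolding S_def by (rule card_Un_le)
    then show "card (S k) \<le> 2 * (M ^ k - 1)" using lev(2,4)[of k] by linarith
  qed
  have ge0: "0 \<le> \<alpha> k" "0 \<le> \<beta> k" for k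
    using rearrangement_ge0[of a, OF fa] rearrangement_ge0[of b, OF fb] by (auto simp: \<alpha>_def \<beta>_def)
  have main: "(\<Sum>n\<in>S K. a n * b n) \<le> (\<Sum>k<K. 2 * real (M ^ Suc k) * (\<alpha> k * \<beta> k))" for K
  proof (induction K)
    case 0
    have "S 0 = {}" using S[of 0] by simp
    then show ?case by simp
  next
    case (Suc K)
    have "(\<Sum>n\<in>S (Suc K). a n * b n) \<le> (\<Sum>n\<in>S K \<union> (S (Suc K) - S K). a n * b n)"
      using S a0 b0 by (intro sum_mono2) auto
    also have "\<dots> = (\<Sum>n\<in>S K. a n * b n) + (\<Sum>n\<in>S (Suc K) - S K. a n * b n)"
      using S by (intro sum.union_disjoint) auto
    also have "(\<Sum>n\<in>S (Suc K) - S K. a n * b n) \<le> (\<Sum>n\<in>S (Suc K) - S K. \<alpha> K * \<beta> K)"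
      using a0 b0 ge0 by (intro sum_mono mult_mono) (auto simp: S_def not_less)
    also have "\<dots> = real (card (S (Suc K) - S K)) * (\<alpha> K * \<beta> K)" by simp
    also have "\<dots> \<le> (2 * real (M ^ Suc K)) * (\<alpha> K * \<beta> K)"
    proof (rule mult_right_mono)
      have "card (S (Suc K) - S K) \<le> card (S (Suc K))" using S by (intro card_mono) auto
      also have "\<dots> \<le> 2 * M ^ Suc K" using S(2)[of "Suc K"] by linarith
      finally have "real (card (S (Suc K) - S K)) \<le> real (2 * M ^ Suc K)" by (simp only: of_nat_le_iff)
      then show "real (card (S (Suc K) - S K)) \<le> 2 * real (M ^ Suc K)" by simp
    qed (use ge0 in simp)
    finally show ?case using Suc by simp
  qed
  \<comment> \<open>The support of \<open>a\<close> has fewer than \<open>M ^ card F\<close>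
    elements, so the rearrangement vanishes there and \<open>S (card F)\<close> contains the whole
    support.\<close>
  have "\<alpha> (card F) \<le> 0"
    unfolding \<alpha>_def
  proof (rule rearrangement_le)
    have sub: "{k. 0 < norm (a k)} \<subseteq> F" using F(2) by force
    then show "finite {k. 0 < norm (a k)}" using F(1) finite_subset by blast
    have "card {k. 0 < norm (a k)} \<le> card F" by (rule card_mono[OF F(1) sub])
    also have "card F < M ^ card F"
      using M less_exp[of "card F"] power_mono[of 2 M "card F"] by linarith
    finally show "card {k. 0 < norm (a k)} \<le> M ^ card F - 1" by linarith
  qed simp
  then have "n \<in> S (card F)" if "a n \<noteq> 0" for n
    using that a0[of n] by (simp add: S_def)
  then have "(\<Sum>n\<in>F. a n * b n) = (\<Sum>n\<in>F \<inter> S (card F). a n * b n)"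
    using F(1) by (intro sum.mono_neutral_right) auto
  also have "\<dots> \<le> (\<Sum>n\<in>S (card F). a n * b n)"
    using S a0 b0 by (intro sum_mono2) auto
  finally show ?thesis using main[of "card F"] by (simp add: \<alpha>_def \<beta>_def)
qed

section \<open>Lorentz quasi-norms as sums over blocks, and the embeddings\<close>

locale ag_basis_weight = ag_basis smul x xs
  for smul :: "'k::{real_normed_field,euclidean_space} \<Rightarrow> 'a::banach \<Rightarrow> 'a" and x xs +
  fixes w :: "nat \<Rightarrow> real"
  assumes w: "\<forall>m\<ge>1. primitive w m = fundamental_fun smul x m"
begin

lemma primitive_w: "primitive w m = \<phi> m"
  using w \<phi>_zero by (cases "m = 0") (auto simp: primitive_def)

lemma w_eq: "w n = \<phi> (Suc n) - \<phi> n"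
  using primitive_w[of n] primitive_w[of "Suc n"] by (simp add: primitive_def)

lemma w_ge0: "0 \<le> w n"
  using \<phi>_mono[of n "Suc n"] by (simp add: w_eq)

lemma sum_w: "m \<le> n \<Longrightarrow> (\<Sum>j\<in>{m..<n}. w j) = \<phi> n - \<phi> m"
  unfolding w_eq by (rule sum_Suc_diff')

definition lorentz_term :: "real \<Rightarrow> (nat \<Rightarrow> 'k) \<Rightarrow> nat \<Rightarrow> real" where
  "lorentz_term q a n = (rearrangement a n * \<phi> (Suc n)) powr q * (w n / \<phi> (Suc n))"

lemma lorentz_iff: "a \<in> lorentz_space q w \<longleftrightarrow> a \<in> c0 \<and> summable (lorentz_term q a)"
  by (simp add: lorentz_space_def primitive_w lorentz_term_def[abs_def])

lemma term_ge0: "0 \<le> lorentz_term q a n"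
  using w_ge0 \<phi>_ge0 by (simp add: lorentz_term_def)

lemma \<phi>_M_pos: "0 < \<phi> (M ^ k)"
  using M_ge2 by (intro \<phi>_pos) simp

lemma \<phi>_M_le: "\<phi> (M ^ Suc k) \<le> M * \<phi> (M ^ k)"
  using \<phi>_mult[of M "M ^ k"] by simp

text \<open>On the block from \<open>M ^ K - 1\<close> to \<open>M ^ Suc K - 2\<close> the
  rearrangement is at most its first value, \<open>\<phi> (Suc n)\<close> lies between
  \<open>\<phi> (M ^ K)\<close> and \<open>M\<close> times it, and the weights add up to at most
  \<open>M * \<phi> (M ^ K)\<close>. The shift by 1 comes from counting indices from 0.\<close>

lemma term_blocks_le:
  assumes fin: "\<And>t. 0 < t \<Longrightarrow> finite {k. t \<le> norm (a k)}" and q: "1 \<le> q"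
  shows "(\<Sum>n<M ^ K - 1. lorentz_term q a n) \<le>
    M powr q * M * (\<Sum>k<K. (rearrangement a (M ^ k - 1) * \<phi> (M ^ k)) powr q)"
proof (induction K)
  case (Suc K)
  define \<alpha> where "\<alpha> = rearrangement a (M ^ K - 1)"
  have \<alpha>: "0 \<le> \<alpha>" unfolding \<alpha>_def by (rule rearrangement_ge0[OF fin])
  have M1: "1 \<le> M ^ K" using M_ge2 by simp
  have le: "M ^ K - 1 \<le> M ^ Suc K - 1" using M_ge2 by (intro diff_le_mono) simp
  have "(\<Sum>n\<in>{M ^ K - 1..<M ^ Suc K - 1}. lorentz_term q a n)
    \<le> (\<Sum>n\<in>{M ^ K - 1..<M ^ Suc K - 1}. (M * (\<alpha> * \<phi> (M ^ K))) powr q * (w n / \<phi> (M ^ K)))"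
  proof (rule sum_mono)
    fix n assume n: "n \<in> {M ^ K - 1..<M ^ Suc K - 1}"
    have r: "rearrangement a n \<le> \<alpha>" "0 \<le> rearrangement a n"
      using n rearrangement_antimono[OF fin, of "M ^ K - 1" n] rearrangement_ge0[OF fin, of n]
      by (auto simp: \<alpha>_def)
    have "\<phi> (Suc n) \<le> \<phi> (M ^ Suc K)" using n by (intro \<phi>_mono) (simp add: less_diff_conv)
    also have "\<dots> \<le> M * \<phi> (M ^ K)" by (rule \<phi>_M_le)
    finally have "rearrangement a n * \<phi> (Suc n) \<le> \<alpha> * (M * \<phi> (M ^ K))"
      using r \<phi>_ge0 \<alpha> by (intro mult_mono) auto
    then have 1: "rearrangement a n * \<phi> (Suc n) \<le> M * (\<alpha> * \<phi> (M ^ K))" by (simp add: mult_ac)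
    have "\<phi> (M ^ K) \<le> \<phi> (Suc n)" using n M1 by (intro \<phi>_mono) auto
    then have 2: "w n / \<phi> (Suc n) \<le> w n / \<phi> (M ^ K)"
      using w_ge0 \<phi>_M_pos by (intro divide_left_mono mult_pos_pos) (auto intro: \<phi>_pos)
    show "lorentz_term q a n \<le> (M * (\<alpha> * \<phi> (M ^ K))) powr q * (w n / \<phi> (M ^ K))"
      unfolding lorentz_term_def using r q w_ge0 \<phi>_ge0
      by (intro mult_mono[OF powr_mono2[OF _ _ 1] 2]) auto
  qed
  also have "\<dots> = (M * (\<alpha> * \<phi> (M ^ K))) powr q * ((\<phi> (M ^ Suc K - 1) - \<phi> (M ^ K - 1)) / \<phi> (M ^ K))"
    by (simp only: sum_w[OF le, symmetric] sum_distrib_left sum_divide_distrib)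
  also have "\<dots> \<le> (M * (\<alpha> * \<phi> (M ^ K))) powr q * M"
  proof (intro mult_left_mono)
    have "\<phi> (M ^ Suc K - 1) \<le> \<phi> (M ^ Suc K)" by (intro \<phi>_mono) simp
    then have "\<phi> (M ^ Suc K - 1) - \<phi> (M ^ K - 1) \<le> M * \<phi> (M ^ K)"
      using \<phi>_M_le[of K] \<phi>_ge0[of "M ^ K - 1"] by linarith
    then show "(\<phi> (M ^ Suc K - 1) - \<phi> (M ^ K - 1)) / \<phi> (M ^ K) \<le> M"
      using \<phi>_M_pos[of K] by (simp add: pos_divide_le_eq del: power_Suc)
  qed simp
  also have "\<dots> = M powr q * M * (\<alpha> * \<phi> (M ^ K)) powr q"
    using \<alpha> \<phi>_ge0 by (simp add: powr_mult)
  finally have "(\<Sum>n\<in>{M ^ K - 1..<M ^ Suc K - 1}. lorentz_term q a n) \<le> M powr q * M * (\<alpha> * \<phi> (M ^ K)) powr q" .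
  moreover have "(\<Sum>n<M ^ Suc K - 1. lorentz_term q a n) =
    (\<Sum>n<M ^ K - 1. lorentz_term q a n) + (\<Sum>n\<in>{M ^ K - 1..<M ^ Suc K - 1}. lorentz_term q a n)"
    using sum.atLeastLessThan_concat[OF _ le, of 0 "lorentz_term q a"] by (simp add: lessThan_atLeast0)
  ultimately show ?case using Suc by (simp add: distrib_left \<alpha>_def)
qed simp

text \<open>The block value at \<open>M ^ Suc K\<close> is dominated by the terms before it, with
  indices from \<open>M ^ K\<close> on, where the rearrangement is at least as large. By lower
  regularity their weights carry at least half of \<open>\<phi> (M ^ Suc K)\<close>. The first value
  is the term of index 0.\<close>

lemma blocks_le_term:
  assumes fin: "\<And>t. 0 < t \<Longrightarrow> finite {k. t \<le> norm (a k)}" and q: "1 \<le> q"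
  shows "(\<Sum>k<Suc K. (rearrangement a (M ^ k - 1) * \<phi> (M ^ k)) powr q) \<le>
    2 * M powr q * (\<Sum>n<M ^ K. lorentz_term q a n)"
proof (induction K)
  case 0
  have w0: "w 0 = \<phi> 1" by (simp add: w_eq \<phi>_zero)
  have "1 powr q \<le> M powr q" using M_ge2 q by (intro powr_mono2) auto
  then have "1 * (rearrangement a 0 * \<phi> 1) powr q \<le> (2 * M powr q) * (rearrangement a 0 * \<phi> 1) powr q"
    by (intro mult_right_mono) auto
  then show ?case using w0 \<phi>_pos[of 1] by (simp add: lorentz_term_def)
next
  case (Suc K)
  define \<alpha> where "\<alpha> = rearrangement a (M ^ Suc K - 1)"
  have \<alpha>: "0 \<le> \<alpha>" unfolding \<alpha>_def by (rule rearrangement_ge0[OF fin])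
  have le: "M ^ K \<le> M ^ Suc K" using M_ge2 by simp
  have "(\<alpha> * \<phi> (M ^ Suc K)) powr q \<le> (M * (\<alpha> * \<phi> (M ^ K))) powr q"
    using \<alpha> q \<phi>_ge0 mult_left_mono[OF \<phi>_M_le \<alpha>, of K] by (intro powr_mono2) (auto simp: mult_ac simp del: power_Suc)
  also have "\<dots> = M powr q * (\<alpha> * \<phi> (M ^ K)) powr q" using \<alpha> \<phi>_ge0 by (simp add: powr_mult)
  also have "\<dots> \<le> 2 * M powr q * ((\<alpha> * \<phi> (M ^ K)) powr q * ((\<phi> (M ^ Suc K) - \<phi> (M ^ K)) / \<phi> (M ^ Suc K)))"
  proof -
    have "2 * \<phi> (M ^ K) \<le> \<phi> (M ^ Suc K)" using \<phi>_M_lower[of "M ^ K"] by simp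
    then have "1/2 \<le> (\<phi> (M ^ Suc K) - \<phi> (M ^ K)) / \<phi> (M ^ Suc K)"
      using \<phi>_M_pos[of "Suc K"] by (simp add: pos_le_divide_eq del: power_Suc)
    then have "(\<alpha> * \<phi> (M ^ K)) powr q * (1/2) \<le> (\<alpha> * \<phi> (M ^ K)) powr q * ((\<phi> (M ^ Suc K) - \<phi> (M ^ K)) / \<phi> (M ^ Suc K))"
      by (rule mult_left_mono) simp
    from mult_left_mono[OF this, of "2 * M powr q"] show ?thesis by simp
  qed
  finally have 0: "(\<alpha> * \<phi> (M ^ Suc K)) powr q \<le>
    2 * M powr q * ((\<alpha> * \<phi> (M ^ K)) powr q * ((\<phi> (M ^ Suc K) - \<phi> (M ^ K)) / \<phi> (M ^ Suc K)))" .
  have "(\<alpha> * \<phi> (M ^ K)) powr q * ((\<phi> (M ^ Suc K) - \<phi> (M ^ K)) / \<phi> (M ^ Suc K)) =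
    (\<Sum>n\<in>{M ^ K..<M ^ Suc K}. (\<alpha> * \<phi> (M ^ K)) powr q * (w n / \<phi> (M ^ Suc K)))"
    by (simp only: sum_w[OF le, symmetric] sum_distrib_left sum_divide_distrib)
  also have "\<dots> \<le> (\<Sum>n\<in>{M ^ K..<M ^ Suc K}. lorentz_term q a n)"
  proof (rule sum_mono)
    fix n assume n: "n \<in> {M ^ K..<M ^ Suc K}"
    have r: "\<alpha> \<le> rearrangement a n"
      unfolding \<alpha>_def using n by (intro rearrangement_antimono[OF fin]) auto
    have 1: "\<phi> (M ^ K) \<le> \<phi> (Suc n)" using n by (intro \<phi>_mono) auto
    have "\<phi> (Suc n) \<le> \<phi> (M ^ Suc K)" using n by (intro \<phi>_mono) auto
    then have 2: "w n / \<phi> (M ^ Suc K) \<le> w n / \<phi> (Suc n)"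
      using w_ge0 \<phi>_M_pos[of "Suc K"] by (intro divide_left_mono mult_pos_pos) (auto intro: \<phi>_pos)
    show "(\<alpha> * \<phi> (M ^ K)) powr q * (w n / \<phi> (M ^ Suc K)) \<le> lorentz_term q a n"
      unfolding lorentz_term_def using 1 2 r \<alpha> q w_ge0 \<phi>_ge0 \<phi>_M_pos[of "Suc K"]
      by (intro mult_mono powr_mono2) (auto simp del: power_Suc)
  qed
  finally have *: "(\<alpha> * \<phi> (M ^ Suc K)) powr q \<le> 2 * M powr q * (\<Sum>n\<in>{M ^ K..<M ^ Suc K}. lorentz_term q a n)"
    using 0 mult_left_mono[of _ _ "2 * M powr q"] by (meson order_trans powr_ge_zero mult_nonneg_nonneg zero_le_numeral)
  have "(\<Sum>n<M ^ Suc K. lorentz_term q a n) = (\<Sum>n<M ^ K. lorentz_term q a n) + (\<Sum>n\<in>{M ^ K..<M ^ Suc K}. lorentz_term q a n)"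
    using sum.atLeastLessThan_concat[OF _ le, of 0 "lorentz_term q a"] by (simp add: lessThan_atLeast0)
  then show ?case using Suc * unfolding \<alpha>_def by (simp add: distrib_left del: power_Suc)
qed

lemma space_embeds:
  "\<exists>r0. \<forall>r\<ge>r0. space_embeds_in_seq xs (lorentz_space r w)"
proof -
  obtain r0 where r0: "\<forall>r\<ge>r0. \<exists>B. \<forall>f. norm f \<le> c \<longrightarrow>
      (\<forall>n. (\<Sum>k<n. (primal.decr f k * \<phi> (M ^ k)) powr r) \<le> B)"
    using primal.decr_summable by blast
  have "coeff_transform xs f \<in> lorentz_space r w" if r: "max r0 1 \<le> r" for r f
  proof -
    define a where "a = (\<lambda>n. xs n f)"
    have fin: "finite {k. t \<le> norm (a k)}" if "0 < t" for t
      unfolding a_def by (rule finite_level[OF that])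
    obtain B where B: "\<And>f n. norm f \<le> c \<Longrightarrow> (\<Sum>k<n. (primal.decr f k * \<phi> (M ^ k)) powr r) \<le> B"
    proof -
      have "r0 \<le> r" using r by simp
      then show ?thesis using r0 that by blast
    qed
    \<comment> \<open>Scales \<open>f\<close> into the ball for which the summability estimate is
      stated; adding 1 keeps \<open>s\<close> positive when \<open>f = 0\<close>.\<close>
    define s where "s = (norm f + 1) / c"
    have s: "0 < s" using c_pos by (simp add: s_def add_nonneg_pos)
    have fs: "norm ((1 / s) *\<^sub>R f) \<le> c"
    proof -
      have "norm ((1 / s) *\<^sub>R f) = norm f / s" using s by simp
      also have "\<dots> \<le> (norm f + 1) / s" using s by (intro divide_right_mono) auto
      also have "\<dots> = c" using c_pos add_nonneg_pos[OF norm_ge_zero[of f] zero_less_one] by (simp add: s_def)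
      finally show ?thesis .
    qed
    have decr: "rearrangement a (M ^ k - 1) \<le> s * primal.decr ((1 / s) *\<^sub>R f) k" for k
      unfolding primal.decr_def
    proof (rule rearrangement_le_scaled[OF _ s])
      fix t :: real assume "0 < t"
      then show "finite {k. t \<le> norm (norm (xs k ((1 / s) *\<^sub>R f)))}" using finite_level by simp
    next
      fix j show "norm (a j) = s * norm (norm (xs j ((1 / s) *\<^sub>R f)))"
        using s by (simp add: a_def xs_scaleR)
    qed
    have "(\<Sum>n<N. lorentz_term r a n) \<le> M powr r * M * (s powr r * B)" for N
    proof -
      have "N < M ^ N" using M_ge2 less_exp[of N] power_mono[of 2 M N] by linarith
      then have "(\<Sum>n<N. lorentz_term r a n) \<le> (\<Sum>n<M ^ N - 1. lorentz_term r a n)"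
        by (intro sum_mono2 term_ge0) auto
      also have "\<dots> \<le> M powr r * M * (\<Sum>k<N. (rearrangement a (M ^ k - 1) * \<phi> (M ^ k)) powr r)"
        using r by (intro term_blocks_le fin) auto
      also have "(\<Sum>k<N. (rearrangement a (M ^ k - 1) * \<phi> (M ^ k)) powr r)
        \<le> (\<Sum>k<N. s powr r * (primal.decr ((1 / s) *\<^sub>R f) k * \<phi> (M ^ k)) powr r)"
      proof (rule sum_mono)
        fix k
        have "(rearrangement a (M ^ k - 1) * \<phi> (M ^ k)) powr r
          \<le> (s * primal.decr ((1 / s) *\<^sub>R f) k * \<phi> (M ^ k)) powr r"
          using r decr[of k] rearrangement_ge0[OF fin] \<phi>_ge0 by (intro powr_mono2 mult_right_mono) auto
        then show "(rearrangement a (M ^ k - 1) * \<phi> (M ^ k)) powr r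
          \<le> s powr r * (primal.decr ((1 / s) *\<^sub>R f) k * \<phi> (M ^ k)) powr r"
          using s primal.decr_ge0 \<phi>_ge0 by (simp add: mult.assoc powr_mult)
      qed
      also have "\<dots> = s powr r * (\<Sum>k<N. (primal.decr ((1 / s) *\<^sub>R f) k * \<phi> (M ^ k)) powr r)"
        by (rule sum_distrib_left[symmetric])
      also have "\<dots> \<le> s powr r * B" by (intro mult_left_mono B fs) simp
      finally show ?thesis by (simp add: mult_left_mono)
    qed
    then have "summable (lorentz_term r a)" by (intro summableI_nonneg_bounded term_ge0)
    then show ?thesis using c0_xs by (simp add: lorentz_iff coeff_transform_def a_def)
  qed
  then show ?thesis by (intro exI[of _ "max r0 1"]) (auto simp: space_embeds_in_seq_def)
qed

text \<open>Duality: pair the sum with a norming functional, pass to rearrangements in blocks, and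
  split each block product by Young's inequality into a primal and a dual power. Dividing by
  \<open>\<delta>\<close> first makes the primal sum at most 1, so that \<open>\<delta>\<close>
  comes out as a linear factor.\<close>

lemma norm_sum_le:
  fixes a :: "nat \<Rightarrow> 'k" and q r \<delta> B :: real
  assumes qr: "1 < q" "1 < r" "1 / q + 1 / r = 1" and \<delta>: "0 < \<delta>" and F: "finite F"
    and B: "\<And>g n. norm g \<le> 1/2 \<Longrightarrow> (\<Sum>k<n. (dual.decr g k * \<psi> (M ^ k)) powr r) \<le> B"
    and a: "\<And>n. (\<Sum>k<n. (rearrangement (\<lambda>n. if n \<in> F then a n else 0) (M ^ k - 1) * \<phi> (M ^ k)) powr q) \<le> \<delta> powr q"
  shows "norm (\<Sum>n\<in>F. smul (a n) (x n)) \<le> 4 * M * \<delta> * (1 + B)"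
proof -
  define a' where "a' n = (if n \<in> F then norm (a n) else 0)" for n
  define \<alpha> where "\<alpha> k = rearrangement a' (M ^ k - 1)" for k
  have \<alpha>_eq: "\<alpha> k = rearrangement (\<lambda>n. if n \<in> F then a n else 0) (M ^ k - 1)" for k
    unfolding \<alpha>_def rearrangement_norm[of "\<lambda>n. if n \<in> F then a n else 0", symmetric]
    by (rule arg_cong[of _ _ "\<lambda>f. rearrangement f _"]) (auto simp: a'_def fun_eq_iff)
  obtain g0 :: "'a \<Rightarrow>\<^sub>L real" where g0: "norm g0 \<le> 1"
    "blinfun_apply g0 (\<Sum>n\<in>F. smul (a n) (x n)) = norm (\<Sum>n\<in>F. smul (a n) (x n))"
    by (rule norming_functional)
  \<comment> \<open>The dual summability estimate is stated for functionals of norm at most 1/2, the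
    lower constant of the dual chain space.\<close>
  define g where "g = (1/2) *\<^sub>R g0"
  have g: "norm g \<le> 1/2" using g0(1) by (simp add: g_def)
  define X where "X k = \<alpha> k * \<phi> (M ^ k)" for k
  define Y where "Y k = dual.decr g k * \<psi> (M ^ k)" for k
  have fin': "finite {n. t \<le> norm (a' n)}" if "0 < t" for t
    by (rule finite_subset[OF _ F]) (use that in \<open>auto simp: a'_def split: if_splits\<close>)
  have X0: "0 \<le> X k" and Y0: "0 \<le> Y k" for k
    using rearrangement_ge0[of a', OF fin'] \<phi>_ge0 dual.decr_ge0 \<psi>_def[of "M ^ k"]
    by (auto simp: X_def Y_def \<alpha>_def)
  have "norm (\<Sum>n\<in>F. smul (a n) (x n)) = 2 * blinfun_apply g (\<Sum>n\<in>F. smul (a n) (x n))"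
    using g0(2) by (simp add: g_def blinfun.scaleR_left)
  also have "blinfun_apply g (\<Sum>n\<in>F. smul (a n) (x n)) = (\<Sum>n\<in>F. blinfun_apply g (smul (a n) (x n)))"
    by (rule blinfun.sum_right)
  also have "\<dots> \<le> (\<Sum>n\<in>F. a' n * dN g n)"
    using coeff_le_dN[of g] by (intro sum_mono) (auto simp: a'_def intro: order_trans[OF abs_ge_self])
  also have "\<dots> \<le> (\<Sum>k<card F. 2 * real (M ^ Suc k) * (\<alpha> k * dual.decr g k))"
    unfolding \<alpha>_def dual.decr_def
    using sum_prod_le_rearrangements[OF M_ge2 F, of a' "dN g"] dN_ge0 dual_finite
    by (auto simp: a'_def)
  also have "\<dots> = (\<Sum>k<card F. 2 * M * \<delta> * (X k / \<delta> * Y k))"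
  proof (rule sum.cong[OF refl])
    fix k
    \<comment> \<open>The block length is exactly the product of the two fundamental scales. This is
      why primal and dual use the same \<open>M\<close>.\<close>
    have "\<phi> (M ^ k) * \<psi> (M ^ k) = M ^ k" using \<phi>_M_pos[of k] by (simp add: \<psi>_def)
    moreover have "X k * Y k = (\<phi> (M ^ k) * \<psi> (M ^ k)) * (\<alpha> k * dual.decr g k)"
      unfolding X_def Y_def by (simp only: mult_ac)
    ultimately have "X k * Y k = real (M ^ k) * (\<alpha> k * dual.decr g k)" by simp
    then show "2 * real (M ^ Suc k) * (\<alpha> k * dual.decr g k) = 2 * M * \<delta> * (X k / \<delta> * Y k)"
      using \<delta> by simp
  qed
  also have "\<dots> \<le> (\<Sum>k<card F. 2 * M * \<delta> * ((X k / \<delta>) powr q + Y k powr r))"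
  proof (intro sum_mono mult_left_mono)
    fix k
    have "X k / \<delta> * Y k \<le> (X k / \<delta>) powr q / q + Y k powr r / r"
      using qr X0 Y0 \<delta> by (intro Youngs_inequality) auto
    also have "\<dots> \<le> (X k / \<delta>) powr q + Y k powr r"
      using qr by (intro add_mono) (auto simp: divide_le_eq mult_le_cancel_left1)
    finally show "X k / \<delta> * Y k \<le> (X k / \<delta>) powr q + Y k powr r" .
  qed (use \<delta> in auto)
  also have "\<dots> = 2 * M * \<delta> * ((\<Sum>k<card F. (X k / \<delta>) powr q) + (\<Sum>k<card F. Y k powr r))"
    by (simp add: sum_distrib_left distrib_left sum.distrib)
  also have "\<dots> \<le> 2 * M * \<delta> * (1 + B)"
  proof (intro mult_left_mono add_mono)
    have "(\<Sum>k<card F. (X k / \<delta>) powr q) = (\<Sum>k<card F. X k powr q) / \<delta> powr q"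
      using X0 \<delta> by (simp add: powr_divide sum_divide_distrib)
    also have "\<dots> \<le> 1" using a[of "card F"] \<delta> unfolding X_def \<alpha>_eq by (simp add: divide_le_eq)
    finally show "(\<Sum>k<card F. (X k / \<delta>) powr q) \<le> 1" .
    show "(\<Sum>k<card F. Y k powr r) \<le> B" unfolding Y_def by (rule B[OF g])
  qed (use \<delta> in auto)
  finally show ?thesis by simp
qed

text \<open>Dominated convergence: the rearrangement of a tail of \<open>a\<close> is at most that of \<open>a\<close> and at
  most the supremum of the tail.\<close>

lemma tails_small:
  assumes a: "a \<in> lorentz_space q w" and q: "1 \<le> q" and "0 < \<epsilon>"
  shows "\<exists>N. \<forall>F N'. F \<subseteq> {N..} \<longrightarrow> (\<Sum>n<N'. lorentz_term q (\<lambda>n. if n \<in> F then a n else 0) n) \<le> \<epsilon>"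
proof -
  have c0: "a \<in> c0" and sm: "summable (lorentz_term q a)" using a by (auto simp: lorentz_iff)
  have fin: "finite {k. t \<le> norm (a k)}" if "0 < t" for t by (rule c0_finite[OF c0 that])
  obtain J where J: "norm (\<Sum>n. lorentz_term q a (n + J)) < \<epsilon> / 2"
    using suminf_exist_split[OF _ sm, of "\<epsilon> / 2"] \<open>0 < \<epsilon>\<close> by auto
  define S where "S = (\<Sum>n<J. \<phi> (Suc n) powr q * (w n / \<phi> (Suc n)))"
  have S: "0 \<le> S" unfolding S_def using w_ge0 \<phi>_ge0 by (intro sum_nonneg) auto
  \<comment> \<open>With coefficients below \<open>\<eta>\<close>, the first \<open>J\<close> terms
    contribute at most \<open>\<epsilon> / 2\<close>; the other half is reserved for the remainder
    of the convergent series of \<open>a\<close>.\<close>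
  define \<eta> where "\<eta> = (\<epsilon> / (2 * (S + 1))) powr (1 / q)"
  have \<eta>: "0 < \<eta>" using S \<open>0 < \<epsilon>\<close> by (simp add: \<eta>_def)
  have "\<eta> powr q = \<epsilon> / (2 * (S + 1))" using q S \<open>0 < \<epsilon>\<close> by (simp add: \<eta>_def powr_powr)
  then have "\<eta> powr q * (S + 1) = \<epsilon> / 2" using S by (simp add: field_simps)
  then have \<eta>S: "\<eta> powr q * S \<le> \<epsilon> / 2" by (simp add: distrib_left) (smt (verit) powr_ge_zero)
  have "eventually (\<lambda>n. norm (a n) < \<eta>) sequentially"
    using c0 \<eta> order_tendstoD(2)[OF tendsto_norm_zero, of a sequentially \<eta>] by (simp add: c0_def)
  then obtain N where N: "\<And>n. N \<le> n \<Longrightarrow> norm (a n) < \<eta>" by (auto simp: eventually_sequentially)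
  have "(\<Sum>n<N'. lorentz_term q (\<lambda>n. if n \<in> F then a n else 0) n) \<le> \<epsilon>" if F: "F \<subseteq> {N..}" for F N'
  proof -
    define b where "b n = (if n \<in> F then a n else 0)" for n
    have finb: "finite {k. t \<le> norm (b k)}" if "0 < t" for t
      by (rule finite_subset[OF _ fin[OF that]]) (use that in \<open>auto simp: b_def split: if_splits\<close>)
    have r0: "0 \<le> rearrangement b n" for n by (rule rearrangement_ge0[OF finb])
    have r1: "rearrangement b n \<le> rearrangement a n" for n
      by (rule rearrangement_le_of_le[OF fin]) (auto simp: b_def)
    have r2: "rearrangement b n \<le> \<eta>" for n
      by (rule rearrangement_le_bound[OF finb]) (use F N \<eta> in \<open>auto simp: b_def less_imp_le subset_iff\<close>)
    have "(\<Sum>n<N'. lorentz_term q b n) \<le> (\<Sum>n<J + N'. lorentz_term q b n)"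
      by (intro sum_mono2 term_ge0) auto
    also have "\<dots> = (\<Sum>n<J. lorentz_term q b n) + (\<Sum>n<N'. lorentz_term q b (n + J))"
      by (induction N') (simp_all add: add.commute)
    also have "(\<Sum>n<J. lorentz_term q b n) \<le> (\<Sum>n<J. \<eta> powr q * (\<phi> (Suc n) powr q * (w n / \<phi> (Suc n))))"
    proof (rule sum_mono)
      fix n
      have "(rearrangement b n * \<phi> (Suc n)) powr q \<le> (\<eta> * \<phi> (Suc n)) powr q"
        using r0 r2 q \<phi>_ge0 by (intro powr_mono2 mult_right_mono) auto
      also have "\<dots> = \<eta> powr q * \<phi> (Suc n) powr q" using \<eta> \<phi>_ge0 by (simp add: powr_mult)
      finally have "lorentz_term q b n \<le> (\<eta> powr q * \<phi> (Suc n) powr q) * (w n / \<phi> (Suc n))"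
        unfolding lorentz_term_def using w_ge0 \<phi>_ge0 by (intro mult_right_mono) auto
      then show "lorentz_term q b n \<le> \<eta> powr q * (\<phi> (Suc n) powr q * (w n / \<phi> (Suc n)))" by (simp add: mult.assoc)
    qed
    also have "\<dots> = \<eta> powr q * S" unfolding S_def by (rule sum_distrib_left[symmetric])
    also have "\<dots> \<le> \<epsilon> / 2" by (rule \<eta>S)
    also have "(\<Sum>n<N'. lorentz_term q b (n + J)) \<le> (\<Sum>n<N'. lorentz_term q a (n + J))"
      unfolding lorentz_term_def using r0 r1 q w_ge0 \<phi>_ge0
      by (intro sum_mono mult_right_mono powr_mono2) auto
    also have "\<dots> \<le> (\<Sum>n. lorentz_term q a (n + J))"
      using sm by (intro sum_le_suminf) (auto simp: term_ge0 summable_iff_shift)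
    also have "\<dots> \<le> \<epsilon> / 2" using J by simp
    finally show ?thesis by (simp add: b_def[abs_def])
  qed
  then show ?thesis by blast
qed

lemma seq_embeds: "\<exists>q>1. seq_embeds_in_space smul x (lorentz_space q w)"
proof -
  obtain r0 where r0: "\<forall>r\<ge>r0. \<exists>B. \<forall>g. norm g \<le> 1/2 \<longrightarrow>
      (\<forall>n. (\<Sum>k<n. (dual.decr g k * \<psi> (M ^ k)) powr r) \<le> B)"
    using dual.decr_summable by blast
  \<comment> \<open>Enlarging the dual exponent is free, and \<open>r \<ge> 2\<close> ensures that
    its conjugate \<open>q\<close> is finite and larger than 1.\<close>
  define r where "r = max r0 2"
  obtain B where B: "\<And>g n. norm g \<le> 1/2 \<Longrightarrow> (\<Sum>k<n. (dual.decr g k * \<psi> (M ^ k)) powr r) \<le> B"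
  proof -
    have "r0 \<le> r" by (simp add: r_def)
    then show ?thesis using r0 that by blast
  qed
  have "0 \<le> B" using B[of 0 0] by simp
  have r: "1 < r" by (simp add: r_def)
  define q where "q = r / (r - 1)"
  have q: "1 < q" "1 / q + 1 / r = 1" using r by (auto simp: q_def field_simps)
  have "summable (\<lambda>n. smul (a n) (x n))" if a: "a \<in> lorentz_space q w" for a
    unfolding summable_Cauchy
  proof (intro allI impI)
    fix e :: real assume e: "0 < e"
    \<comment> \<open>The additional 1 turns the final estimate into a strict one.\<close>
    define Z where "Z = 4 * M * (1 + B) + 1"
    have Z: "0 < Z" using \<open>0 \<le> B\<close> by (simp add: Z_def add_nonneg_pos)
    define \<delta> where "\<delta> = e / Z"
    have \<delta>: "0 < \<delta>" using e Z by (simp add: \<delta>_def)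
    have small: "4 * M * \<delta> * (1 + B) < e"
    proof -
      have "4 * M * \<delta> * (1 + B) = \<delta> * (Z - 1)" by (simp add: Z_def)
      also have "\<dots> < \<delta> * Z" using \<delta> by simp
      finally show ?thesis using Z by (simp add: \<delta>_def)
    qed
    \<comment> \<open>The constant of \<open>blocks_le_term\<close> is divided out, so that the
      block sums are at most \<open>\<delta> powr q\<close>.\<close>
    define \<epsilon> where "\<epsilon> = \<delta> powr q / (2 * M powr q)"
    have \<epsilon>: "0 < \<epsilon>" using \<delta> M_ge2 by (simp add: \<epsilon>_def)
    obtain N where N: "\<And>F N'. F \<subseteq> {N..} \<Longrightarrow> (\<Sum>n<N'. lorentz_term q (\<lambda>n. if n \<in> F then a n else 0) n) \<le> \<epsilon>"
      using tails_small[OF a _ \<epsilon>] q by auto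
    show "\<exists>N. \<forall>m\<ge>N. \<forall>n. norm (\<Sum>n\<in>{m..<n}. smul (a n) (x n)) < e"
    proof (intro exI[of _ N] allI impI)
      fix m n assume m: "N \<le> m"
      define F where "F = {m..<n}"
      have fin: "finite {k. t \<le> norm (if k \<in> F then a k else 0)}" if "0 < t" for t
        by (rule finite_subset[of _ F]) (use that in \<open>auto simp: F_def split: if_splits\<close>)
      have "norm (\<Sum>n\<in>F. smul (a n) (x n)) \<le> 4 * M * \<delta> * (1 + B)"
      proof (rule norm_sum_le[OF q(1) r q(2) \<delta> _ B])
        fix K
        have "(\<Sum>k<K. (rearrangement (\<lambda>n. if n \<in> F then a n else 0) (M ^ k - 1) * \<phi> (M ^ k)) powr q)
          \<le> (\<Sum>k<Suc K. (rearrangement (\<lambda>n. if n \<in> F then a n else 0) (M ^ k - 1) * \<phi> (M ^ k)) powr q)"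
          by simp
        also have "\<dots> \<le> 2 * M powr q * (\<Sum>n<M ^ K. lorentz_term q (\<lambda>n. if n \<in> F then a n else 0) n)"
          using q by (intro blocks_le_term fin) auto
        also have "\<dots> \<le> 2 * M powr q * \<epsilon>"
          using m by (intro mult_left_mono N) (auto simp: F_def)
        also have "\<dots> = \<delta> powr q" using M_ge2 by (simp add: \<epsilon>_def)
        finally show "(\<Sum>k<K. (rearrangement (\<lambda>n. if n \<in> F then a n else 0) (M ^ k - 1) * \<phi> (M ^ k)) powr q)
          \<le> \<delta> powr q" .
      qed (simp_all add: F_def)
      then show "norm (\<Sum>n\<in>{m..<n}. smul (a n) (x n)) < e" using small by (simp add: F_def)
    qed
  qed
  then show ?thesis using q by (auto simp: seq_embeds_in_space_def)
qed

end

theorem theorem1p1: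
  fixes smul :: "'k::{real_normed_field,euclidean_space} \<Rightarrow> 'a::banach \<Rightarrow> 'a"
    and x :: "nat \<Rightarrow> 'a"
    and xs :: "nat \<Rightarrow> 'a \<Rightarrow> 'k"
    and w :: "nat \<Rightarrow> real"
  assumes "banach_over smul"
    and "infinite_dimensional smul"
    and "separable_type TYPE('a)"
    and "superreflexive (space_of smul)"
    and "is_basis smul x xs"
    and "almost_greedy smul x xs"
    and "\<forall>m\<ge>1. primitive w m = fundamental_fun smul x m"
  shows "\<exists>q r. 1 < q \<and> q < r \<and>
           seq_embeds_in_space smul x (lorentz_space q w) \<and>
           space_embeds_in_seq xs (lorentz_space r w)"
proof -
  interpret banach_over smul by (rule assms)
  interpret ag_basis_weight smul x xs w by unfold_locales (use assms in auto)
  obtain q where q: "1 < q" "seq_embeds_in_space smul x (lorentz_space q w)" using seq_embeds by blast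
  obtain r0 where "\<And>r. r0 \<le> r \<Longrightarrow> space_embeds_in_seq xs (lorentz_space r w)" using space_embeds by blast
  \<comment> \<open>Any exponent beyond \<open>r0\<close> works for the space, so the choice
    \<open>q + 1\<close> in the maximum secures \<open>q < r\<close>.\<close>
  then have "space_embeds_in_seq xs (lorentz_space (max r0 (q + 1)) w)" by simp
  then show ?thesis using q by (intro exI[of _ q] exI[of _ "max r0 (q + 1)"]) auto
qed

end
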